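(* Let $m,n,p$ be positive integers, let $X$ be an $m\times p$ matrix of rank $q$, let $\sigma>0$, and let $Y=XA+\sigma E$, where $A$ is a $p\times n$ matrix and $E$ is an $m\times n$ random matrix with i.i.d. standard Gaussian entries. Assume that $A=0$ and that $\hat r$ is any minimizer over $r\in\{1,\ldots,\min(n,q)-1\}$ of the criterion $$\mathrm{Crit}'(r)=\|Y-X\widehat A_r\|^2\left(1+\frac{\mathrm{pen}'(r)}{nm}\right)$$ with $$\mathrm{pen}'(r)=\frac{K\,\mathcal{S}_{q\times n}(r)^2}{1-\frac{K}{nm}\,\mathcal{S}_{q\times n}(r)^2}\qquad\text{for some } K<1.$$ Then, setting $\alpha=(1-K)/4>0$, we have $$\mathbb{P}\left(\hat r\ \ge\ \frac{1-K}{8}\times\frac{nq-1}{(\sqrt n+\sqrt q)^2}\right)\ \ge\ 1-2e^{\alpha^2/2}\,\frac{e^{-\alpha^2\max(n,q)/2}}{1-e^{-\alpha^2\max(n,q)/2}} .$$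
   Context: $\|\cdot\|$ denotes the Hilbert–Schmidt (Frobenius) norm. $\sigma_1(M)\ge\sigma_2(M)\ge\cdots$ are the singular values of a matrix $M$, and $\|M\|_{(2,r)}=\big(\sum_{k=1}^r\sigma_k(M)^2\big)^{1/2}$ is its Ky-Fan $(2,r)$-norm. For a $q\times n$ random matrix $G_{q\times n}$ with i.i.d. standard Gaussian entries, $\mathcal{S}_{q\times n}(r)=\mathbb{E}\big[\|G_{q\times n}\|_{(2,r)}\big]$. The matrix $X$ is deterministic. For each $r$, $\widehat A_r$ denotes a minimizer of $B\mapsto\|Y-XB\|$ over the $p\times n$ matrices $B$ of rank at most $r$ (so $\widehat A_r$ depends on $Y$). The set $\{1,\ldots,\min(n,q)-1\}$ over which the criterion is minimized is implicitly assumed non-empty.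
   Formalization: The formal theorem assumes 0 ≤ K < 1 instead of K < 1: for very negative K (e.g. K = −1000, m = n = p = q = 2) the threshold exceeds every admissible rank, so the probability is 0 while the right-hand side is nearly 1. *)

theory Defs
  imports
    "HOL-Probability.Probability"
    "Jordan_Normal_Form.Char_Poly"
    "Jordan_Normal_Form.DL_Rank"
begin

definition hs_norm :: "real mat \<Rightarrow> real" where
  "hs_norm M = sqrt (\<Sum>i<dim_row M. \<Sum>j<dim_col M. (M $$ (i, j))\<^sup>2)"

(* The roots of the characteristic polynomial are taken with multiplicity; a Gram matrix
   has only real nonnegative eigenvalues, so the list has dim_col M entries, in
   decreasing order. *)
definition singular_values :: "real mat \<Rightarrow> real list" where
  "singular_values M =
     map sqrt (rev (sorted_list_of_multiset (proots (char_poly (transpose_mat M * M)))))"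

(* Indexed from 1, with value 0 beyond the number of columns. *)
definition singular_value :: "nat \<Rightarrow> real mat \<Rightarrow> real" where
  "singular_value k M =
     (if 1 \<le> k \<and> k \<le> length (singular_values M) then singular_values M ! (k - 1) else 0)"

definition ky_fan2 :: "nat \<Rightarrow> real mat \<Rightarrow> real" where
  "ky_fan2 r M = sqrt (\<Sum>k=1..r. (singular_value k M)\<^sup>2)"

definition gaussian_entries :: "nat \<Rightarrow> nat \<Rightarrow> (nat \<times> nat \<Rightarrow> real) measure" where
  "gaussian_entries q n =
     PiM ({..<q} \<times> {..<n}) (\<lambda>_. density lborel std_normal_density)"

definition gauss_ky_fan :: "nat \<Rightarrow> nat \<Rightarrow> nat \<Rightarrow> real" where
  "gauss_ky_fan q n r = (LINT g|gaussian_entries q n. ky_fan2 r (mat q n g))"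

definition std_gaussian_matrix ::
    "'w measure \<Rightarrow> nat \<Rightarrow> nat \<Rightarrow> ('w \<Rightarrow> real mat) \<Rightarrow> bool" where
  "std_gaussian_matrix M m n E \<longleftrightarrow>
     (\<forall>\<omega>\<in>space M. E \<omega> \<in> carrier_mat m n) \<and>
     prob_space.indep_vars M (\<lambda>_. borel) (\<lambda>ij \<omega>. E \<omega> $$ ij) ({..<m} \<times> {..<n}) \<and>
     (\<forall>ij\<in>{..<m} \<times> {..<n}. distributed M lborel (\<lambda>\<omega>. E \<omega> $$ ij) std_normal_density)"

definition rank_restricted_lse ::
    "nat \<Rightarrow> nat \<Rightarrow> nat \<Rightarrow> real mat \<Rightarrow> real mat \<Rightarrow> real mat \<Rightarrow> bool" where
  "rank_restricted_lse p n r X Y \<equiv>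
     is_arg_min (\<lambda>B. hs_norm (Y - X * B))
       (\<lambda>B. B \<in> carrier_mat p n \<and> vec_space.rank p B \<le> r)"

definition pen' :: "real \<Rightarrow> nat \<Rightarrow> nat \<Rightarrow> nat \<Rightarrow> nat \<Rightarrow> real" where
  "pen' K m n q r =
     K * (gauss_ky_fan q n r)\<^sup>2 / (1 - K / (real n * real m) * (gauss_ky_fan q n r)\<^sup>2)"

definition crit' ::
    "real \<Rightarrow> nat \<Rightarrow> nat \<Rightarrow> nat \<Rightarrow> real mat \<Rightarrow> real mat \<Rightarrow> (nat \<Rightarrow> real mat) \<Rightarrow> nat \<Rightarrow> real" where
  "crit' K m n q X Y Ahat r =
     (hs_norm (Y - X * Ahat r))\<^sup>2 * (1 + pen' K m n q r / (real n * real m))"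

end

theory Submission
  imports Defs
begin

text \<open>
  For \<open>A = 0\<close> the residual sum of squares at rank \<open>r\<close> is \<open>\<sigma>\<^sup>2 (|E|\<^sup>2 - |G|\<^sub>r\<^sup>2)\<close>, where \<open>|G|\<^sub>r\<close> is the
  Ky Fan \<open>(2, r)\<close>-norm and \<open>G\<close> consists of the first \<open>q\<close> rows of \<open>R E\<close> for an orthogonal \<open>R\<close> that
  maps the range of \<open>X\<close> to the first \<open>q\<close> coordinates (Eckart--Young). By rotation invariance \<open>G\<close> is
  again a standard Gaussian matrix. Since \<open>1 + pen'(r) / nm = 1 / (1 - K S(r)\<^sup>2 / nm)\<close>, the
  selection of \<open>r\<close> instead of \<open>r\<^sup>* = min(n, q) - 1\<close> forces
  \<open>|G|\<^sub>r\<^sub>*\<^sup>2 \<le> |G|\<^sub>r\<^sup>2 + K S(r\<^sup>*)\<^sup>2 |E|\<^sup>2 / nm\<close>.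

  All three norms are Lipschitz functions of Gaussian vectors, hence close to their means. As
  \<open>S(r\<^sup>*)\<^sup>2\<close> is nearly \<open>nq\<close> while \<open>S(r)\<^sup>2 \<le> r E|G|\<^sub>1\<^sup>2 \<le> 2 r (sqrt n + sqrt q)\<^sup>2\<close> is less than
  \<open>\<alpha> nq\<close> below the threshold, the inequality fails outside three events of total probability
  \<open>2 x + x\<^sup>2\<close> with \<open>x = exp (- \<alpha>\<^sup>2 max(n, q) / 2)\<close>.

  The concentration inequality comes from Maurey's property \<open>(\<tau>)\<close>, which follows from the
  Prekopa--Leindler inequality on the line and passes to products. Its constant is not optimal,
  but the gap \<open>4 \<alpha>\<close> between \<open>K\<close> and \<open>1\<close> leaves enough room.
\<close>

subsection \<open>Gaussian concentration\<close>

text \<open>The Ky Fan norms are defined through the roots of a characteristic polynomial, which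
  shows neither measurability nor integrability. Both come from the Lipschitz bound
  \<open>ky_fan2_lipschitz_le\<close>: a Lipschitz function of finitely many coordinates is
  measurable by approximation with rational points, and property (tau) gives its exponential
  moments. Plane rotations serve twice. They triangularise and diagonalise matrices, and since each
  moves only two coordinates, invariance of the Gaussian law under their products reduces to an
  integral in the plane. The constants fit together as follows. Property (tau) yields tails
  \<open>exp (- t^2 / 4)\<close>, hence the deviations \<open>sqrt 2 * \<tau>\<close> and
  \<open>2 * \<tau>\<close> with \<open>\<tau>^2 = \<alpha>^2 * max n q\<close>. The factor 2 in the
  bound on the squared operator norm matches the threshold, whose factor \<open>(1 - K) / 8\<close>
  is \<open>\<alpha> / 2\<close>. A threshold of at most 1 is always reached; a larger one forces
  \<open>\<alpha> * min n q > 2\<close>, hence \<open>min n q >= 9\<close>, and this is the slack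
  that the constants consume.\<close>

text \<open>Brunn-Minkowski on the line. If \<open>p\<close> is the last point of \<open>P\<close>
  and \<open>q\<close> the first of \<open>Q\<close>, then \<open>(P + q) / 2\<close> and
  \<open>(p + Q) / 2\<close> both lie in the midpoint set and meet only at
  \<open>(p + q) / 2\<close>. A measurable superset \<open>H\<close> stands for the midpoint set,
  which need not be Borel.\<close>

lemma emeasure_midpoint_set_ge:
  fixes P Q H :: "real set"
  assumes [measurable]: "P \<in> sets borel" "Q \<in> sets borel" "H \<in> sets borel"
    and ne: "P \<noteq> {}" "Q \<noteq> {}" and bd: "bounded P" "bounded Q"
    and mid: "\<And>x y. x \<in> P \<Longrightarrow> y \<in> Q \<Longrightarrow> (x + y) / 2 \<in> H"
  shows "emeasure lborel P + emeasure lborel Q \<le> 2 * emeasure lborel H"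
proof -
  have half: "2 * emeasure lborel {z. 2 * z - t \<in> B} = emeasure lborel B"
    if [measurable]: "B \<in> sets borel" for B :: "real set" and t
  proof -
    have "emeasure lborel B = (\<integral>\<^sup>+x. indicator B x \<partial>lborel)" by simp
    also have "\<dots> = 2 * (\<integral>\<^sup>+x. indicator B (- t + 2 * x) \<partial>lborel)"
      by (subst nn_integral_real_affine[of _ 2 "- t"]) auto
    also have "(\<integral>\<^sup>+x. indicator B (- t + 2 * x) \<partial>lborel) = (\<integral>\<^sup>+x. indicator {z. 2 * z - t \<in> B} x \<partial>lborel)"
      by (intro nn_integral_cong) (auto simp: indicator_def)
    also have "\<dots> = emeasure lborel {z. 2 * z - t \<in> B}"
      by (subst nn_integral_indicator) auto
    finally show ?thesis by simp
  qed
  have eps: "emeasure lborel P + emeasure lborel Q \<le> 2 * emeasure lborel H + ennreal e"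
    if e: "0 < e" for e :: real
  proof -
    have bp: "bdd_above P" "bdd_below Q"
      using bd bounded_imp_bdd_above bounded_imp_bdd_below by auto
    obtain p where p: "p \<in> P" "Sup P - e/2 < p"
      using less_cSup_iff[OF ne(1) bp(1), of "Sup P - e/2"] e by auto
    obtain q where q: "q \<in> Q" "q < Inf Q + e/2"
      using cInf_less_iff[OF ne(2) bp(2), of "Inf Q + e/2"] e by auto
    \<comment> \<open>Supremum and infimum need not be attained. Cutting at nearly extremal points
      costs at most \<open>e / 2\<close> on each side, and the strict bound in \<open>Q'\<close>
      makes the two halves disjoint.\<close>
    define P' where "P' = P \<inter> {..p}"
    define Q' where "Q' = Q \<inter> {q<..}"
    have [measurable]: "P' \<in> sets borel" "Q' \<in> sets borel"
      unfolding P'_def Q'_def by auto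
    have "emeasure lborel P \<le> emeasure lborel (P' \<union> {p..Sup P})"
      by (rule emeasure_mono) (auto simp: P'_def dest: cSup_upper[OF _ bp(1)])
    also have "\<dots> \<le> emeasure lborel P' + emeasure lborel {p..Sup P}"
      by (rule emeasure_subadditive) auto
    also have "emeasure lborel {p..Sup P} \<le> ennreal (e/2)"
      using p by (cases "p \<le> Sup P") (auto intro!: ennreal_leI)
    finally have P: "emeasure lborel P \<le> emeasure lborel P' + ennreal (e/2)" by (simp add: add_left_mono)
    have "emeasure lborel Q \<le> emeasure lborel (Q' \<union> {Inf Q..q})"
      by (rule emeasure_mono) (auto simp: Q'_def dest: cInf_lower[OF _ bp(2)])
    also have "\<dots> \<le> emeasure lborel Q' + emeasure lborel {Inf Q..q}"
      by (rule emeasure_subadditive) auto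
    also have "emeasure lborel {Inf Q..q} \<le> ennreal (e/2)"
      using q by (cases "Inf Q \<le> q") (auto intro!: ennreal_leI)
    finally have Q: "emeasure lborel Q \<le> emeasure lborel Q' + ennreal (e/2)" by (simp add: add_left_mono)
    have "emeasure lborel P' + emeasure lborel Q'
        = 2 * (emeasure lborel {z. 2 * z - q \<in> P'} + emeasure lborel {z. 2 * z - p \<in> Q'})"
      using half[OF \<open>P' \<in> sets borel\<close>, of q] half[OF \<open>Q' \<in> sets borel\<close>, of p]
      by (simp add: distrib_left)
    also have "emeasure lborel {z. 2 * z - q \<in> P'} + emeasure lborel {z. 2 * z - p \<in> Q'}
        = emeasure lborel ({z. 2 * z - q \<in> P'} \<union> {z. 2 * z - p \<in> Q'})"
      by (rule plus_emeasure) (auto simp: P'_def Q'_def)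
    also have "\<dots> \<le> emeasure lborel H"
    proof (rule emeasure_mono)
      show "{z. 2 * z - q \<in> P'} \<union> {z. 2 * z - p \<in> Q'} \<subseteq> H"
        using mid[of "2 * z - q" q for z] mid[of p "2 * z - p" for z] p q
        by (auto simp: P'_def Q'_def)
    qed auto
    finally have "emeasure lborel P' + emeasure lborel Q' \<le> 2 * emeasure lborel H"
      by (simp add: mult_left_mono)
    moreover have "emeasure lborel P + emeasure lborel Q \<le>
        (emeasure lborel P' + ennreal (e/2)) + (emeasure lborel Q' + ennreal (e/2))"
      by (rule add_mono[OF P Q])
    moreover have "(emeasure lborel P' + ennreal (e/2)) + (emeasure lborel Q' + ennreal (e/2))
        = emeasure lborel P' + emeasure lborel Q' + ennreal e"
      using e by (simp add: ac_simps ennreal_plus[symmetric] del: ennreal_plus)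
    ultimately show ?thesis by (metis add_right_mono order_trans)
  qed
  show ?thesis
    by (rule ennreal_le_epsilon) (use eps in auto)
qed

text \<open>Layer-cake formula for the levels \<open>c * l\<close> with \<open>l < 1\<close>. If
  \<open>c\<close> is the supremum of \<open>f\<close>, these are the positive levels with a
  nonempty superlevel set and the minimum has no effect; for a smaller \<open>c\<close>, higher
  levels are cut off, which only loses mass.\<close>

lemma nn_integral_superlevel_sets:
  fixes f :: "real \<Rightarrow> real" and c :: real
  assumes [measurable]: "f \<in> borel_measurable borel" and f: "\<And>x. 0 \<le> f x" and c: "0 < c"
  shows "(\<integral>\<^sup>+l. indicator {0<..<1} l * emeasure lborel {x. c * l < f x} \<partial>lborel)
       = (\<integral>\<^sup>+x. ennreal (min 1 (f x / c)) \<partial>lborel)"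
proof -
  have "(\<integral>\<^sup>+l. indicator {0<..<1} l * emeasure lborel {x. c * l < f x} \<partial>lborel)
      = (\<integral>\<^sup>+l. (\<integral>\<^sup>+x. indicator {0<..<1} l * indicator {x. c * l < f x} x \<partial>lborel) \<partial>lborel)"
    by (intro nn_integral_cong, subst nn_integral_cmult, auto)
  also have "\<dots> = (\<integral>\<^sup>+x. (\<integral>\<^sup>+l. indicator {0<..<1} l * indicator {x. c * l < f x} x \<partial>lborel) \<partial>lborel)"
    by (rule lborel_pair.Fubini') (auto simp: indicator_def)
  also have "\<dots> = (\<integral>\<^sup>+x. ennreal (min 1 (f x / c)) \<partial>lborel)"
  proof (rule nn_integral_cong)
    fix x
    have "(\<integral>\<^sup>+l. indicator {0<..<1} l * indicator {x. c * l < f x} x \<partial>lborel)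
       = (\<integral>\<^sup>+l. indicator {0<..<min 1 (f x / c)} l \<partial>lborel)"
      using c by (intro nn_integral_cong) (auto simp: indicator_def field_simps)
    also have "\<dots> = ennreal (min 1 (f x / c))"
      using f[of x] c by (subst nn_integral_indicator) auto
    finally show "(\<integral>\<^sup>+l. indicator {0<..<1} l * indicator {x. c * l < f x} x \<partial>lborel) = ennreal (min 1 (f x / c))" .
  qed
  finally show ?thesis .
qed

text \<open>After division by the suprema \<open>A\<close> and \<open>B\<close>, the superlevel sets
  of \<open>f\<close> and \<open>g\<close> at a common level \<open>l < 1\<close> are both nonempty,
  so that Brunn-Minkowski applies to them. Integration over \<open>l\<close> yields the additive
  bound \<open>a + b <= 2 / D\<close>, and \<open>4 * a * b <= (a + b)^2\<close> turns it into the
  multiplicative one.\<close>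

lemma prekopa_leindler_midpoint_bounded:
  fixes f g h :: "real \<Rightarrow> real"
  assumes [measurable]: "f \<in> borel_measurable borel" "g \<in> borel_measurable borel" "h \<in> borel_measurable borel"
    and nn: "\<And>x. 0 \<le> f x" "\<And>x. 0 \<le> g x" "\<And>x. 0 \<le> h x"
    and bd: "\<And>x. f x \<le> C" "\<And>x. g x \<le> C"
    and supp: "\<And>x. C < \<bar>x\<bar> \<Longrightarrow> f x = 0" "\<And>x. C < \<bar>x\<bar> \<Longrightarrow> g x = 0"
    and le: "\<And>x y. f x * g y \<le> (h ((x + y) / 2))\<^sup>2"
    and h1: "(\<integral>\<^sup>+x. ennreal (h x) \<partial>lborel) \<le> 1"
  shows "(\<integral>\<^sup>+x. ennreal (f x) \<partial>lborel) * (\<integral>\<^sup>+x. ennreal (g x) \<partial>lborel) \<le> 1"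
proof (cases "(\<exists>x. f x \<noteq> 0) \<and> (\<exists>x. g x \<noteq> 0)")
  case False
  then show ?thesis by auto
next
  case True
  then obtain x0 y0 where x0: "0 < f x0" and y0: "0 < g y0"
    using nn by (metis less_eq_real_def)
  have bdd: "bdd_above (range f)" "bdd_above (range g)"
    using bd by (auto intro!: bdd_aboveI)
  define A where "A = (SUP x. f x)"
  define B where "B = (SUP x. g x)"
  have fA: "f x \<le> A" and gB: "g x \<le> B" for x
    unfolding A_def B_def using bdd by (auto intro: cSUP_upper)
  have A: "0 < A" and B: "0 < B"
    using x0 y0 fA[of x0] gB[of y0] by auto
  \<comment> \<open>The geometric mean is the right scale for \<open>h\<close>: where
    \<open>f x > A * l\<close> and \<open>g y > B * l\<close>, the hypothesis gives
    \<open>h > D * l\<close> at the midpoint.\<close>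
  define D where "D = sqrt (A * B)"
  have D: "0 < D" using A B by (simp add: D_def)
  have level: "emeasure lborel {x. A * l < f x} + emeasure lborel {x. B * l < g x}
      \<le> 2 * emeasure lborel {x. D * l < h x}" if l: "0 < l" "l < 1" for l
  proof (rule emeasure_midpoint_set_ge)
    have "\<exists>x. A * l < f x"
      using less_cSUP_iff[OF _ bdd(1), of "A * l"] A l unfolding A_def[symmetric] by auto
    then show "{x. A * l < f x} \<noteq> {}" by auto
    have "\<exists>x. B * l < g x"
      using less_cSUP_iff[OF _ bdd(2), of "B * l"] B l unfolding B_def[symmetric] by auto
    then show "{x. B * l < g x} \<noteq> {}" by auto
    show "bounded {x. A * l < f x}" "bounded {x. B * l < g x}"
      using A B l supp unfolding bounded_iff
      by (auto intro!: exI[of _ C]) (metis not_le_imp_less not_less_iff_gr_or_eq mult_pos_pos)+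
    fix x y assume xy: "x \<in> {x. A * l < f x}" "y \<in> {x. B * l < g x}"
    have "(D * l)\<^sup>2 = (A * l) * (B * l)"
      using A B by (simp add: D_def power2_eq_square)
    also have "\<dots> < f x * g y"
      using xy mult_pos_pos[OF A l(1)] mult_pos_pos[OF B l(1)] by (intro mult_strict_mono) auto
    also have "\<dots> \<le> (h ((x + y) / 2))\<^sup>2" by (rule le)
    finally show "(x + y) / 2 \<in> {x. D * l < h x}"
      using nn(3) power_less_imp_less_base by auto
  qed auto
  have fi: "(\<integral>\<^sup>+x. ennreal (f x) \<partial>lborel) = A * (\<integral>\<^sup>+x. ennreal (min 1 (f x / A)) \<partial>lborel)"
  proof -
    have "f x = A * min 1 (f x / A)" for x
      using A fA[of x] by (auto simp: min_def field_simps)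
    then have "ennreal (f x) = ennreal A * ennreal (min 1 (f x / A))" for x
      using A by (metis ennreal_mult' less_imp_le)
    then show ?thesis
      by (simp add: nn_integral_cmult)
  qed
  have gi: "(\<integral>\<^sup>+x. ennreal (g x) \<partial>lborel) = B * (\<integral>\<^sup>+x. ennreal (min 1 (g x / B)) \<partial>lborel)"
  proof -
    have "g x = B * min 1 (g x / B)" for x
      using B gB[of x] by (auto simp: min_def field_simps)
    then have "ennreal (g x) = ennreal B * ennreal (min 1 (g x / B))" for x
      using B by (metis ennreal_mult' less_imp_le)
    then show ?thesis
      by (simp add: nn_integral_cmult)
  qed
  define a where "a = (\<integral>\<^sup>+x. ennreal (min 1 (f x / A)) \<partial>lborel)"
  define b where "b = (\<integral>\<^sup>+x. ennreal (min 1 (g x / B)) \<partial>lborel)"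
  have "a + b = (\<integral>\<^sup>+l. indicator {0<..<1} l * emeasure lborel {x. A * l < f x} \<partial>lborel)
        + (\<integral>\<^sup>+l. indicator {0<..<1} l * emeasure lborel {x. B * l < g x} \<partial>lborel)"
    unfolding a_def b_def
    using nn_integral_superlevel_sets[of f A] nn_integral_superlevel_sets[of g B] A B nn by simp
  also have "\<dots> = (\<integral>\<^sup>+l. indicator {0<..<1} l *
       (emeasure lborel {x. A * l < f x} + emeasure lborel {x. B * l < g x}) \<partial>lborel)"
    by (subst nn_integral_add[symmetric]) (auto simp: distrib_left)
  also have "\<dots> \<le> (\<integral>\<^sup>+l. 2 * (indicator {0<..<1} l * emeasure lborel {x. D * l < h x}) \<partial>lborel)"
    using level by (intro nn_integral_mono) (auto simp: indicator_def)
  also have "\<dots> = 2 * (\<integral>\<^sup>+l. indicator {0<..<1} l * emeasure lborel {x. D * l < h x} \<partial>lborel)"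
    by (rule nn_integral_cmult) auto
  also have "\<dots> = 2 * (\<integral>\<^sup>+x. ennreal (min 1 (h x / D)) \<partial>lborel)"
    using nn_integral_superlevel_sets[of h D] D nn by simp
  also have "\<dots> \<le> 2 * (\<integral>\<^sup>+x. ennreal (1 / D) * ennreal (h x) \<partial>lborel)"
    using D nn by (intro mult_left_mono nn_integral_mono) (auto simp: ennreal_mult'[symmetric] intro!: ennreal_leI)
  also have "\<dots> = 2 * (ennreal (1 / D) * (\<integral>\<^sup>+x. ennreal (h x) \<partial>lborel))"
    by (subst nn_integral_cmult) auto
  also have "\<dots> \<le> 2 * (ennreal (1 / D) * 1)"
    by (intro mult_left_mono h1) auto
  also have "\<dots> = ennreal (2 / D)"
    using D by (simp add: ennreal_mult'[symmetric] ennreal_numeral[symmetric] del: ennreal_numeral)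
  finally have ab: "a + b \<le> ennreal (2 / D)" .
  then have "a < \<top>" "b < \<top>"
    by (auto simp: less_top[symmetric] top_unique)
  then obtain a' b' where a': "a = ennreal a'" "0 \<le> a'" and b': "b = ennreal b'" "0 \<le> b'"
    by (metis ennreal_cases less_irrefl)
  have sum: "a' + b' \<le> 2 / D"
    using ab a' b' D by (simp add: ennreal_plus[symmetric] del: ennreal_plus)
  have "4 * (a' * b') \<le> (a' + b')\<^sup>2"
    using zero_le_power2[of "a' - b'"] by (simp add: power2_eq_square algebra_simps)
  also have "\<dots> \<le> (2 / D)\<^sup>2" using sum a' b' by (intro power_mono) auto
  also have "\<dots> = 4 / (A * B)" using A B by (simp add: D_def power_divide)
  finally have "A * B * (a' * b') \<le> 1" using A B by (simp add: field_simps)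
  then have "ennreal (A * a' * (B * b')) \<le> 1"
    by (simp add: ennreal_1[symmetric] mult_ac del: ennreal_1)
  then show ?thesis
    unfolding fi gi a_def[symmetric] b_def[symmetric] a' b' using a' b' A B
    by (simp add: ennreal_mult'[symmetric])
qed

section \<open>Property (tau) of Gaussian measures\<close>

abbreviation std_normal :: "real measure" where
  "std_normal \<equiv> density lborel (\<lambda>x. ennreal (std_normal_density x))"

lemma prob_space_std_normal: "prob_space std_normal"
  by (rule prob_space_normal_density) simp

lemma nn_integral_std_normal:
  "f \<in> borel_measurable borel \<Longrightarrow>
    (\<integral>\<^sup>+x. f x \<partial>std_normal) = (\<integral>\<^sup>+x. ennreal (std_normal_density x) * f x \<partial>lborel)"
  by (rule nn_integral_density) auto

text \<open>With \<open>\<phi>\<close> the Gaussian density, \<open>\<phi> x * \<phi> y * exp ((x - y)\<^sup>2 / 4) = (\<phi> ((x + y) / 2))\<^sup>2\<close>, so that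
  Prekopa--Leindler applies to \<open>u \<phi>\<close> and \<open>v \<phi>\<close>. The truncations \<open>t k\<close> make these functions bounded
  with bounded support.\<close>

lemma std_normal_property_tau:
  fixes u v :: "real \<Rightarrow> ennreal"
  assumes [measurable]: "u \<in> borel_measurable borel" "v \<in> borel_measurable borel"
    and le: "\<And>x y. u x * v y \<le> ennreal (exp ((x - y)\<^sup>2 / 4))"
  shows "(\<integral>\<^sup>+x. u x \<partial>std_normal) * (\<integral>\<^sup>+x. v x \<partial>std_normal) \<le> 1"
proof -
  define t where "t k w x = std_normal_density x * enn2real (min (w x) (of_nat k)) * indicator {- real k..real k} x"
    for k :: nat and w :: "real \<Rightarrow> ennreal" and x
  have t_meas [measurable]: "t k w \<in> borel_measurable borel" if [measurable]: "w \<in> borel_measurable borel" for k w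
    unfolding t_def by measurable
  have t_enn: "ennreal (t k w x) = ennreal (std_normal_density x) * (min (w x) (of_nat k) * indicator {- real k..real k} x)"
    for k w x
  proof -
    have "min (w x) (of_nat k) < \<top>" by (simp add: min_less_iff_disj of_nat_less_top)
    then show ?thesis
      unfolding t_def by (auto simp: ennreal_mult' ennreal_enn2real indicator_def)
  qed
  have t_sup: "(\<integral>\<^sup>+x. w x \<partial>std_normal) = (SUP k. \<integral>\<^sup>+x. ennreal (t k w x) \<partial>lborel)"
    if [measurable]: "w \<in> borel_measurable borel" for w
  proof -
    have sup: "(SUP k. min (w x) (of_nat k) * indicator {- real k..real k} x) = w x" for x
    proof (rule antisym)
      show "(SUP k. min (w x) (of_nat k) * indicator {- real k..real k} x) \<le> w x"
        by (rule SUP_least) (auto simp: indicator_def)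
      show "w x \<le> (SUP k. min (w x) (of_nat k) * indicator {- real k..real k} x)"
      proof (rule ccontr)
        assume "\<not> ?thesis"
        then have *: "(SUP k. min (w x) (of_nat k) * indicator {- real k..real k} x) < w x" by simp
        \<comment> \<open>The supremum is finite, hence below some natural number \<open>j\<close>.
          Once \<open>k\<close> is at least \<open>j\<close> and \<open>\<bar>x\<bar>\<close>, the
          truncated value is \<open>w x\<close> or at least \<open>j\<close>, and both exceed the
          supremum.\<close>
        then obtain j where j: "(SUP k. min (w x) (of_nat k) * indicator {- real k..real k} x) < of_nat j"
          by (metis ennreal_SUP_of_nat_eq_top less_SUP_iff less_le_trans top_greatest)
        obtain l where l: "\<bar>x\<bar> \<le> real l" using real_arch_simple by blast
        define k where "k = max j l"
        have "min (w x) (of_nat k) * indicator {- real k..real k} x = min (w x) (of_nat k)"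
          using l by (auto simp: k_def indicator_def)
        moreover have "of_nat j \<le> (of_nat k :: ennreal)" by (auto simp: k_def)
        ultimately have "(SUP k. min (w x) (of_nat k) * indicator {- real k..real k} x)
            < min (w x) (of_nat k) * indicator {- real k..real k} x"
          using * j by (simp add: min_def less_le_trans)
        then show False
          by (meson SUP_upper UNIV_I not_le)
      qed
    qed
    have "ennreal (std_normal_density x) * w x = (SUP k. ennreal (t k w x))" for x
      by (simp only: t_enn SUP_mult_left_ennreal[symmetric] sup)
    then have "(\<integral>\<^sup>+x. w x \<partial>std_normal) = (\<integral>\<^sup>+x. (SUP k. ennreal (t k w x)) \<partial>lborel)"
      using nn_integral_std_normal[OF that] by simp
    also have "\<dots> = (SUP k. \<integral>\<^sup>+x. ennreal (t k w x) \<partial>lborel)"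
    proof (rule nn_integral_monotone_convergence_SUP)
      show "incseq (\<lambda>k x. ennreal (t k w x))"
      proof (intro incseq_SucI le_funI)
        fix k x
        have "min (w x) (of_nat k) \<le> min (w x) (of_nat (Suc k))"
          by (intro min.mono order_refl) (simp only: of_nat_le_iff le_Suc_eq, simp)
        moreover have "(indicator {- real k..real k} x :: ennreal) \<le> indicator {- real (Suc k)..real (Suc k)} x"
          by (auto simp: indicator_def)
        ultimately show "ennreal (t k w x) \<le> ennreal (t (Suc k) w x)"
          unfolding t_enn by (intro mult_left_mono mult_mono) simp_all
      qed
    qed auto
    finally show ?thesis .
  qed
  have "(\<integral>\<^sup>+x. ennreal (t k u x) \<partial>lborel) * (\<integral>\<^sup>+x. ennreal (t l v x) \<partial>lborel) \<le> 1" for k l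
  proof (rule prekopa_leindler_midpoint_bounded[where h = std_normal_density and C = "real k + real l"])
    have dens1: "std_normal_density x \<le> 1" for x
    proof -
      have "1 / sqrt (2 * pi) \<le> 1" using pi_gt3 by (simp add: real_le_lsqrt)
      then show ?thesis unfolding std_normal_density_def
        by (intro mult_le_one) auto
    qed
    have e2r: "enn2real (min c (of_nat k)) \<le> real k" for c k
      by (rule enn2real_leI) (auto simp: ennreal_of_nat_eq_real_of_nat)
    have tle: "t k w x \<le> real k" for k w x
    proof -
      have "std_normal_density x * enn2real (min (w x) (of_nat k)) \<le> 1 * real k"
        by (intro mult_mono dens1 e2r) simp_all
      then show ?thesis unfolding t_def by (cases "x \<in> {- real k..real k}") simp_all
    qed
    show "t k u x \<le> real k + real l" "t l v x \<le> real k + real l" for x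
      using tle[of k u x] tle[of l v x] by auto
    show "t k u x = 0" "t l v x = 0" if "real k + real l < \<bar>x\<bar>" for x
      using that by (auto simp: t_def indicator_def)
    show "0 \<le> t k u x" "0 \<le> t l v x" "0 \<le> std_normal_density x" for x
      by (auto simp: t_def)
    have "(\<integral>\<^sup>+x. ennreal (std_normal_density x) \<partial>lborel) = emeasure std_normal (space std_normal)"
      by (simp add: emeasure_density)
    also have "\<dots> = 1" using prob_space_std_normal by (rule prob_space.emeasure_space_1)
    finally show "(\<integral>\<^sup>+x. ennreal (std_normal_density x) \<partial>lborel) \<le> 1" by simp
    fix x y
    have "ennreal (t k u x * t l v y) = ennreal (t k u x) * ennreal (t l v y)"
      by (rule ennreal_mult) (auto simp: t_def)
    also have "\<dots> \<le> (ennreal (std_normal_density x) * u x) * (ennreal (std_normal_density y) * v y)"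
      unfolding t_enn by (intro mult_mono) (auto simp: indicator_def)
    also have "\<dots> = ennreal (std_normal_density x * std_normal_density y) * (u x * v y)"
      by (simp add: ennreal_mult' mult_ac)
    also have "\<dots> \<le> ennreal (std_normal_density x * std_normal_density y) * ennreal (exp ((x - y)\<^sup>2 / 4))"
      by (intro mult_left_mono le) auto
    also have "\<dots> = ennreal (std_normal_density x * std_normal_density y * exp ((x - y)\<^sup>2 / 4))"
      by (simp add: ennreal_mult')
    also have "std_normal_density x * std_normal_density y * exp ((x - y)\<^sup>2 / 4)
        = (std_normal_density ((x + y) / 2))\<^sup>2"
    proof -
      have "exp (- x\<^sup>2 / 2) * exp (- y\<^sup>2 / 2) * exp ((x - y)\<^sup>2 / 4) = (exp (- ((x + y) / 2)\<^sup>2 / 2))\<^sup>2"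
        unfolding exp_add[symmetric] exp_double[symmetric]
        by (intro arg_cong[where f=exp]) (simp add: power2_eq_square field_simps)
      then show ?thesis
        unfolding std_normal_density_def power_mult_distrib by (simp add: power2_eq_square mult_ac)
    qed
    finally show "t k u x * t l v y \<le> (std_normal_density ((x + y) / 2))\<^sup>2"
      by (subst (asm) ennreal_le_iff) auto
  qed (auto intro: t_meas)
  then show ?thesis
    unfolding t_sup[of u, OF assms(1)] t_sup[of v, OF assms(2)]
    by (subst SUP_mult_right_ennreal, intro SUP_least, subst SUP_mult_left_ennreal, intro SUP_least)
qed

abbreviation gauss_PiM :: "'i set \<Rightarrow> ('i \<Rightarrow> real) measure" where
  "gauss_PiM I \<equiv> PiM I (\<lambda>_. std_normal)"

lemma product_prob_space_std_normal: "product_prob_space (\<lambda>_::'i. std_normal)"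
  by (intro product_prob_spaceI prob_space_std_normal)

lemma prob_space_gauss_PiM: "prob_space (gauss_PiM I)"
  by (intro prob_space_PiM prob_space_std_normal)

text \<open>Tensorisation: with the other coordinates fixed and \<open>S\<close> their share of the
  cost, the one-dimensional property for \<open>exp (- S) * u\<close> and \<open>v\<close> shows
  that the partial integrals \<open>U\<close> and \<open>V\<close> satisfy the hypothesis with one
  coordinate less.\<close>

lemma gauss_PiM_property_tau:
  fixes u v :: "('i \<Rightarrow> real) \<Rightarrow> ennreal"
  assumes "finite I" "u \<in> borel_measurable (gauss_PiM I)" "v \<in> borel_measurable (gauss_PiM I)"
    and "\<And>x y. x \<in> space (gauss_PiM I) \<Longrightarrow> y \<in> space (gauss_PiM I) \<Longrightarrow>
           u x * v y \<le> ennreal (exp ((\<Sum>i\<in>I. (x i - y i)\<^sup>2) / 4))"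
  shows "(\<integral>\<^sup>+x. u x \<partial>gauss_PiM I) * (\<integral>\<^sup>+x. v x \<partial>gauss_PiM I) \<le> 1"
  using assms
proof (induction I arbitrary: u v rule: finite_induct)
  case empty
  interpret product_prob_space "\<lambda>_::'i. std_normal" by (rule product_prob_space_std_normal)
  show ?case
    using empty.prems(3)[of "\<lambda>_. undefined" "\<lambda>_. undefined"]
    by (simp add: PiM_empty nn_integral_count_space_finite space_PiM)
next
  case (insert i I)
  interpret product_prob_space "\<lambda>_::'i. std_normal" by (rule product_prob_space_std_normal)
  note [measurable] = insert.prems(1,2)
  have upd: "(\<lambda>y. h (x(i := y))) \<in> borel_measurable borel"
    if "x \<in> space (gauss_PiM I)" "h \<in> borel_measurable (gauss_PiM (insert i I))" for x and h :: "_ \<Rightarrow> ennreal"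
    using measurable_comp[OF measurable_component_update[OF that(1) \<open>i \<notin> I\<close>] that(2)]
    by (simp add: comp_def)
  have spc: "x(i := s) \<in> space (gauss_PiM (insert i I))" if "x \<in> space (gauss_PiM I)" for x s
    using that by (auto simp: space_PiM PiE_iff extensional_def)
  define U where "U x = (\<integral>\<^sup>+s. u (x(i := s)) \<partial>std_normal)" for x
  define V where "V x = (\<integral>\<^sup>+s. v (x(i := s)) \<partial>std_normal)" for x
  have "(\<integral>\<^sup>+x. U x \<partial>gauss_PiM I) * (\<integral>\<^sup>+x. V x \<partial>gauss_PiM I) \<le> 1"
  proof (rule insert.IH)
    show "U \<in> borel_measurable (gauss_PiM I)" "V \<in> borel_measurable (gauss_PiM I)"
      unfolding U_def V_def by measurable
    fix x y assume x: "x \<in> space (gauss_PiM I)" and y: "y \<in> space (gauss_PiM I)"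
    define S where "S = (\<Sum>i\<in>I. (x i - y i)\<^sup>2) / 4"
    note [measurable] = upd[OF x insert.prems(1)] upd[OF y insert.prems(2)]
    have "(\<integral>\<^sup>+s. ennreal (exp (- S)) * u (x(i := s)) \<partial>std_normal) * V y \<le> 1"
      unfolding V_def
    proof (rule std_normal_property_tau)
      fix s t
      have "(\<Sum>j\<in>insert i I. ((x(i := s)) j - (y(i := t)) j)\<^sup>2) = (s - t)\<^sup>2 + (\<Sum>j\<in>I. (x j - y j)\<^sup>2)"
        using insert.hyps by (subst sum.insert) (auto intro!: arg_cong2[where f="(+)"] sum.cong)
      then have "u (x(i := s)) * v (y(i := t)) \<le> ennreal (exp ((s - t)\<^sup>2 / 4 + S))"
        using insert.prems(3)[OF spc[OF x, of s] spc[OF y, of t]]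
        by (simp add: S_def add_divide_distrib del: fun_upd_apply)
      then have "ennreal (exp (- S)) * (u (x(i := s)) * v (y(i := t)))
          \<le> ennreal (exp (- S)) * ennreal (exp ((s - t)\<^sup>2 / 4 + S))"
        by (rule mult_left_mono) simp
      also have "\<dots> = ennreal (exp ((s - t)\<^sup>2 / 4))"
        by (simp add: ennreal_mult'[symmetric] exp_add[symmetric])
      finally show "ennreal (exp (- S)) * u (x(i := s)) * v (y(i := t)) \<le> ennreal (exp ((s - t)\<^sup>2 / 4))"
        by (simp add: mult_ac)
    qed auto
    also have "(\<integral>\<^sup>+s. ennreal (exp (- S)) * u (x(i := s)) \<partial>std_normal) = ennreal (exp (- S)) * U x"
      unfolding U_def by (rule nn_integral_cmult) auto
    finally have "ennreal (exp S) * (ennreal (exp (- S)) * U x * V y) \<le> ennreal (exp S) * 1"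
      by (rule mult_left_mono) simp
    also have "ennreal (exp S) * (ennreal (exp (- S)) * U x * V y) = U x * V y"
      by (simp add: mult.assoc[symmetric] ennreal_mult'[symmetric] exp_add[symmetric])
    finally show "U x * V y \<le> ennreal (exp ((\<Sum>i\<in>I. (x i - y i)\<^sup>2) / 4))" by (simp add: S_def)
  qed
  then show ?case
    unfolding U_def V_def
    by (simp add: product_nn_integral_insert[OF insert.hyps(1,2)] insert.prems)
qed

section \<open>Concentration of Lipschitz functions\<close>

text \<open>Points are taken from \<open>PiE I\<close>, the space of \<open>gauss_PiM I\<close>. The
  condition \<open>0 <= L\<close> does not follow from the inequality when \<open>I\<close> is
  empty.\<close>

definition lipschitz_L2 :: "'i set \<Rightarrow> real \<Rightarrow> (('i \<Rightarrow> real) \<Rightarrow> real) \<Rightarrow> bool" where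
  "lipschitz_L2 I L F \<longleftrightarrow> 0 \<le> L \<and>
     (\<forall>x\<in>PiE I (\<lambda>_. UNIV). \<forall>y\<in>PiE I (\<lambda>_. UNIV). \<bar>F x - F y\<bar> \<le> L * L2_set (\<lambda>i. x i - y i) I)"

lemma lipschitz_L2D:
  "lipschitz_L2 I L F \<Longrightarrow> x \<in> space (gauss_PiM I) \<Longrightarrow> y \<in> space (gauss_PiM I) \<Longrightarrow>
    \<bar>F x - F y\<bar> \<le> L * L2_set (\<lambda>i. x i - y i) I"
  by (auto simp: lipschitz_L2_def space_PiM)

lemma lipschitz_L2_scale: "lipschitz_L2 I L F \<Longrightarrow> lipschitz_L2 I (\<bar>c\<bar> * L) (\<lambda>x. c * F x)"
  unfolding lipschitz_L2_def
  by (auto simp: right_diff_distrib[symmetric] abs_mult mult.assoc intro!: mult_left_mono)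

text \<open>Makes the Ky Fan norms measurable without a look at the roots that define them. By the
  Lipschitz bound a strict sublevel set is the union, over the countably many rational points
  \<open>y\<close>, of sets that are given by the distance from \<open>y\<close>.\<close>

lemma lipschitz_L2_measurable:
  assumes I: "finite I" and F: "lipschitz_L2 I L F"
  shows "F \<in> borel_measurable (gauss_PiM I)"
proof (subst borel_measurable_iff_less, intro allI)
  fix c
  let ?M = "gauss_PiM I"
  have L: "0 \<le> L" using F by (simp add: lipschitz_L2_def)
  have D: "PiE I (\<lambda>_. \<rat>) \<subseteq> space ?M" by (auto simp: space_PiM)
  have "{x \<in> space ?M. F x < c}
      = (\<Union>y\<in>PiE I (\<lambda>_. \<rat>). {x \<in> space ?M. F y + L * L2_set (\<lambda>i. x i - y i) I < c})"
  proof (intro antisym subsetI)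
    fix x assume x: "x \<in> {x \<in> space ?M. F x < c}"
    \<comment> \<open>The distance from \<open>x\<close> to \<open>y\<close> is at most
      \<open>card I * e\<close> and is paid twice, once for \<open>F y\<close> against
      \<open>F x\<close> and once for the added term; the summand 1 makes the final inequality
      strict.\<close>
    define k where "k = 2 * L * card I + 1"
    have k: "0 < k" using L by (auto simp: k_def intro: add_nonneg_pos)
    define e where "e = (c - F x) / k"
    have e: "0 < e" using x k by (auto simp: e_def)
    have "\<exists>r\<in>\<rat>. \<bar>x i - r\<bar> < e" for i
      using Rats_dense_in_real[of "x i - e" "x i + e"] e by (force simp: abs_less_iff)
    then obtain r where r: "\<And>i. r i \<in> \<rat>" "\<And>i. \<bar>x i - r i\<bar> < e" by metis
    define y where "y = restrict r I"
    have y: "y \<in> PiE I (\<lambda>_. \<rat>)" using r by (auto simp: y_def)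
    have "L2_set (\<lambda>i. x i - y i) I \<le> (\<Sum>i\<in>I. \<bar>x i - y i\<bar>)" by (rule L2_set_le_sum_abs)
    also have "\<dots> \<le> (\<Sum>i\<in>I. e)" using r by (intro sum_mono) (auto simp: y_def less_imp_le)
    finally have n: "L2_set (\<lambda>i. x i - y i) I \<le> card I * e" by simp
    have "F y \<le> F x + L * L2_set (\<lambda>i. x i - y i) I"
      using lipschitz_L2D[OF F, of x y] x y D by auto
    then have "F y + L * L2_set (\<lambda>i. x i - y i) I \<le> F x + 2 * L * (card I * e)"
      using mult_left_mono[OF n L] by simp
    also have "\<dots> < F x + k * e"
      using e by (simp add: k_def algebra_simps)
    also have "\<dots> = c" using k by (simp add: e_def)
    finally show "x \<in> (\<Union>y\<in>PiE I (\<lambda>_. \<rat>). {x \<in> space ?M. F y + L * L2_set (\<lambda>i. x i - y i) I < c})"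
      using x y by blast
  next
    fix x assume "x \<in> (\<Union>y\<in>PiE I (\<lambda>_. \<rat>). {x \<in> space ?M. F y + L * L2_set (\<lambda>i. x i - y i) I < c})"
    then obtain y where "y \<in> space ?M" and x: "x \<in> space ?M" "F y + L * L2_set (\<lambda>i. x i - y i) I < c"
      using D by auto
    then have "F x \<le> F y + L * L2_set (\<lambda>i. x i - y i) I"
      using lipschitz_L2D[OF F, of x y] by auto
    then show "x \<in> {x \<in> space ?M. F x < c}" using x by auto
  qed
  also have "\<dots> \<in> sets ?M"
  proof (rule sets.countable_UN'')
    show "countable (PiE I (\<lambda>_. \<rat> :: real set))"
      using I by (intro countable_PiE countable_rat)
    fix y :: "'a \<Rightarrow> real"
    have "(\<lambda>x. F y + L * L2_set (\<lambda>i. x i - y i) I) \<in> borel_measurable ?M"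
      unfolding L2_set_def by measurable
    then show "{x \<in> space ?M. F y + L * L2_set (\<lambda>i. x i - y i) I < c} \<in> sets ?M"
      by measurable
  qed
  finally show "{x \<in> space ?M. F x < c} \<in> sets ?M" .
qed

lemma abs_le_exp_add_exp: "\<bar>y\<bar> \<le> exp y + exp (- y)" for y :: real
  using exp_ge_add_one_self[of y] exp_ge_add_one_self[of "- y"] exp_gt_zero[of y] exp_gt_zero[of "- y"]
  by linarith

text \<open>For nonnegative \<open>y\<close> this is the sum of
  \<open>exp y >= 1 + y + y^2 / 2\<close> and \<open>exp (- y) >= 1 - y\<close>; both sides are
  even.\<close>

lemma square_le_exp_add_exp: "y\<^sup>2 \<le> 2 * (exp y + exp (- y) - 2)" for y :: real
proof -
  have *: "y\<^sup>2 \<le> 2 * (exp y + exp (- y) - 2)" if "0 \<le> y" for y :: real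
    using exp_lower_Taylor_quadratic[OF that] exp_ge_add_one_self[of "- y"] by simp
  show ?thesis using *[of y] *[of "- y"] by (cases "0 \<le> y") (auto simp: add.commute)
qed

text \<open>Property (tau) for \<open>exp (F - L^2)\<close> and \<open>exp (- F)\<close>, where
  \<open>L * r <= r^2 / 4 + L^2\<close> provides the cost. Since the integrals are nonnegative ones,
  no integrability has to be known in advance.\<close>

lemma nn_integral_exp_lipschitz:
  assumes I: "finite I" and F: "lipschitz_L2 I L F"
  shows "(\<integral>\<^sup>+x. ennreal (exp (F x)) \<partial>gauss_PiM I) * (\<integral>\<^sup>+x. ennreal (exp (- F x)) \<partial>gauss_PiM I)
          \<le> ennreal (exp (L\<^sup>2))"
proof -
  note [measurable] = lipschitz_L2_measurable[OF I F]
  have "(\<integral>\<^sup>+x. ennreal (exp (- L\<^sup>2)) * ennreal (exp (F x)) \<partial>gauss_PiM I) * (\<integral>\<^sup>+x. ennreal (exp (- F x)) \<partial>gauss_PiM I) \<le> 1"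
  proof (rule gauss_PiM_property_tau[OF I])
    fix x y assume x: "x \<in> space (gauss_PiM I)" and y: "y \<in> space (gauss_PiM I)"
    define r where "r = L2_set (\<lambda>i. x i - y i) I"
    have "F x - F y \<le> L * r" using lipschitz_L2D[OF F x y] by (simp add: r_def)
    also have "\<dots> \<le> r\<^sup>2 / 4 + L\<^sup>2"
      using zero_le_power2[of "r / 2 - L"] by (simp add: power2_eq_square algebra_simps)
    also have "r\<^sup>2 = (\<Sum>i\<in>I. (x i - y i)\<^sup>2)" by (simp add: r_def L2_set_def sum_nonneg)
    finally have "exp (- L\<^sup>2) * exp (F x) * exp (- F y) \<le> exp ((\<Sum>i\<in>I. (x i - y i)\<^sup>2) / 4)"
      by (simp add: exp_add[symmetric])
    then show "ennreal (exp (- L\<^sup>2)) * ennreal (exp (F x)) * ennreal (exp (- F y))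
        \<le> ennreal (exp ((\<Sum>i\<in>I. (x i - y i)\<^sup>2) / 4))"
      by (simp add: ennreal_mult'[symmetric] ennreal_leI)
  qed measurable
  then have "ennreal (exp (L\<^sup>2)) * (ennreal (exp (- L\<^sup>2)) * (\<integral>\<^sup>+x. ennreal (exp (F x)) \<partial>gauss_PiM I) * (\<integral>\<^sup>+x. ennreal (exp (- F x)) \<partial>gauss_PiM I))
     \<le> ennreal (exp (L\<^sup>2)) * 1"
    by (intro mult_left_mono) (simp_all add: nn_integral_cmult)
  then show ?thesis
    by (simp add: mult.assoc[symmetric] ennreal_mult'[symmetric] exp_add[symmetric])
qed

text \<open>The integral of \<open>exp (- F)\<close> is not zero, so a finite product forces the
  other factor to be finite.\<close>

lemma integrable_exp_lipschitz:
  assumes I: "finite I" and F: "lipschitz_L2 I L F"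
  shows "integrable (gauss_PiM I) (\<lambda>x. exp (F x))"
proof -
  interpret prob_space "gauss_PiM I" by (rule prob_space_gauss_PiM)
  note [measurable] = lipschitz_L2_measurable[OF I F]
  have "(\<integral>\<^sup>+x. ennreal (exp (- F x)) \<partial>gauss_PiM I) \<noteq> 0"
    by (subst nn_integral_0_iff_AE) auto
  moreover have "(\<integral>\<^sup>+x. ennreal (exp (F x)) \<partial>gauss_PiM I) * (\<integral>\<^sup>+x. ennreal (exp (- F x)) \<partial>gauss_PiM I) < \<top>"
    using nn_integral_exp_lipschitz[OF I F] by (rule order.strict_trans1) simp
  ultimately have "(\<integral>\<^sup>+x. ennreal (exp (F x)) \<partial>gauss_PiM I) < \<top>"
    by (auto simp: ennreal_mult_less_top)
  then show ?thesis by (intro integrableI_nonneg) auto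
qed

lemma integrable_lipschitz:
  assumes I: "finite I" and F: "lipschitz_L2 I L F"
  shows "integrable (gauss_PiM I) F" "integrable (gauss_PiM I) (\<lambda>x. (F x)\<^sup>2)"
proof -
  note [measurable] = lipschitz_L2_measurable[OF I F]
  have "integrable (gauss_PiM I) (\<lambda>x. exp (- F x))"
    using integrable_exp_lipschitz[OF I lipschitz_L2_scale[OF F, of "-1"]] by simp
  then have i: "integrable (gauss_PiM I) (\<lambda>x. exp (F x) + exp (- F x))"
    using integrable_exp_lipschitz[OF I F] by simp
  show "integrable (gauss_PiM I) F"
    by (rule Bochner_Integration.integrable_bound[OF i]) (auto simp: abs_le_exp_add_exp)
  show "integrable (gauss_PiM I) (\<lambda>x. (F x)\<^sup>2)"
  proof (rule Bochner_Integration.integrable_bound)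
    show "integrable (gauss_PiM I) (\<lambda>x. 2 * (exp (F x) + exp (- F x)))"
      using i by (rule integrable_mult_right)
    show "AE x in gauss_PiM I. norm ((F x)\<^sup>2) \<le> norm (2 * (exp (F x) + exp (- F x)))"
    proof (rule AE_I2)
      fix x
      show "norm ((F x)\<^sup>2) \<le> norm (2 * (exp (F x) + exp (- F x)))"
        using square_le_exp_add_exp[of "F x"] exp_gt_zero[of "F x"] exp_gt_zero[of "- F x"]
        by simp
    qed
  qed measurable
qed

text \<open>By Jensen the mean of \<open>exp (- F)\<close> is at least \<open>exp (- \<mu>)\<close>,
  which converts the bound on the product of the two exponential moments into a centred one. The
  exponent is twice the optimal \<open>L^2 / 2\<close>, hence the 4 in the tail bounds.\<close>

lemma gauss_lipschitz_mgf:
  assumes I: "finite I" and F: "lipschitz_L2 I L F"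
  defines "\<mu> \<equiv> (LINT x|gauss_PiM I. F x)"
  shows "(LINT x|gauss_PiM I. exp (F x - \<mu>)) \<le> exp (L\<^sup>2)"
proof -
  interpret prob_space "gauss_PiM I" by (rule prob_space_gauss_PiM)
  note [measurable] = lipschitz_L2_measurable[OF I F]
  have ie: "integrable (gauss_PiM I) (\<lambda>x. exp (F x))" "integrable (gauss_PiM I) (\<lambda>x. exp (- F x))"
    using integrable_exp_lipschitz[OF I F]
      integrable_exp_lipschitz[OF I lipschitz_L2_scale[OF F, of "-1"]] by simp_all
  note iF = integrable_lipschitz(1)[OF I F]
  have "exp (- \<mu>) = (LINT x|gauss_PiM I. exp (- \<mu>) * (1 + (\<mu> - F x)))"
    using iF by (simp add: \<mu>_def prob_space)
  also have "\<dots> \<le> (LINT x|gauss_PiM I. exp (- F x))"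
  proof (rule integral_mono)
    show "exp (- \<mu>) * (1 + (\<mu> - F x)) \<le> exp (- F x)" for x
    proof -
      have "exp (- \<mu>) * (1 + (\<mu> - F x)) \<le> exp (- \<mu>) * exp (\<mu> - F x)"
        using exp_ge_add_one_self[of "\<mu> - F x"] by (intro mult_left_mono) simp_all
      then show ?thesis by (simp add: exp_add[symmetric])
    qed
  qed (use iF ie in auto)
  finally have j: "exp (- \<mu>) \<le> (LINT x|gauss_PiM I. exp (- F x))" .
  have "(LINT x|gauss_PiM I. exp (F x - \<mu>)) = (LINT x|gauss_PiM I. exp (F x)) * exp (- \<mu>)"
    by (simp add: exp_diff exp_minus divide_inverse)
  also have "\<dots> \<le> (LINT x|gauss_PiM I. exp (F x)) * (LINT x|gauss_PiM I. exp (- F x))"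
    by (intro mult_left_mono j) simp
  also have "\<dots> \<le> exp (L\<^sup>2)"
  proof -
    have "ennreal ((LINT x|gauss_PiM I. exp (F x)) * (LINT x|gauss_PiM I. exp (- F x))) \<le> ennreal (exp (L\<^sup>2))"
      using nn_integral_exp_lipschitz[OF I F] ie
      by (simp add: nn_integral_eq_integral ennreal_mult')
    then show ?thesis by (subst (asm) ennreal_le_iff) auto
  qed
  finally show ?thesis .
qed

lemma gauss_lipschitz_upper_tail:
  assumes I: "finite I" and F: "lipschitz_L2 I 1 F" and t: "0 \<le> t"
  defines "\<mu> \<equiv> (LINT x|gauss_PiM I. F x)"
  shows "measure (gauss_PiM I) {x \<in> space (gauss_PiM I). \<mu> + t \<le> F x} \<le> exp (- t\<^sup>2 / 4)"
proof -
  interpret prob_space "gauss_PiM I" by (rule prob_space_gauss_PiM)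
  note [measurable] = lipschitz_L2_measurable[OF I F]
  \<comment> \<open>The minimiser of the exponent \<open>c^2 - c * t\<close>.\<close>
  define c where "c = t / 2"
  have cF: "lipschitz_L2 I c (\<lambda>x. c * F x)"
    using lipschitz_L2_scale[OF F, of c] t by (simp add: c_def)
  have c\<mu>: "(LINT x|gauss_PiM I. c * F x) = c * \<mu>" by (simp add: \<mu>_def)
  have ie: "integrable (gauss_PiM I) (\<lambda>x. exp (c * F x - c * \<mu>))"
    using integrable_exp_lipschitz[OF I cF] by (simp add: exp_diff)
  have "prob {x \<in> space (gauss_PiM I). \<mu> + t \<le> F x}
      = (LINT x|gauss_PiM I. indicator {x \<in> space (gauss_PiM I). \<mu> + t \<le> F x} x)"
    by simp
  also have "\<dots> \<le> (LINT x|gauss_PiM I. exp (- c * t) * exp (c * F x - c * \<mu>))"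
  proof (rule integral_mono)
    fix x
    show "indicator {x \<in> space (gauss_PiM I). \<mu> + t \<le> F x} x \<le> exp (- c * t) * exp (c * F x - c * \<mu>)"
    proof (cases "\<mu> + t \<le> F x")
      case True
      then have "0 \<le> c * (F x - \<mu> - t)" using t by (intro mult_nonneg_nonneg) (auto simp: c_def)
      then show ?thesis by (simp add: indicator_def exp_add[symmetric] algebra_simps)
    qed (simp add: indicator_def)
    show "integrable (gauss_PiM I) (indicat_real {x \<in> space (gauss_PiM I). \<mu> + t \<le> F x})"
      by (rule integrable_real_indicator) (auto simp: emeasure_eq_measure)
  qed (use ie in auto)
  also have "\<dots> \<le> exp (- c * t) * exp (c\<^sup>2)"
    using gauss_lipschitz_mgf[OF I cF] unfolding c\<mu> by simp
  also have "\<dots> = exp (- t\<^sup>2 / 4)"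
    by (simp add: exp_add[symmetric] c_def power2_eq_square field_simps)
  finally show ?thesis .
qed

lemma gauss_lipschitz_lower_tail:
  assumes I: "finite I" and F: "lipschitz_L2 I 1 F" and t: "0 \<le> t"
  defines "\<mu> \<equiv> (LINT x|gauss_PiM I. F x)"
  shows "measure (gauss_PiM I) {x \<in> space (gauss_PiM I). F x \<le> \<mu> - t} \<le> exp (- t\<^sup>2 / 4)"
proof -
  have "lipschitz_L2 I 1 (\<lambda>x. - F x)" using lipschitz_L2_scale[OF F, of "-1"] by simp
  from gauss_lipschitz_upper_tail[OF I this t] show ?thesis
    by (simp add: \<mu>_def algebra_simps)
qed

text \<open>With \<open>Z = F - \<mu>\<close>, the variance is at most the mean of
  \<open>2 * (exp Z + exp (- Z) - 2)\<close>, hence at most \<open>4 * exp 1 - 4 < 7\<close>. The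
  bound does not depend on the dimension, so that second moments may be exchanged for squared
  means.\<close>

lemma gauss_lipschitz_second_moment:
  assumes I: "finite I" and F: "lipschitz_L2 I 1 F"
  shows "(LINT x|gauss_PiM I. (F x)\<^sup>2) \<le> (LINT x|gauss_PiM I. F x)\<^sup>2 + 7"
proof -
  interpret prob_space "gauss_PiM I" by (rule prob_space_gauss_PiM)
  define \<mu> where "\<mu> = (LINT x|gauss_PiM I. F x)"
  have Fm: "lipschitz_L2 I 1 (\<lambda>x. - F x)" using lipschitz_L2_scale[OF F, of "-1"] by simp
  note iF = integrable_lipschitz[OF I F]
  have ie: "integrable (gauss_PiM I) (\<lambda>x. exp (F x - \<mu>))" "integrable (gauss_PiM I) (\<lambda>x. exp (\<mu> - F x))"
    using integrable_exp_lipschitz[OF I F] integrable_exp_lipschitz[OF I Fm]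
    by (simp_all add: exp_diff exp_minus divide_inverse)
  have "(LINT x|gauss_PiM I. (F x - \<mu>)\<^sup>2) = (LINT x|gauss_PiM I. (F x)\<^sup>2) - 2 * \<mu> * (LINT x|gauss_PiM I. F x) + \<mu>\<^sup>2"
    using iF by (simp add: power2_diff prob_space mult_ac)
  then have "(LINT x|gauss_PiM I. (F x)\<^sup>2) - \<mu>\<^sup>2 = (LINT x|gauss_PiM I. (F x - \<mu>)\<^sup>2)"
    by (simp add: \<mu>_def power2_eq_square)
  also have "\<dots> \<le> (LINT x|gauss_PiM I. 2 * (exp (F x - \<mu>) + exp (\<mu> - F x) - 2))"
  proof (rule integral_mono)
    show "(F x - \<mu>)\<^sup>2 \<le> 2 * (exp (F x - \<mu>) + exp (\<mu> - F x) - 2)" for x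
      using square_le_exp_add_exp[of "F x - \<mu>"] by simp
    show "integrable (gauss_PiM I) (\<lambda>x. (F x - \<mu>)\<^sup>2)" using iF by (simp add: power2_diff)
  qed (use ie in auto)
  also have "\<dots> = 2 * ((LINT x|gauss_PiM I. exp (F x - \<mu>)) + (LINT x|gauss_PiM I. exp (\<mu> - F x)) - 2)"
    using ie by (simp add: prob_space)
  also have "\<dots> \<le> 2 * (exp 1 + exp 1 - 2)"
    using gauss_lipschitz_mgf[OF I F] gauss_lipschitz_mgf[OF I Fm] by (simp add: \<mu>_def)
  also have "\<dots> \<le> 7" using e_less_272 by simp
  finally show ?thesis by (simp add: \<mu>_def)
qed

subsection \<open>Rotations of Gaussian vectors and the norm of a Gaussian matrix\<close>

lemma nn_integral_lborel_shear:
  fixes h :: "real \<Rightarrow> real \<Rightarrow> ennreal"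
  assumes [measurable]: "case_prod h \<in> borel_measurable (borel \<Otimes>\<^sub>M borel)"
  shows "(\<integral>\<^sup>+y. (\<integral>\<^sup>+x. h (x + a * y) y \<partial>lborel) \<partial>lborel) = (\<integral>\<^sup>+y. (\<integral>\<^sup>+x. h x y \<partial>lborel) \<partial>lborel)"
proof (rule nn_integral_cong)
  fix y
  show "(\<integral>\<^sup>+x. h (x + a * y) y \<partial>lborel) = (\<integral>\<^sup>+x. h x y \<partial>lborel)"
    using nn_integral_real_affine[of "\<lambda>x. h x y" 1 "a * y"] by (simp add: add.commute)
qed

lemma nn_integral_lborel_shear':
  fixes h :: "real \<Rightarrow> real \<Rightarrow> ennreal"
  assumes [measurable]: "case_prod h \<in> borel_measurable (borel \<Otimes>\<^sub>M borel)"
  shows "(\<integral>\<^sup>+y. (\<integral>\<^sup>+x. h x (y + a * x) \<partial>lborel) \<partial>lborel) = (\<integral>\<^sup>+y. (\<integral>\<^sup>+x. h x y \<partial>lborel) \<partial>lborel)"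
proof -
  have [measurable]: "case_prod h \<in> borel_measurable (lborel \<Otimes>\<^sub>M lborel)"
    using assms by (simp cong: measurable_cong_sets)
  have "(\<integral>\<^sup>+y. (\<integral>\<^sup>+x. h x (y + a * x) \<partial>lborel) \<partial>lborel) = (\<integral>\<^sup>+x. (\<integral>\<^sup>+y. h x (y + a * x) \<partial>lborel) \<partial>lborel)"
    by (rule lborel_pair.Fubini') measurable
  also have "\<dots> = (\<integral>\<^sup>+x. (\<integral>\<^sup>+y. h x y \<partial>lborel) \<partial>lborel)"
    by (rule nn_integral_lborel_shear[of "\<lambda>x y. h y x"]) measurable
  also have "\<dots> = (\<integral>\<^sup>+y. (\<integral>\<^sup>+x. h x y \<partial>lborel) \<partial>lborel)"
    by (rule lborel_pair.Fubini'[symmetric]) measurable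
  finally show ?thesis .
qed

text \<open>A plane rotation with cosine different from \<open>-1\<close> is a product of three shears.\<close>

lemma nn_integral_lborel_rotation:
  fixes h :: "real \<Rightarrow> real \<Rightarrow> ennreal"
  assumes h: "case_prod h \<in> borel_measurable (borel \<Otimes>\<^sub>M borel)"
    and cs: "c\<^sup>2 + s\<^sup>2 = 1" and c: "0 \<le> c"
  shows "(\<integral>\<^sup>+y. (\<integral>\<^sup>+x. h (c * x - s * y) (s * x + c * y) \<partial>lborel) \<partial>lborel)
       = (\<integral>\<^sup>+y. (\<integral>\<^sup>+x. h x y \<partial>lborel) \<partial>lborel)"
proof -
  note [measurable] = h
  \<comment> \<open>Minus the tangent of half the angle. The rotation is the composition of shears
    with coefficients \<open>a\<close>, \<open>s\<close>, \<open>a\<close>, and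
    \<open>0 <= c\<close> keeps \<open>1 + c\<close> away from zero.\<close>
  define a where "a = - s / (1 + c)"
  have "s\<^sup>2 = (1 - c) * (1 + c)" using cs by (simp add: power2_eq_square algebra_simps)
  then have as: "a * s = c - 1"
    using c by (simp add: a_def power2_eq_square field_simps)
  have a2: "a * (1 + c) = - s" using c by (simp add: a_def)
  define k where "k x y = h (x + a * y) y" for x y
  have k [measurable]: "case_prod k \<in> borel_measurable (borel \<Otimes>\<^sub>M borel)"
    unfolding k_def by measurable
  define l where "l x y = k x (y + s * x)" for x y
  have l [measurable]: "case_prod l \<in> borel_measurable (borel \<Otimes>\<^sub>M borel)"
    unfolding l_def by measurable
  have "h (c * x - s * y) (s * x + c * y) = l (x + a * y) y" for x y
  proof -
    have 1: "y + s * (x + a * y) = s * x + c * y"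
      using arg_cong[OF as, of "\<lambda>t. t * y"] by (simp add: algebra_simps)
    have "x + a * y + a * (s * x + c * y) = (1 + a * s) * x + (a * (1 + c)) * y"
      by (simp add: algebra_simps)
    then have "x + a * y + a * (y + s * (x + a * y)) = c * x - s * y"
      unfolding 1 as a2 by simp
    then show ?thesis unfolding l_def k_def 1 by simp
  qed
  then have "(\<integral>\<^sup>+y. (\<integral>\<^sup>+x. h (c * x - s * y) (s * x + c * y) \<partial>lborel) \<partial>lborel)
      = (\<integral>\<^sup>+y. (\<integral>\<^sup>+x. l (x + a * y) y \<partial>lborel) \<partial>lborel)" by simp
  also have "\<dots> = (\<integral>\<^sup>+y. (\<integral>\<^sup>+x. l x y \<partial>lborel) \<partial>lborel)" by (rule nn_integral_lborel_shear[OF l])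
  also have "\<dots> = (\<integral>\<^sup>+y. (\<integral>\<^sup>+x. k x y \<partial>lborel) \<partial>lborel)"
    unfolding l_def by (rule nn_integral_lborel_shear'[OF k])
  also have "\<dots> = (\<integral>\<^sup>+y. (\<integral>\<^sup>+x. h x y \<partial>lborel) \<partial>lborel)"
    unfolding k_def by (rule nn_integral_lborel_shear[OF h])
  finally show ?thesis .
qed

text \<open>The product density depends on \<open>x^2 + y^2\<close> only, which the rotation
  preserves.\<close>

lemma nn_integral_std_normal_rotation:
  fixes h :: "real \<Rightarrow> real \<Rightarrow> ennreal"
  assumes h: "case_prod h \<in> borel_measurable (borel \<Otimes>\<^sub>M borel)"
    and cs: "c\<^sup>2 + s\<^sup>2 = 1" and c: "0 \<le> c"
  shows "(\<integral>\<^sup>+y. (\<integral>\<^sup>+x. h (c * x - s * y) (s * x + c * y) \<partial>std_normal) \<partial>std_normal)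
       = (\<integral>\<^sup>+y. (\<integral>\<^sup>+x. h x y \<partial>std_normal) \<partial>std_normal)"
proof -
  define w where "w x y = ennreal (std_normal_density x * std_normal_density y)" for x y
  have *: "(\<integral>\<^sup>+y. (\<integral>\<^sup>+x. f x y \<partial>std_normal) \<partial>std_normal) = (\<integral>\<^sup>+y. (\<integral>\<^sup>+x. w x y * f x y \<partial>lborel) \<partial>lborel)"
    if [measurable]: "case_prod f \<in> borel_measurable (borel \<Otimes>\<^sub>M borel)" for f :: "real \<Rightarrow> real \<Rightarrow> ennreal"
  proof -
    have "(\<integral>\<^sup>+y. (\<integral>\<^sup>+x. f x y \<partial>std_normal) \<partial>std_normal)
        = (\<integral>\<^sup>+y. ennreal (std_normal_density y) * (\<integral>\<^sup>+x. ennreal (std_normal_density x) * f x y \<partial>lborel) \<partial>lborel)"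
      by (simp add: nn_integral_std_normal)
    also have "\<dots> = (\<integral>\<^sup>+y. (\<integral>\<^sup>+x. w x y * f x y \<partial>lborel) \<partial>lborel)"
      by (simp add: nn_integral_cmult[symmetric] w_def ennreal_mult' mult_ac)
    finally show ?thesis .
  qed
  have w: "w (c * x - s * y) (s * x + c * y) = w x y" for x y
  proof -
    have "(c * x - s * y)\<^sup>2 + (s * x + c * y)\<^sup>2 = (c\<^sup>2 + s\<^sup>2) * (x\<^sup>2 + y\<^sup>2)"
      by (simp add: power2_eq_square algebra_simps)
    then have "(c * x - s * y)\<^sup>2 + (s * x + c * y)\<^sup>2 = x\<^sup>2 + y\<^sup>2" by (simp add: cs)
    then have "exp (- (c * x - s * y)\<^sup>2 / 2) * exp (- (s * x + c * y)\<^sup>2 / 2) = exp (- x\<^sup>2 / 2) * exp (- y\<^sup>2 / 2)"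
      unfolding exp_add[symmetric] by (intro arg_cong[where f=exp]) (simp add: field_simps)
    then show ?thesis by (simp add: w_def std_normal_density_def)
  qed
  have wm [measurable]: "case_prod w \<in> borel_measurable (borel \<Otimes>\<^sub>M borel)"
    unfolding w_def by measurable
  note [measurable] = h
  have "(\<integral>\<^sup>+y. (\<integral>\<^sup>+x. h (c * x - s * y) (s * x + c * y) \<partial>std_normal) \<partial>std_normal)
      = (\<integral>\<^sup>+y. (\<integral>\<^sup>+x. w (c * x - s * y) (s * x + c * y) * h (c * x - s * y) (s * x + c * y) \<partial>lborel) \<partial>lborel)"
    by (subst *) (measurable, simp add: w)
  also have "\<dots> = (\<integral>\<^sup>+y. (\<integral>\<^sup>+x. w x y * h x y \<partial>lborel) \<partial>lborel)"
    by (rule nn_integral_lborel_rotation[OF _ cs c, of "\<lambda>x y. w x y * h x y"]) measurable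
  also have "\<dots> = (\<integral>\<^sup>+y. (\<integral>\<^sup>+x. h x y \<partial>std_normal) \<partial>std_normal)"
    by (subst *) measurable
  finally show ?thesis .
qed

definition plane_rotation :: "'i \<Rightarrow> 'i \<Rightarrow> real \<Rightarrow> real \<Rightarrow> ('i \<Rightarrow> real) \<Rightarrow> 'i \<Rightarrow> real" where
  "plane_rotation i k c s x = x(i := c * x i - s * x k, k := s * x i + c * x k)"

lemma plane_rotation_measurable:
  assumes "i \<in> I" "k \<in> I"
  shows "plane_rotation i k c s \<in> gauss_PiM I \<rightarrow>\<^sub>M gauss_PiM I"
proof (rule measurable_PiM_single')
  show "plane_rotation i k c s \<in> space (gauss_PiM I) \<rightarrow> (\<Pi>\<^sub>E i\<in>I. space std_normal)"
    using assms by (auto simp: plane_rotation_def space_PiM PiE_iff extensional_def)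
  fix j assume j: "j \<in> I"
  have "(\<lambda>x. if j = k then s * x i + c * x k else if j = i then c * x i - s * x k else x j) \<in> borel_measurable (gauss_PiM I)"
    using assms j by measurable
  then show "(\<lambda>x. plane_rotation i k c s x j) \<in> gauss_PiM I \<rightarrow>\<^sub>M std_normal"
    unfolding plane_rotation_def fun_upd_apply by (simp cong: measurable_cong_sets)
qed

text \<open>Fubini isolates the coordinates \<open>i\<close> and \<open>k\<close>; with the others
  fixed, the inner double integral is the planar case.\<close>

lemma distr_gauss_PiM_plane_rotation:
  assumes I: "finite I" "i \<in> I" "k \<in> I" "i \<noteq> k" and cs: "c\<^sup>2 + s\<^sup>2 = 1" and c: "0 \<le> c"
  shows "distr (gauss_PiM I) (gauss_PiM I) (plane_rotation i k c s) = gauss_PiM I"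
proof (rule measure_eqI)
  fix A assume "A \<in> sets (distr (gauss_PiM I) (gauss_PiM I) (plane_rotation i k c s))"
  then have A [measurable]: "A \<in> sets (gauss_PiM I)" by simp
  interpret product_prob_space "\<lambda>_::'a. std_normal" by (rule product_prob_space_std_normal)
  define J where "J = I - {i, k}"
  have J: "I = insert i (insert k J)" "finite J" "k \<notin> J" "i \<notin> insert k J"
    using I by (auto simp: J_def)
  note rm [measurable] = plane_rotation_measurable[OF I(2,3), of c s]
  have split: "(\<integral>\<^sup>+x. f x \<partial>gauss_PiM I) =
      (\<integral>\<^sup>+x. (\<integral>\<^sup>+y. (\<integral>\<^sup>+z. f (x(k := y, i := z)) \<partial>std_normal) \<partial>std_normal) \<partial>gauss_PiM J)"
    if f: "f \<in> borel_measurable (gauss_PiM I)" for f :: "_ \<Rightarrow> ennreal"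
  proof -
    note [measurable] = f[unfolded J(1)]
    have "(\<integral>\<^sup>+x. f x \<partial>gauss_PiM I) = (\<integral>\<^sup>+x. (\<integral>\<^sup>+z. f (x(i := z)) \<partial>std_normal) \<partial>gauss_PiM (insert k J))"
      unfolding J(1) using J by (subst product_nn_integral_insert) auto
    also have "\<dots> = (\<integral>\<^sup>+x. (\<integral>\<^sup>+y. (\<integral>\<^sup>+z. f (x(k := y, i := z)) \<partial>std_normal) \<partial>std_normal) \<partial>gauss_PiM J)"
      using J by (subst product_nn_integral_insert) auto
    finally show ?thesis .
  qed
  have "emeasure (distr (gauss_PiM I) (gauss_PiM I) (plane_rotation i k c s)) A
      = (\<integral>\<^sup>+x. indicator A (plane_rotation i k c s x) \<partial>gauss_PiM I)"
    by (subst nn_integral_distr[symmetric, OF rm]) auto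
  also have "\<dots> = (\<integral>\<^sup>+x. (\<integral>\<^sup>+y. (\<integral>\<^sup>+z. indicator A (plane_rotation i k c s (x(k := y, i := z))) \<partial>std_normal) \<partial>std_normal) \<partial>gauss_PiM J)"
    by (rule split) measurable
  also have "\<dots> = (\<integral>\<^sup>+x. (\<integral>\<^sup>+y. (\<integral>\<^sup>+z. indicator A (x(k := y, i := z)) \<partial>std_normal) \<partial>std_normal) \<partial>gauss_PiM J)"
  proof (rule nn_integral_cong)
    fix x assume x: "x \<in> space (gauss_PiM J)"
    have "(\<lambda>(z, y). x(k := y, i := z)) \<in> borel \<Otimes>\<^sub>M borel \<rightarrow>\<^sub>M gauss_PiM I"
    proof (rule measurable_PiM_single')
      show "(\<lambda>(z, y). x(k := y, i := z)) \<in> space (borel \<Otimes>\<^sub>M borel) \<rightarrow> (\<Pi>\<^sub>E i\<in>I. space std_normal)"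
        using x J(1) by (auto simp: space_PiM PiE_iff extensional_def)
      fix j assume "j \<in> I"
      have "(\<lambda>(z, y). if j = i then z else if j = k then y else x j) \<in> borel_measurable (borel \<Otimes>\<^sub>M borel)"
        by measurable
      then show "(\<lambda>p. (case p of (z, y) \<Rightarrow> x(k := y, i := z)) j) \<in> borel \<Otimes>\<^sub>M borel \<rightarrow>\<^sub>M std_normal"
        unfolding case_prod_beta fun_upd_apply by (simp cong: measurable_cong_sets)
    qed
    then have "case_prod (\<lambda>z y. indicator A (x(k := y, i := z)) :: ennreal) \<in> borel_measurable (borel \<Otimes>\<^sub>M borel)"
      using measurable_compose[OF _ borel_measurable_indicator[OF A]] by (simp add: case_prod_beta)
    note this[THEN nn_integral_std_normal_rotation[OF _ cs c]]
    moreover have "plane_rotation i k c s (x(k := y, i := z)) = x(k := s * z + c * y, i := c * z - s * y)" for y z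
      using \<open>i \<noteq> k\<close> by (auto simp: plane_rotation_def)
    ultimately show "(\<integral>\<^sup>+y. (\<integral>\<^sup>+z. indicator A (plane_rotation i k c s (x(k := y, i := z))) \<partial>std_normal) \<partial>std_normal)
        = (\<integral>\<^sup>+y. (\<integral>\<^sup>+z. indicator A (x(k := y, i := z)) \<partial>std_normal) \<partial>std_normal)"
      by simp
  qed
  also have "\<dots> = (\<integral>\<^sup>+x. indicator A x \<partial>gauss_PiM I)"
    by (rule split[symmetric]) measurable
  finally show "emeasure (distr (gauss_PiM I) (gauss_PiM I) (plane_rotation i k c s)) A = emeasure (gauss_PiM I) A"
    by simp
qed simp

section \<open>Exponential moments and the operator norm\<close>

lemma nn_integral_std_normal_exp_linear:
  "(\<integral>\<^sup>+x. ennreal (exp (c * x)) \<partial>std_normal) = ennreal (exp (c\<^sup>2 / 2))"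
proof -
  have "std_normal_density x * exp (c * x) = exp (c\<^sup>2 / 2) * normal_density c 1 x" for x
  proof -
    have "exp (- x\<^sup>2 / 2) * exp (c * x) = exp (c\<^sup>2 / 2) * exp (- (x - c)\<^sup>2 / 2)"
      unfolding exp_add[symmetric] by (intro arg_cong[where f=exp]) (simp add: power2_eq_square field_simps)
    then show ?thesis by (simp add: normal_density_def)
  qed
  then have "(\<integral>\<^sup>+x. ennreal (exp (c * x)) \<partial>std_normal)
      = (\<integral>\<^sup>+x. ennreal (exp (c\<^sup>2 / 2)) * ennreal (normal_density c 1 x) \<partial>lborel)"
    by (subst nn_integral_std_normal) (simp_all add: ennreal_mult'[symmetric])
  also have "\<dots> = ennreal (exp (c\<^sup>2 / 2)) * (\<integral>\<^sup>+x. ennreal (normal_density c 1 x) \<partial>lborel)"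
    by (rule nn_integral_cmult) simp
  also have "(\<integral>\<^sup>+x. ennreal (normal_density c 1 x) \<partial>lborel) = 1"
    using prob_space.emeasure_space_1[OF prob_space_normal_density, of 1 c] by (simp add: emeasure_density)
  finally show ?thesis by simp
qed

lemma nn_integral_std_normal_exp_square:
  assumes "k < 1"
  shows "(\<integral>\<^sup>+x. ennreal (exp (k / 2 * x\<^sup>2)) \<partial>std_normal) = ennreal (1 / sqrt (1 - k))"
proof -
  \<comment> \<open>The standard deviation of the Gaussian density proportional to
    \<open>exp (- (1 - k) * x^2 / 2)\<close>.\<close>
  define t where "t = 1 / sqrt (1 - k)"
  have t: "0 < t" and t2: "t\<^sup>2 = 1 / (1 - k)" using assms by (simp_all add: t_def power_divide)
  have "std_normal_density x * exp (k / 2 * x\<^sup>2) = t * normal_density 0 t x" for x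
  proof -
    have "exp (- x\<^sup>2 / 2) * exp (k / 2 * x\<^sup>2) = exp (- x\<^sup>2 / (2 * t\<^sup>2))"
      unfolding exp_add[symmetric] t2 by (intro arg_cong[where f=exp]) (simp add: field_simps)
    moreover have "sqrt (2 * pi * t\<^sup>2) = sqrt (2 * pi) * t" using t by (simp add: real_sqrt_mult)
    ultimately show ?thesis using t by (simp add: normal_density_def)
  qed
  then have "(\<integral>\<^sup>+x. ennreal (exp (k / 2 * x\<^sup>2)) \<partial>std_normal)
      = (\<integral>\<^sup>+x. ennreal t * ennreal (normal_density 0 t x) \<partial>lborel)"
    using t by (subst nn_integral_std_normal) (simp_all add: ennreal_mult'[symmetric])
  also have "\<dots> = ennreal t * (\<integral>\<^sup>+x. ennreal (normal_density 0 t x) \<partial>lborel)"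
    by (rule nn_integral_cmult) simp
  also have "(\<integral>\<^sup>+x. ennreal (normal_density 0 t x) \<partial>lborel) = 1"
    using prob_space.emeasure_space_1[OF prob_space_normal_density[OF t], of 0] by (simp add: emeasure_density)
  finally show ?thesis by (simp add: t_def)
qed

lemma nn_integral_gauss_exp_linear:
  assumes "finite I"
  shows "(\<integral>\<^sup>+x. ennreal (exp (\<Sum>i\<in>I. c i * x i)) \<partial>gauss_PiM I) = ennreal (exp ((\<Sum>i\<in>I. (c i)\<^sup>2) / 2))"
proof -
  interpret product_prob_space "\<lambda>_::'a. std_normal" by (rule product_prob_space_std_normal)
  have "(\<integral>\<^sup>+x. ennreal (exp (\<Sum>i\<in>I. c i * x i)) \<partial>gauss_PiM I)
      = (\<integral>\<^sup>+x. (\<Prod>i\<in>I. ennreal (exp (c i * x i))) \<partial>gauss_PiM I)"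
    by (simp add: exp_sum[OF assms] prod_ennreal)
  also have "\<dots> = (\<Prod>i\<in>I. \<integral>\<^sup>+x. ennreal (exp (c i * x)) \<partial>std_normal)"
    by (rule product_nn_integral_prod) (auto simp: assms)
  also have "\<dots> = (\<Prod>i\<in>I. ennreal (exp ((c i)\<^sup>2 / 2)))"
    by (simp add: nn_integral_std_normal_exp_linear)
  also have "\<dots> = ennreal (exp ((\<Sum>i\<in>I. (c i)\<^sup>2) / 2))"
    by (simp add: exp_sum[OF assms] prod_ennreal sum_divide_distrib)
  finally show ?thesis .
qed

lemma nn_integral_gauss_exp_square:
  assumes "finite I" "k < 1"
  shows "(\<integral>\<^sup>+x. ennreal (exp (k / 2 * (\<Sum>i\<in>I. (x i)\<^sup>2))) \<partial>gauss_PiM I) = ennreal ((1 / sqrt (1 - k)) ^ card I)"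
proof -
  interpret product_prob_space "\<lambda>_::'a. std_normal" by (rule product_prob_space_std_normal)
  have "(\<integral>\<^sup>+x. ennreal (exp (k / 2 * (\<Sum>i\<in>I. (x i)\<^sup>2))) \<partial>gauss_PiM I)
      = (\<integral>\<^sup>+x. (\<Prod>i\<in>I. ennreal (exp (k / 2 * (x i)\<^sup>2))) \<partial>gauss_PiM I)"
    by (simp add: sum_distrib_left exp_sum[OF assms(1)] prod_ennreal)
  also have "\<dots> = (\<Prod>i\<in>I. \<integral>\<^sup>+x. ennreal (exp (k / 2 * x\<^sup>2)) \<partial>std_normal)"
    by (rule product_nn_integral_prod) (auto simp: assms(1))
  also have "\<dots> = ennreal ((1 / sqrt (1 - k)) ^ card I)"
    using assms(2) by (simp only: nn_integral_std_normal_exp_square[OF assms(2)] prod_constant) (simp add: ennreal_power)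
  finally show ?thesis .
qed

lemma nn_integral_gauss_swap:
  assumes "case_prod f \<in> borel_measurable (gauss_PiM I \<Otimes>\<^sub>M gauss_PiM J)"
  shows "(\<integral>\<^sup>+y. (\<integral>\<^sup>+x. f x y \<partial>gauss_PiM I) \<partial>gauss_PiM J) = (\<integral>\<^sup>+x. (\<integral>\<^sup>+y. f x y \<partial>gauss_PiM J) \<partial>gauss_PiM I)"
  by (intro pair_sigma_finite.Fubini' assms pair_sigma_finite.intro prob_space_imp_sigma_finite prob_space_gauss_PiM)

text \<open>For a unit vector \<open>b\<close>, the transpose of \<open>g\<close> maps
  \<open>b\<close> to a standard Gaussian vector. In place of that law, an auxiliary Gaussian vector
  \<open>w\<close> linearises the square and \<open>g\<close> is integrated out first. The
  hypothesis on \<open>b\<close> is an inequality because normalising the zero vector gives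
  zero.\<close>

lemma nn_integral_exp_square_matrix_times_vector:
  assumes I: "finite I" and J: "finite J" and k: "0 \<le> k" "k < 1" and b: "(\<Sum>i\<in>I. (b i)\<^sup>2) \<le> 1"
  shows "(\<integral>\<^sup>+g. ennreal (exp (k / 2 * (\<Sum>j\<in>J. (\<Sum>i\<in>I. g (i, j) * b i)\<^sup>2))) \<partial>gauss_PiM (I \<times> J))
          \<le> ennreal ((1 / sqrt (1 - k)) ^ card J)"
proof -
  define h where "h g j = (\<Sum>i\<in>I. g (i, j) * b i)" for g :: "'a \<times> 'b \<Rightarrow> real" and j
  have h_meas: "(\<lambda>g. h g j) \<in> borel_measurable (gauss_PiM (I \<times> J))" if "j \<in> J" for j
    unfolding h_def by measurable (use that in auto)
  have lin: "(\<Sum>j\<in>J. (sqrt k * h g j) * w j) = (\<Sum>p\<in>I \<times> J. (sqrt k * w (snd p) * b (fst p)) * g p)" for g w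
    unfolding h_def sum.cartesian_product'
    by (subst sum.swap) (simp add: sum_distrib_left sum_distrib_right mult_ac)
  have sq: "(\<Sum>p\<in>I \<times> J. (sqrt k * w (snd p) * b (fst p))\<^sup>2) = (\<Sum>i\<in>I. (b i)\<^sup>2) * (k * (\<Sum>j\<in>J. (w j)\<^sup>2))" for w
    using k unfolding sum.cartesian_product'
    by (subst sum.swap) (simp add: sum_distrib_left sum_distrib_right power_mult_distrib mult_ac)
  have "(\<integral>\<^sup>+g. ennreal (exp (k / 2 * (\<Sum>j\<in>J. (h g j)\<^sup>2))) \<partial>gauss_PiM (I \<times> J))
      = (\<integral>\<^sup>+g. (\<integral>\<^sup>+w. ennreal (exp (\<Sum>j\<in>J. (sqrt k * h g j) * w j)) \<partial>gauss_PiM J) \<partial>gauss_PiM (I \<times> J))"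
    using k by (simp add: nn_integral_gauss_exp_linear[OF J] power_mult_distrib sum_distrib_left[symmetric])
  also have "\<dots> = (\<integral>\<^sup>+w. (\<integral>\<^sup>+g. ennreal (exp (\<Sum>j\<in>J. (sqrt k * h g j) * w j)) \<partial>gauss_PiM (I \<times> J)) \<partial>gauss_PiM J)"
  proof (rule nn_integral_gauss_swap)
    have [measurable]: "(\<lambda>x. h (snd x) j) \<in> borel_measurable (gauss_PiM J \<Otimes>\<^sub>M gauss_PiM (I \<times> J))" if "j \<in> J" for j
      using measurable_compose[OF measurable_snd h_meas[OF that]] .
    show "(\<lambda>(w, g). ennreal (exp (\<Sum>j\<in>J. (sqrt k * h g j) * w j))) \<in> borel_measurable (gauss_PiM J \<Otimes>\<^sub>M gauss_PiM (I \<times> J))"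
      unfolding case_prod_beta by measurable
  qed
  also have "\<dots> = (\<integral>\<^sup>+w. ennreal (exp ((\<Sum>i\<in>I. (b i)\<^sup>2) * (k * (\<Sum>j\<in>J. (w j)\<^sup>2)) / 2)) \<partial>gauss_PiM J)"
    unfolding lin by (simp add: nn_integral_gauss_exp_linear I J sq)
  also have "\<dots> \<le> (\<integral>\<^sup>+w. ennreal (exp (k / 2 * (\<Sum>j\<in>J. (w j)\<^sup>2))) \<partial>gauss_PiM J)"
    using k b by (intro nn_integral_mono ennreal_leI) (auto intro!: mult_left_le_one_le sum_nonneg mult_nonneg_nonneg)
  also have "\<dots> = ennreal ((1 / sqrt (1 - k)) ^ card J)"
    by (rule nn_integral_gauss_exp_square[OF J k(2)])
  finally show ?thesis by (simp add: h_def)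
qed

text \<open>The supremum over unit vectors \<open>v\<close> is linearised by a second Gaussian vector \<open>z\<close>: the
  exponential of \<open>\<tau>\<^sup>2 |g v|\<^sup>2 / 2\<close> is the mean of \<open>exp (\<tau> \<langle>z, g v\<rangle>)\<close>, which is at most
  \<open>exp (\<tau> |g\<^sup>T z|)\<close>, a quantity that does not involve \<open>v\<close>.\<close>

lemma nn_integral_exp_operator_norm:
  assumes I: "finite I" and J: "finite J" and be: "0 < \<beta>" "\<beta> < 1" and ka: "0 < \<kappa>" "\<kappa> < 1"
    and S: "\<And>g. g \<in> space (gauss_PiM (I \<times> J)) \<Longrightarrow>
              \<exists>v. (\<Sum>j\<in>J. (v j)\<^sup>2) \<le> 1 \<and> S g \<le> (\<Sum>i\<in>I. (\<Sum>j\<in>J. g (i, j) * v j)\<^sup>2)"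
  shows "(\<integral>\<^sup>+g. ennreal (exp (\<beta> * \<kappa> / 2 * S g)) \<partial>gauss_PiM (I \<times> J))
       \<le> ennreal ((1 / sqrt (1 - \<beta>)) ^ card I * (1 / sqrt (1 - \<kappa>)) ^ card J)"
proof -
  define \<tau> where "\<tau> = sqrt \<beta> * sqrt \<kappa>"
  have \<tau>: "0 < \<tau>" "\<tau>\<^sup>2 = \<beta> * \<kappa>" using be ka by (auto simp: \<tau>_def power_mult_distrib)
  define h where "h g z j = (\<Sum>i\<in>I. g (i, j) * z i)" for g :: "'a \<times> 'b \<Rightarrow> real" and z :: "'a \<Rightarrow> real" and j
  define N where "N z = L2_set z I" for z :: "'a \<Rightarrow> real"
  have N2: "(N z)\<^sup>2 = (\<Sum>i\<in>I. (z i)\<^sup>2)" for z by (simp add: N_def L2_set_def sum_nonneg)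
  define b where "b z i = z i / N z" for z i
  have b1: "(\<Sum>i\<in>I. (b z i)\<^sup>2) \<le> 1" for z
    by (simp add: b_def power_divide N2 sum_divide_distrib[symmetric])
  \<comment> \<open>The bound on the linearised exponent is split by
    \<open>2 * a * b <= a^2 + b^2\<close> into a part in the length of \<open>z\<close> and a part
    in its direction \<open>b z\<close>. The mean over \<open>g\<close> of the factor from the
    direction is bounded uniformly in \<open>z\<close> by the preceding lemma.\<close>
  define \<Phi> where "\<Phi> g z = exp (\<beta> / 2 * (\<Sum>i\<in>I. (z i)\<^sup>2)) * exp (\<kappa> / 2 * (\<Sum>j\<in>J. (h g (b z) j)\<^sup>2))" for g z
  have pt: "ennreal (exp (\<beta> * \<kappa> / 2 * S g)) \<le> (\<integral>\<^sup>+z. ennreal (\<Phi> g z) \<partial>gauss_PiM I)"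
    if g: "g \<in> space (gauss_PiM (I \<times> J))" for g
  proof -
    obtain v where v: "(\<Sum>j\<in>J. (v j)\<^sup>2) \<le> 1" "S g \<le> (\<Sum>i\<in>I. (\<Sum>j\<in>J. g (i, j) * v j)\<^sup>2)"
      using S[OF g] by auto
    define y where "y i = (\<Sum>j\<in>J. g (i, j) * v j)" for i
    have "exp (\<beta> * \<kappa> / 2 * S g) \<le> exp ((\<Sum>i\<in>I. (\<tau> * y i)\<^sup>2) / 2)"
      using v(2) be ka by (simp add: power_mult_distrib \<tau>(2) sum_distrib_left[symmetric] y_def)
    then have "ennreal (exp (\<beta> * \<kappa> / 2 * S g)) \<le> (\<integral>\<^sup>+z. ennreal (exp (\<Sum>i\<in>I. (\<tau> * y i) * z i)) \<partial>gauss_PiM I)"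
      unfolding nn_integral_gauss_exp_linear[OF I] by (rule ennreal_leI)
    also have "\<dots> \<le> (\<integral>\<^sup>+z. ennreal (\<Phi> g z) \<partial>gauss_PiM I)"
    proof (intro nn_integral_mono ennreal_leI)
      fix z
      have "(\<Sum>i\<in>I. (\<tau> * y i) * z i) = \<tau> * (\<Sum>j\<in>J. v j * h g z j)"
        unfolding y_def h_def
        by (simp add: sum_distrib_left sum_distrib_right mult_ac, subst sum.swap, simp)
      also have "(\<Sum>j\<in>J. v j * h g z j) = N z * (\<Sum>j\<in>J. v j * h g (b z) j)"
      proof (cases "N z = 0")
        case True
        then have "z i = 0" if "i \<in> I" for i
          using that I by (simp add: N_def L2_set_eq_0_iff)
        then show ?thesis by (simp add: True h_def)
      next
        case False
        then show ?thesis
          by (simp add: b_def h_def sum_distrib_left)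
      qed
      also have "\<tau> * (N z * (\<Sum>j\<in>J. v j * h g (b z) j)) \<le> \<tau> * (N z * L2_set (h g (b z)) J)"
      proof (intro mult_left_mono)
        have "(\<Sum>j\<in>J. v j * h g (b z) j) \<le> L2_set v J * L2_set (h g (b z)) J"
          by (rule L2_set_mult_ineq[THEN order_trans[rotated]]) (auto intro!: sum_mono simp: abs_mult[symmetric])
        also have "\<dots> \<le> 1 * L2_set (h g (b z)) J"
          using v(1) by (intro mult_right_mono) (auto simp: L2_set_def sum_nonneg)
        finally show "(\<Sum>j\<in>J. v j * h g (b z) j) \<le> L2_set (h g (b z)) J" by simp
      qed (use \<tau> in \<open>auto simp: N_def\<close>)
      also have "\<dots> \<le> \<beta> / 2 * (N z)\<^sup>2 + \<kappa> / 2 * (L2_set (h g (b z)) J)\<^sup>2"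
      proof -
        have "0 \<le> (sqrt \<beta> * N z - sqrt \<kappa> * L2_set (h g (b z)) J)\<^sup>2" by simp
        then show ?thesis using be ka
          by (simp add: power2_diff power_mult_distrib \<tau>_def mult_ac)
      qed
      finally show "exp (\<Sum>i\<in>I. (\<tau> * y i) * z i) \<le> \<Phi> g z"
        by (simp add: \<Phi>_def exp_add[symmetric] N2 L2_set_def sum_nonneg)
    qed
    finally show ?thesis .
  qed
  have "(\<integral>\<^sup>+g. ennreal (exp (\<beta> * \<kappa> / 2 * S g)) \<partial>gauss_PiM (I \<times> J))
      \<le> (\<integral>\<^sup>+g. (\<integral>\<^sup>+z. ennreal (\<Phi> g z) \<partial>gauss_PiM I) \<partial>gauss_PiM (I \<times> J))"
    by (intro nn_integral_mono pt)
  also have "\<dots> = (\<integral>\<^sup>+z. (\<integral>\<^sup>+g. ennreal (\<Phi> g z) \<partial>gauss_PiM (I \<times> J)) \<partial>gauss_PiM I)"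
  proof (rule nn_integral_gauss_swap)
    show "(\<lambda>(z, g). ennreal (\<Phi> g z)) \<in> borel_measurable (gauss_PiM I \<Otimes>\<^sub>M gauss_PiM (I \<times> J))"
      unfolding \<Phi>_def h_def b_def N_def L2_set_def case_prod_beta by measurable
  qed
  also have "\<dots> \<le> (\<integral>\<^sup>+z. ennreal (exp (\<beta> / 2 * (\<Sum>i\<in>I. (z i)\<^sup>2))) * ennreal ((1 / sqrt (1 - \<kappa>)) ^ card J) \<partial>gauss_PiM I)"
  proof (rule nn_integral_mono)
    fix z
    have "(\<lambda>g. ennreal (exp (\<kappa> / 2 * (\<Sum>j\<in>J. (h g (b z) j)\<^sup>2)))) \<in> borel_measurable (gauss_PiM (I \<times> J))"
      unfolding h_def by measurable
    then have "(\<integral>\<^sup>+g. ennreal (\<Phi> g z) \<partial>gauss_PiM (I \<times> J)) = ennreal (exp (\<beta> / 2 * (\<Sum>i\<in>I. (z i)\<^sup>2))) *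
        (\<integral>\<^sup>+g. ennreal (exp (\<kappa> / 2 * (\<Sum>j\<in>J. (h g (b z) j)\<^sup>2))) \<partial>gauss_PiM (I \<times> J))"
      by (simp add: \<Phi>_def ennreal_mult' nn_integral_cmult)
    also have "\<dots> \<le> ennreal (exp (\<beta> / 2 * (\<Sum>i\<in>I. (z i)\<^sup>2))) * ennreal ((1 / sqrt (1 - \<kappa>)) ^ card J)"
      unfolding h_def using ka by (intro mult_left_mono nn_integral_exp_square_matrix_times_vector I J b1) auto
    finally show "(\<integral>\<^sup>+g. ennreal (\<Phi> g z) \<partial>gauss_PiM (I \<times> J)) \<le>
        ennreal (exp (\<beta> / 2 * (\<Sum>i\<in>I. (z i)\<^sup>2))) * ennreal ((1 / sqrt (1 - \<kappa>)) ^ card J)" .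
  qed
  also have "\<dots> = ennreal ((1 / sqrt (1 - \<beta>)) ^ card I) * ennreal ((1 / sqrt (1 - \<kappa>)) ^ card J)"
    by (subst nn_integral_multc) (measurable, simp only: nn_integral_gauss_exp_square[OF I be(2)])
  finally show ?thesis
    using be ka by (simp add: ennreal_mult'[symmetric])
qed

text \<open>Right minus left vanishes at 0 and has the derivative
  \<open>t * (1 - 2 * t) / (1 - t)\<close>, which is nonnegative up to
  \<open>t = 1 / 2\<close>.\<close>

lemma neg_ln_one_minus_le:
  fixes x :: real
  assumes "0 \<le> x" "x \<le> 1 / 2"
  shows "- ln (1 - x) \<le> x + x\<^sup>2"
proof -
  define f where "f t = ln (1 - t) + t + t\<^sup>2" for t :: real
  have "f 0 \<le> f x"
  proof (rule DERIV_nonneg_imp_nondecreasing[OF assms(1)])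
    fix t assume t: "0 \<le> t" "t \<le> x"
    have "(f has_real_derivative - 1 / (1 - t) + 1 + 2 * t) (at t)"
      unfolding f_def using t assms by (auto intro!: derivative_eq_intros)
    moreover have "0 \<le> t * (1 - 2 * t) / (1 - t)"
      using t assms by (intro divide_nonneg_nonneg mult_nonneg_nonneg) auto
    moreover have "t * (1 - 2 * t) / (1 - t) = - 1 / (1 - t) + 1 + 2 * t"
      using t assms by (simp add: field_simps)
    ultimately show "\<exists>y. (f has_real_derivative y) (at t) \<and> 0 \<le> y" by metis
  qed
  then show ?thesis by (simp add: f_def)
qed

text \<open>Jensen, by the tangent to the exponential at \<open>ln C\<close>: an exponential moment
  of at most \<open>C\<close> forces a mean of at most \<open>ln C\<close>.\<close>

lemma integral_operator_norm_le:
  assumes I: "finite I" and J: "finite J" and be: "0 < \<beta>" "\<beta> < 1" and ka: "0 < \<kappa>" "\<kappa> < 1"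
    and S: "\<And>g. g \<in> space (gauss_PiM (I \<times> J)) \<Longrightarrow>
              \<exists>v. (\<Sum>j\<in>J. (v j)\<^sup>2) \<le> 1 \<and> S g \<le> (\<Sum>i\<in>I. (\<Sum>j\<in>J. g (i, j) * v j)\<^sup>2)"
    and int: "integrable (gauss_PiM (I \<times> J)) S"
  shows "\<beta> * \<kappa> * (LINT g|gauss_PiM (I \<times> J). S g) \<le> card I * (- ln (1 - \<beta>)) + card J * (- ln (1 - \<kappa>))"
proof -
  interpret prob_space "gauss_PiM (I \<times> J)" by (rule prob_space_gauss_PiM)
  define C where "C = (1 / sqrt (1 - \<beta>)) ^ card I * (1 / sqrt (1 - \<kappa>)) ^ card J"
  have C: "0 < C" using be ka by (simp add: C_def)
  have lnC: "2 * ln C = card I * (- ln (1 - \<beta>)) + card J * (- ln (1 - \<kappa>))"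
    using be ka by (simp add: C_def ln_mult ln_div ln_realpow ln_sqrt algebra_simps)
  define X where "X g = \<beta> * \<kappa> / 2 * S g" for g
  have iX: "integrable (gauss_PiM (I \<times> J)) X" using int unfolding X_def by (rule integrable_mult_right)
  have [measurable]: "X \<in> borel_measurable (gauss_PiM (I \<times> J))" using iX by auto
  have le: "(\<integral>\<^sup>+g. ennreal (exp (X g)) \<partial>gauss_PiM (I \<times> J)) \<le> ennreal C"
    unfolding X_def C_def by (rule nn_integral_exp_operator_norm[OF I J be ka S])
  have ie: "integrable (gauss_PiM (I \<times> J)) (\<lambda>g. exp (X g))"
    by (rule integrableI_nonneg) (use le in \<open>auto intro: order.strict_trans1\<close>)
  have eC: "(LINT g|gauss_PiM (I \<times> J). exp (X g)) \<le> C"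
    using le C by (simp add: nn_integral_eq_integral[OF ie])
  have "C * (1 + (LINT g|gauss_PiM (I \<times> J). X g) - ln C) = (LINT g|gauss_PiM (I \<times> J). C * (1 + (X g - ln C)))"
    using iX by (simp add: prob_space algebra_simps)
  also have "\<dots> \<le> (LINT g|gauss_PiM (I \<times> J). exp (X g))"
  proof (rule integral_mono)
    fix g
    have "C * (1 + (X g - ln C)) \<le> C * exp (X g - ln C)"
      using C exp_ge_add_one_self[of "X g - ln C"] by (intro mult_left_mono) auto
    then show "C * (1 + (X g - ln C)) \<le> exp (X g)" using C by (simp add: exp_diff)
  qed (use iX ie in auto)
  finally have "C * (1 + (LINT g|gauss_PiM (I \<times> J). X g) - ln C) \<le> C * 1" using eC by simp
  then have "(LINT g|gauss_PiM (I \<times> J). X g) \<le> ln C" using C by simp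
  then show ?thesis using lnC by (simp add: X_def)
qed

text \<open>The parameter of the smaller dimension is fixed at \<open>1 / 2\<close>, which is the
  origin of the factor 2; the parameter of the larger one is proportional to the ratio of the square
  roots of the dimensions.\<close>

lemma integral_operator_norm_le_dims:
  assumes I: "finite I" "I \<noteq> {}" and J: "finite J" "J \<noteq> {}"
    and S: "\<And>g. g \<in> space (gauss_PiM (I \<times> J)) \<Longrightarrow>
              \<exists>v. (\<Sum>j\<in>J. (v j)\<^sup>2) \<le> 1 \<and> S g \<le> (\<Sum>i\<in>I. (\<Sum>j\<in>J. g (i, j) * v j)\<^sup>2)"
    and int: "integrable (gauss_PiM (I \<times> J)) S"
  shows "(LINT g|gauss_PiM (I \<times> J). S g) \<le> 2 * (sqrt (card I) + sqrt (card J))\<^sup>2"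
proof -
  define E where "E = (LINT g|gauss_PiM (I \<times> J). S g)"
  have main: "E \<le> 2 * (sqrt a + sqrt b)\<^sup>2"
    if a: "0 < a" and b: "a \<le> b"
      and le: "\<And>\<kappa>. 0 < \<kappa> \<Longrightarrow> \<kappa> \<le> 1 / 2 \<Longrightarrow> 1 / 2 * \<kappa> * E \<le> a * ln 2 + b * (- ln (1 - \<kappa>))" for a b :: real
  proof -
    define x where "x = sqrt a" define y where "y = sqrt b"
    have xy: "0 < x" "x \<le> y" "a = x\<^sup>2" "b = y\<^sup>2" using a b by (auto simp: x_def y_def)
    \<comment> \<open>After division by \<open>\<kappa> / 2\<close> the term linear in
      \<open>\<kappa>\<close> becomes \<open>2 * y^2\<close> whatever \<open>\<kappa>\<close> is.
      With \<open>\<kappa>\<close> of order \<open>x / y\<close> the other two are of order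
      \<open>x * y\<close> and fit into \<open>2 * (x + y)^2\<close>.\<close>
    define \<kappa> where "\<kappa> = x / (2 * y)"
    have \<kappa>: "0 < \<kappa>" "\<kappa> \<le> 1 / 2" using xy by (auto simp: \<kappa>_def field_simps)
    have l2: "ln 2 \<le> (7 / 10 :: real)" using ln2_le_25_over_36 by simp
    have "1 / 2 * \<kappa> * E \<le> a * ln 2 + b * (- ln (1 - \<kappa>))" by (rule le[OF \<kappa>])
    also have "\<dots> \<le> x\<^sup>2 * (7 / 10) + y\<^sup>2 * (\<kappa> + \<kappa>\<^sup>2)"
      using \<kappa> l2 unfolding xy(3,4) by (intro add_mono mult_left_mono neg_ln_one_minus_le) auto
    also have "y\<^sup>2 * (\<kappa> + \<kappa>\<^sup>2) = x * y / 2 + x\<^sup>2 / 4"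
      using xy by (simp add: \<kappa>_def field_simps power2_eq_square)
    finally have "x / (4 * y) * E \<le> x\<^sup>2 * (7 / 10) + (x * y / 2 + x\<^sup>2 / 4)" by (simp add: \<kappa>_def)
    then have "(4 * y / x) * (x / (4 * y) * E) \<le> (4 * y / x) * (x\<^sup>2 * (7 / 10) + (x * y / 2 + x\<^sup>2 / 4))"
      using xy by (intro mult_left_mono) auto
    also have "(4 * y / x) * (x / (4 * y) * E) = E" using xy by simp
    also have "(4 * y / x) * (x\<^sup>2 * (7 / 10) + (x * y / 2 + x\<^sup>2 / 4)) = 19 / 5 * (x * y) + 2 * y\<^sup>2"
      using xy by (simp add: field_simps power2_eq_square)
    also have "\<dots> \<le> 2 * (x + y)\<^sup>2"
      using xy mult_pos_pos[of x y] by (simp add: power2_sum)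
    finally show ?thesis by (simp add: x_def y_def)
  qed
  have pos: "0 < real (card I)" "0 < real (card J)" using I J by (auto simp: card_gt_0_iff)
  have l: "- ln (1 - 1 / 2) = ln (2::real)" by (simp add: ln_div)
  show ?thesis
  proof (cases "card I \<le> card J")
    case True
    show ?thesis unfolding E_def[symmetric]
    proof (rule main)
      fix \<kappa> :: real assume "0 < \<kappa>" "\<kappa> \<le> 1 / 2"
      then show "1 / 2 * \<kappa> * E \<le> card I * ln 2 + card J * (- ln (1 - \<kappa>))"
        using integral_operator_norm_le[OF I(1) J(1), of "1/2" \<kappa> S, OF _ _ _ _ S int] unfolding E_def l by simp
    qed (use True pos in auto)
  next
    case False
    have "E \<le> 2 * (sqrt (card J) + sqrt (card I))\<^sup>2"
    proof (rule main)
      fix \<kappa> :: real assume "0 < \<kappa>" "\<kappa> \<le> 1 / 2"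
      then show "1 / 2 * \<kappa> * E \<le> card J * ln 2 + card I * (- ln (1 - \<kappa>))"
        using integral_operator_norm_le[OF I(1) J(1), of \<kappa> "1/2" S, OF _ _ _ _ S int] unfolding E_def l by simp
    qed (use False pos in auto)
    then show ?thesis by (simp add: E_def add.commute)
  qed
qed

subsection \<open>Elimination by plane rotations\<close>

definition orth_mat :: "nat \<Rightarrow> real mat \<Rightarrow> bool" where
  "orth_mat n R \<longleftrightarrow> R \<in> carrier_mat n n \<and> R * transpose_mat R = 1\<^sub>m n \<and> transpose_mat R * R = 1\<^sub>m n"

lemma orth_matD:
  assumes "orth_mat n R"
  shows "R \<in> carrier_mat n n" "R * transpose_mat R = 1\<^sub>m n" "transpose_mat R * R = 1\<^sub>m n"
    "dim_row R = n" "dim_col R = n"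
  using assms by (auto simp: orth_mat_def)

lemma orth_mat_one: "orth_mat n (1\<^sub>m n)"
  by (simp add: orth_mat_def)

lemma orth_mat_transpose: "orth_mat n R \<Longrightarrow> orth_mat n (transpose_mat R)"
  by (auto simp: orth_mat_def)

lemma orth_mat_mult:
  assumes "orth_mat n R" "orth_mat n Q"
  shows "orth_mat n (R * Q)"
proof -
  note R = orth_matD[OF assms(1)] and Q = orth_matD[OF assms(2)]
  have "R * Q * transpose_mat (R * Q) = R * (Q * transpose_mat Q) * transpose_mat R"
    using R(1) Q(1) by (simp add: transpose_mult[of R n n Q n] assoc_mult_mat[of _ n n _ n _ n])
  moreover have "transpose_mat (R * Q) * (R * Q) = transpose_mat Q * (transpose_mat R * R) * Q"
    using R(1) Q(1) by (simp add: transpose_mult[of R n n Q n] assoc_mult_mat[of _ n n _ n _ n])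
  ultimately show ?thesis
    using R Q by (simp add: orth_mat_def)
qed

lemma orth_mat_cols:
  assumes "orth_mat n R" "i < n" "j < n"
  shows "(\<Sum>a<n. R $$ (a, i) * R $$ (a, j)) = (if i = j then 1 else 0)"
proof -
  note R = orth_matD[OF assms(1)]
  have "(transpose_mat R * R) $$ (i, j) = (\<Sum>a<n. R $$ (a, i) * R $$ (a, j))"
    using R(1) assms(2,3) by (auto simp: scalar_prod_def lessThan_atLeast0 intro!: sum.cong)
  then show ?thesis using R(3) assms(2,3) by simp
qed

lemma orth_mat_rows:
  assumes "orth_mat n R" "i < n" "j < n"
  shows "(\<Sum>a<n. R $$ (i, a) * R $$ (j, a)) = (if i = j then 1 else 0)"
  using orth_mat_cols[OF orth_mat_transpose[OF assms(1)] assms(2,3)]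
    orth_matD(4,5)[OF assms(1)] assms(2,3)
  by simp

definition givens :: "nat \<Rightarrow> nat \<Rightarrow> nat \<Rightarrow> real \<Rightarrow> real \<Rightarrow> real mat" where
  "givens n i k c s = mat n n (\<lambda>(a, b).
     if a = i then (if b = i then c else if b = k then - s else 0)
     else if a = k then (if b = i then s else if b = k then c else 0)
     else if a = b then 1 else 0)"

lemma givens_carrier [simp]: "givens n i k c s \<in> carrier_mat n n"
  by (simp add: givens_def)

lemma givens_mult_index:
  assumes A: "A \<in> carrier_mat n m" and ik: "i < n" "k < n" "i \<noteq> k" and aj: "a < n" "j < m"
  shows "(givens n i k c s * A) $$ (a, j) =
    (if a = i then c * A $$ (i, j) - s * A $$ (k, j)
     else if a = k then s * A $$ (i, j) + c * A $$ (k, j) else A $$ (a, j))"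
proof -
  have two: "(\<Sum>b<n. if b = i then x else if b = k then y else 0) = x + y" for x y :: real
  proof -
    have "(\<Sum>b<n. if b = i then x else if b = k then y else 0)
       = (\<Sum>b<n. (if b = i then x else 0) + (if b = k then y else 0))"
      using ik by (intro sum.cong) auto
    then show ?thesis using ik by (simp add: sum.distrib)
  qed
  have "(givens n i k c s * A) $$ (a, j) = (\<Sum>b<n. givens n i k c s $$ (a, b) * A $$ (b, j))"
    using A aj by (auto simp: scalar_prod_def lessThan_atLeast0 givens_def intro!: sum.cong)
  also have "\<dots> = (\<Sum>b<n. if a = i then (if b = i then c * A $$ (i, j) else if b = k then - s * A $$ (k, j) else 0)
     else if a = k then (if b = i then s * A $$ (i, j) else if b = k then c * A $$ (k, j) else 0)
     else if a = b then A $$ (a, j) else 0)"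
    using aj ik by (intro sum.cong) (auto simp: givens_def)
  also have "\<dots> = (if a = i then c * A $$ (i, j) - s * A $$ (k, j)
     else if a = k then s * A $$ (i, j) + c * A $$ (k, j) else A $$ (a, j))"
    using aj by (auto simp: two)
  finally show ?thesis .
qed

lemma orth_mat_givens:
  assumes ik: "i < n" "k < n" "i \<noteq> k" and cs: "c\<^sup>2 + s\<^sup>2 = 1"
  shows "orth_mat n (givens n i k c s)"
proof -
  have t: "transpose_mat (givens n i k c s) = givens n i k c (- s)" for s
    using ik by (auto simp: givens_def)
  have "givens n i k c s * givens n i k c (- s) = 1\<^sub>m n" if "c\<^sup>2 + s\<^sup>2 = 1" for s
  proof (rule eq_matI)
    fix a b assume "a < dim_row (1\<^sub>m n)" "b < dim_col (1\<^sub>m n)"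
    then have ab: "a < n" "b < n" by auto
    show "(givens n i k c s * givens n i k c (- s)) $$ (a, b) = 1\<^sub>m n $$ (a, b)"
      using ab ik that by (subst givens_mult_index[OF givens_carrier ik ab])
        (auto simp: givens_def power2_eq_square)
  qed (auto simp: givens_def)
  from this[of s] this[of "- s"] show ?thesis
    using cs by (simp add: orth_mat_def t)
qed

text \<open>Products of plane rotations of the coordinates from \<open>k\<close> on. The condition \<open>0 \<le> c\<close> keeps away from
  the half turn, for which the decomposition into shears is not available.\<close>

inductive_set rotations :: "nat \<Rightarrow> nat \<Rightarrow> real mat set" for n k where
  one: "1\<^sub>m n \<in> rotations n k"
| step: "R \<in> rotations n k \<Longrightarrow> k \<le> i \<Longrightarrow> i < n \<Longrightarrow> k \<le> j \<Longrightarrow> j < n \<Longrightarrow> i \<noteq> j \<Longrightarrow> c\<^sup>2 + s\<^sup>2 = 1 \<Longrightarrow> 0 \<le> c \<Longrightarrow>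
    givens n i j c s * R \<in> rotations n k"

lemma rotations_orthogonal: "R \<in> rotations n k \<Longrightarrow> orth_mat n R"
  by (induction rule: rotations.induct)
    (auto intro: orth_mat_one orth_mat_mult orth_mat_givens)

lemma rotations_carrier: "R \<in> rotations n k \<Longrightarrow> R \<in> carrier_mat n n"
  using rotations_orthogonal orth_matD(1) by blast

lemma rotations_mono: "R \<in> rotations n k \<Longrightarrow> l \<le> k \<Longrightarrow> R \<in> rotations n l"
  by (induction rule: rotations.induct) (auto intro: rotations.intros)

lemma rotations_mult:
  assumes "R \<in> rotations n k" and Q: "Q \<in> rotations n k"
  shows "R * Q \<in> rotations n k"
  using assms(1)
proof (induction rule: rotations.induct)
  case one
  then show ?case using Q rotations_carrier[OF Q] by simp
next
  case (step R i j c s)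
  then show ?case
    using rotations.step[OF step.IH step.hyps(2-8)] rotations_carrier[OF Q] rotations_carrier[OF step.hyps(1)]
    by (simp add: assoc_mult_mat[of _ n n _ n _ n])
qed

lemma rotations_fix_upper:
  assumes "R \<in> rotations n k" "A \<in> carrier_mat n m" "a < k" "a < n" "j < m"
  shows "(R * A) $$ (a, j) = A $$ (a, j)"
  using assms(1)
proof (induction rule: rotations.induct)
  case one
  then show ?case using assms by simp
next
  case (step R i l c s)
  have "givens n i l c s * R * A = givens n i l c s * (R * A)"
    using rotations_carrier[OF step.hyps(1)] assms(2) by (simp add: assoc_mult_mat[of _ n n _ n _ m])
  moreover have "R * A \<in> carrier_mat n m" using rotations_carrier[OF step.hyps(1)] assms(2) by simp
  ultimately show ?case
    using step assms by (simp add: givens_mult_index[of _ n m])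
qed

text \<open>Together with \<open>rotations_fix_upper\<close> this protects finished columns:
  rotations of the rows from \<open>k\<close> on mix zeros with zeros and leave the rows above
  alone.\<close>

lemma rotations_zero_lower:
  assumes "R \<in> rotations n k" "A \<in> carrier_mat n m" "j < m"
    and z: "\<And>a. k \<le> a \<Longrightarrow> a < n \<Longrightarrow> A $$ (a, j) = 0"
  shows "k \<le> a \<Longrightarrow> a < n \<Longrightarrow> (R * A) $$ (a, j) = 0"
  using assms(1)
proof (induction arbitrary: a rule: rotations.induct)
  case one
  then show ?case using assms by simp
next
  case (step R i l c s)
  have "givens n i l c s * R * A = givens n i l c s * (R * A)"
    using rotations_carrier[OF step.hyps(1)] assms(2) by (simp add: assoc_mult_mat[of _ n n _ n _ m])
  moreover have "R * A \<in> carrier_mat n m" using rotations_carrier[OF step.hyps(1)] assms(2) by simp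
  ultimately show ?case
    using step assms by (simp add: givens_mult_index[of _ n m])
qed

text \<open>The cosine is \<open>\<bar>a\<bar> / r\<close> and not \<open>a / r\<close>, so that it
  is nonnegative; the sign of \<open>a\<close> goes into the sine.\<close>

lemma givens_annihilate:
  fixes a b :: real
  obtains c s where "c\<^sup>2 + s\<^sup>2 = 1" "0 \<le> c" "s * a + c * b = 0"
proof (cases "a = 0 \<and> b = 0")
  case True
  then show ?thesis using that[of 1 0] by simp
next
  case False
  define r where "r = sqrt (a\<^sup>2 + b\<^sup>2)"
  have r: "0 < r" "r\<^sup>2 = a\<^sup>2 + b\<^sup>2"
    using False by (auto simp: r_def sum_power2_gt_zero_iff)
  define e where "e = (if 0 \<le> a then 1 else - 1 :: real)"
  have e: "e\<^sup>2 = 1" "\<bar>a\<bar> = e * a" by (auto simp: e_def)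
  show ?thesis
  proof (rule that)
    show "(\<bar>a\<bar> / r)\<^sup>2 + (- e * b / r)\<^sup>2 = 1"
      using r False by (auto simp: power_divide power_mult_distrib e(1) add_divide_distrib[symmetric])
    show "0 \<le> \<bar>a\<bar> / r" using r by simp
    show "- e * b / r * a + \<bar>a\<bar> / r * b = 0" by (simp add: e(2))
  qed
qed

text \<open>Each row \<open>t\<close> below \<open>k\<close> is cleared by a rotation in the plane
  of \<open>k\<close> and \<open>t\<close>, which collects the length of the column in row
  \<open>k\<close>.\<close>

lemma rotations_eliminate_column:
  assumes A: "A \<in> carrier_mat n m" and k: "k < n" and j: "j < m"
  shows "\<exists>R\<in>rotations n k. \<forall>i. k < i \<longrightarrow> i < n \<longrightarrow> (R * A) $$ (i, j) = 0"
proof -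
  have "\<exists>R\<in>rotations n k. \<forall>i. k < i \<longrightarrow> i < t \<longrightarrow> (R * A) $$ (i, j) = 0" if "t \<le> n" for t
    using that
  proof (induction t)
    case 0
    then show ?case using rotations.one by auto
  next
    case (Suc t)
    then obtain R where R: "R \<in> rotations n k" "\<And>i. k < i \<Longrightarrow> i < t \<Longrightarrow> (R * A) $$ (i, j) = 0" by auto
    show ?case
    proof (cases "k < t")
      case False
      then show ?thesis using R by (auto simp: less_Suc_eq)
    next
      case True
      obtain c s where cs: "c\<^sup>2 + s\<^sup>2 = 1" "0 \<le> c" "s * (R * A) $$ (k, j) + c * (R * A) $$ (t, j) = 0"
        by (rule givens_annihilate)
      have RA: "R * A \<in> carrier_mat n m" using rotations_carrier[OF R(1)] A by simp
      have "givens n k t c s * R * A = givens n k t c s * (R * A)"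
        using rotations_carrier[OF R(1)] A by (simp add: assoc_mult_mat[of _ n n _ n _ m])
      moreover have "givens n k t c s * R \<in> rotations n k"
        using R(1) True Suc.prems k cs by (intro rotations.step) auto
      moreover have "(givens n k t c s * (R * A)) $$ (i, j) = 0" if "k < i" "i < Suc t" for i
        using that True Suc.prems k cs(3) R(2) j by (subst givens_mult_index[OF RA]) auto
      ultimately show ?thesis by (metis (no_types, lifting))
    qed
  qed
  from this[of n] show ?thesis by simp
qed

text \<open>QR decomposition by columns: column \<open>t\<close> is cleared below the diagonal by
  rotations of the rows from \<open>t\<close> on, which destroy no zero of the earlier
  columns.\<close>

lemma rotations_upper_triangular:
  assumes A: "A \<in> carrier_mat n m"
  shows "\<exists>R\<in>rotations n 0. \<forall>j<m. \<forall>i<n. j < i \<longrightarrow> (R * A) $$ (i, j) = 0"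
proof -
  have "\<exists>R\<in>rotations n 0. \<forall>j<t. \<forall>i<n. j < i \<longrightarrow> (R * A) $$ (i, j) = 0" if "t \<le> m" for t
    using that
  proof (induction t)
    case 0
    then show ?case using rotations.one by auto
  next
    case (Suc t)
    then obtain R where R: "R \<in> rotations n 0" "\<And>i j. j < t \<Longrightarrow> i < n \<Longrightarrow> j < i \<Longrightarrow> (R * A) $$ (i, j) = 0" by auto
    show ?case
    proof (cases "t < n")
      case False
      then show ?thesis using R by (auto simp: less_Suc_eq intro!: bexI[of _ R])
    next
      case True
      have RA: "R * A \<in> carrier_mat n m" using rotations_carrier[OF R(1)] A by simp
      obtain Q where Q: "Q \<in> rotations n t" "\<And>i. t < i \<Longrightarrow> i < n \<Longrightarrow> (Q * (R * A)) $$ (i, t) = 0"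
        using rotations_eliminate_column[OF RA True, of t] Suc.prems by auto
      have "(Q * (R * A)) $$ (i, j) = 0" if "j < Suc t" "i < n" "j < i" for i j
      proof (cases "j = t")
        case True
        then show ?thesis using Q(2) that by simp
      next
        case False
        then have j: "j < t" "j < m" using that Suc.prems by auto
        show ?thesis
        proof (cases "i < t")
          case True
          then show ?thesis
            using rotations_fix_upper[OF Q(1) RA True that(2) j(2)] R(2)[OF j(1) that(2,3)] by simp
        next
          case False
          then show ?thesis
            using rotations_zero_lower[OF Q(1) RA j(2), of i] R(2)[OF j(1)] j that by auto
        qed
      qed
      moreover have "Q * R * A = Q * (R * A)"
        using rotations_carrier[OF R(1)] rotations_carrier[OF Q(1)] A by (simp add: assoc_mult_mat[of _ n n _ n _ m])
      moreover have "Q * R \<in> rotations n 0"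
        using R(1) rotations_mono[OF Q(1)] by (intro rotations_mult) auto
      ultimately show ?thesis by (metis (no_types, lifting))
    qed
  qed
  from this[of m] show ?thesis by simp
qed

subsection \<open>Singular values and Ky Fan norms\<close>

text \<open>A complex eigenvector \<open>z\<close> exists. Symmetry makes the Hermitian form
  \<open>S\<close> real and hence the eigenvalue too, so that the real or the imaginary part of
  \<open>z\<close> is a real eigenvector. The entries are given by a function, into which a trailing
  block is inserted by an index shift.\<close>

lemma symmetric_real_eigenvector:
  fixes a :: "nat \<Rightarrow> nat \<Rightarrow> real"
  assumes n: "0 < n" and sym: "\<And>i j. i < n \<Longrightarrow> j < n \<Longrightarrow> a i j = a j i"
  shows "\<exists>\<mu> v. (\<exists>i<n. v i \<noteq> 0) \<and> (\<forall>i<n. (\<Sum>j<n. a i j * v j) = \<mu> * v i)"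
proof -
  define C where "C = mat n n (\<lambda>(i, j). complex_of_real (a i j))"
  have C: "C \<in> carrier_mat n n" by (simp add: C_def)
  have "degree (char_poly C) = n" using degree_monic_char_poly[OF C] by simp
  then have "\<not> constant (poly (char_poly C))" using n by (simp add: constant_degree)
  then obtain \<mu> where "poly (char_poly C) \<mu> = 0" using fundamental_theorem_of_algebra by blast
  then obtain z where z: "z \<in> carrier_vec n" "z \<noteq> 0\<^sub>v n" "C *\<^sub>v z = \<mu> \<cdot>\<^sub>v z"
    using C unfolding eigenvalue_root_char_poly[OF C, symmetric] eigenvalue_def eigenvector_def by auto
  have ev: "(\<Sum>j<n. of_real (a i j) * z $ j) = \<mu> * z $ i" if i: "i < n" for i
  proof -
    have "(C *\<^sub>v z) $ i = (\<Sum>j<n. of_real (a i j) * z $ j)"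
      using i z(1) by (auto simp: C_def scalar_prod_def lessThan_atLeast0 intro!: sum.cong)
    then show ?thesis using z i by simp
  qed
  obtain l where l: "l < n" "z $ l \<noteq> 0" using z(1,2) by (auto simp: vec_eq_iff)
  define N where "N = (\<Sum>i<n. (cmod (z $ i))\<^sup>2)"
  have "0 < (cmod (z $ l))\<^sup>2" using l by simp
  also have "\<dots> \<le> N" unfolding N_def using l by (intro member_le_sum) auto
  finally have N: "0 < N" .
  define S where "S = (\<Sum>i<n. \<Sum>j<n. of_real (a i j) * (cnj (z $ i) * z $ j))"
  have "S = (\<Sum>i<n. cnj (z $ i) * (\<Sum>j<n. of_real (a i j) * z $ j))"
    by (simp add: S_def sum_distrib_left mult_ac)
  also have "\<dots> = (\<Sum>i<n. \<mu> * (z $ i * cnj (z $ i)))"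
    by (intro sum.cong) (auto simp: ev)
  also have "\<dots> = \<mu> * of_real N"
    by (simp add: N_def sum_distrib_left complex_norm_square[symmetric])
  finally have S1: "S = \<mu> * of_real N" .
  have "cnj S = (\<Sum>i<n. \<Sum>j<n. of_real (a i j) * (cnj (z $ j) * z $ i))"
    by (simp add: S_def cnj_sum mult_ac)
  also have "\<dots> = (\<Sum>j<n. \<Sum>i<n. of_real (a i j) * (cnj (z $ j) * z $ i))" by (rule sum.swap)
  also have "\<dots> = S" unfolding S_def using sym by (intro sum.cong refl) auto
  finally have "Im S = 0" by (metis complex_cnj_cancel_iff cnj.simps(2) neg_equal_zero)
  then have "Im \<mu> = 0" using N by (simp add: S1)
  then have \<mu>: "\<mu> = of_real (Re \<mu>)" by (simp add: complex_eq_iff)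
  have re: "(\<Sum>j<n. a i j * Re (z $ j)) = Re \<mu> * Re (z $ i)"
    and im: "(\<Sum>j<n. a i j * Im (z $ j)) = Re \<mu> * Im (z $ i)" if "i < n" for i
    using arg_cong[OF ev[OF that], of Re] arg_cong[OF ev[OF that], of Im] \<open>Im \<mu> = 0\<close>
    by (simp_all add: Re_sum Im_sum)
  show ?thesis
  proof (cases "Re (z $ l) = 0")
    case False
    then show ?thesis using l re by (intro exI[of _ "Re \<mu>"] exI[of _ "\<lambda>j. Re (z $ j)"]) auto
  next
    case True
    then have "Im (z $ l) \<noteq> 0" using l by (auto simp: complex_eq_iff)
    then show ?thesis using l im by (intro exI[of _ "Re \<mu>"] exI[of _ "\<lambda>j. Im (z $ j)"]) auto
  qed
qed

lemma mat_mult_index_sum: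
  assumes "A \<in> carrier_mat n k" "B \<in> carrier_mat k m" "i < n" "j < m"
  shows "(A * B) $$ (i, j) = (\<Sum>l<k. A $$ (i, l) * B $$ (l, j))"
  using assms by (auto simp: scalar_prod_def lessThan_atLeast0 intro!: sum.cong)

lemma symmetric_mat_conj:
  fixes B R :: "real mat"
  assumes "B \<in> carrier_mat n n" "transpose_mat B = B" "R \<in> carrier_mat n n"
  shows "transpose_mat (R * B * transpose_mat R) = R * B * transpose_mat R"
proof -
  have "transpose_mat (R * B * transpose_mat R) = transpose_mat (transpose_mat R) * transpose_mat (R * B)"
    by (rule transpose_mult) (use assms in auto)
  also have "transpose_mat (R * B) = B * transpose_mat R"
    using transpose_mult[OF assms(3,1)] assms(2) by simp
  finally show ?thesis
    using assms by (simp add: assoc_mult_mat[of _ n n _ n _ n])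
qed

text \<open>An eigenvector of the trailing block, padded with zeros, is an eigenvector of the whole
  matrix. Rotations of the coordinates from \<open>k\<close> on turn it into the \<open>k\<close>-th
  axis, after which column \<open>k\<close> is zero off the diagonal; row \<open>k\<close> follows
  by symmetry.\<close>

lemma symmetric_mat_diagonalize_upto:
  fixes A :: "real mat"
  assumes A: "A \<in> carrier_mat n n" and sym: "transpose_mat A = A" and "k \<le> n"
  shows "\<exists>Q. orth_mat n Q \<and>
    (\<forall>i<n. \<forall>j<n. i \<noteq> j \<longrightarrow> i < k \<or> j < k \<longrightarrow> (Q * A * transpose_mat Q) $$ (i, j) = 0)"
  using \<open>k \<le> n\<close>
proof (induction k)
  case 0
  then show ?case using orth_mat_one by auto
next
  case (Suc k)
  then have k: "k < n" by simp
  from Suc obtain Q where Q: "orth_mat n Q"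
    and diag: "\<And>i j. i < n \<Longrightarrow> j < n \<Longrightarrow> i \<noteq> j \<Longrightarrow> i < k \<or> j < k \<Longrightarrow> (Q * A * transpose_mat Q) $$ (i, j) = 0"
    by auto
  note Qc = orth_matD(1)[OF Q]
  define B where "B = Q * A * transpose_mat Q"
  have B: "B \<in> carrier_mat n n" using A Qc by (simp add: B_def)
  have Bsym: "transpose_mat B = B" unfolding B_def by (rule symmetric_mat_conj[OF A sym Qc])
  have Bs: "B $$ (i, j) = B $$ (j, i)" if "i < n" "j < n" for i j
    using arg_cong[OF Bsym, of "\<lambda>M. M $$ (i, j)"] that B by simp
  obtain \<mu> v where v: "\<exists>i<n - k. v i \<noteq> 0"
    and ev: "\<And>i. i < n - k \<Longrightarrow> (\<Sum>j<n - k. B $$ (k + i, k + j) * v j) = \<mu> * v i"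
    using symmetric_real_eigenvector[of "n - k" "\<lambda>i j. B $$ (k + i, k + j)"] k Bs by auto
  define W where "W = mat n 1 (\<lambda>(i, _). if i < k then 0 else v (i - k))"
  have W: "W \<in> carrier_mat n 1" by (simp add: W_def)
  have BW: "B * W = \<mu> \<cdot>\<^sub>m W"
  proof (rule eq_matI)
    fix i j assume "i < dim_row (\<mu> \<cdot>\<^sub>m W)" "j < dim_col (\<mu> \<cdot>\<^sub>m W)"
    then have i: "i < n" and j: "j = 0" by (auto simp: W_def)
    have "(B * W) $$ (i, 0) = (\<Sum>l<n. B $$ (i, l) * W $$ (l, 0))"
      using i by (intro mat_mult_index_sum[OF B W]) auto
    also have "\<dots> = \<mu> * W $$ (i, 0)"
    proof (cases "i < k")
      case True
      have "B $$ (i, l) * W $$ (l, 0) = 0" if "l < n" for l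
        using diag[of i l] that i True k by (cases "i = l") (auto simp: B_def W_def)
      then have "(\<Sum>l<n. B $$ (i, l) * W $$ (l, 0)) = 0" by (intro sum.neutral) blast
      then show ?thesis using True i by (simp add: W_def)
    next
      case False
      have "(\<Sum>l<n. B $$ (i, l) * W $$ (l, 0)) = (\<Sum>l\<in>{k..<n}. B $$ (i, l) * v (l - k))"
        by (intro sum.mono_neutral_cong_right) (auto simp: W_def)
      also have "\<dots> = (\<Sum>l<n - k. B $$ (i, k + l) * v l)"
        by (rule sum.reindex_bij_witness[of _ "\<lambda>l. k + l" "\<lambda>l. l - k"]) auto
      also have "\<dots> = \<mu> * v (i - k)" using ev[of "i - k"] False i by auto
      finally show ?thesis using False i by (simp add: W_def)
    qed
    finally show "(B * W) $$ (i, j) = (\<mu> \<cdot>\<^sub>m W) $$ (i, j)" using i j by (simp add: W_def)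
  qed (use B in \<open>auto simp: W_def\<close>)
  obtain R where R: "R \<in> rotations n k" and Rz: "\<And>i. k < i \<Longrightarrow> i < n \<Longrightarrow> (R * W) $$ (i, 0) = 0"
    using rotations_eliminate_column[OF W k, of 0] by auto
  have Ro: "orth_mat n R" by (rule rotations_orthogonal[OF R])
  note Rc = orth_matD(1)[OF Ro]
  \<comment> \<open>\<open>R * W\<close> is concentrated in coordinate \<open>k\<close>, which makes
    the \<open>k\<close>-th axis an eigenvector of \<open>A'\<close>.\<close>
  have RW0: "(R * W) $$ (i, 0) = 0" if "i < n" "i \<noteq> k" for i
    using that Rz[of i] rotations_fix_upper[OF R W, of i 0] by (cases "k < i") (auto simp: W_def)
  have RtRW: "transpose_mat R * (R * W) = W"
    using Rc W orth_matD(3)[OF Ro] by (simp add: assoc_mult_mat[of _ n n _ n _ 1, symmetric])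
  have g: "(R * W) $$ (k, 0) \<noteq> 0"
  proof
    assume "(R * W) $$ (k, 0) = 0"
    then have z: "(R * W) $$ (i, 0) = 0" if "i < n" for i using RW0 that by (cases "i = k") auto
    obtain l where l: "l < n - k" "v l \<noteq> 0" using v by auto
    have "W $$ (k + l, 0) = (\<Sum>i<n. transpose_mat R $$ (k + l, i) * (R * W) $$ (i, 0))"
      by (subst RtRW[symmetric], rule mat_mult_index_sum) (use Rc W l in auto)
    then show False using z l by (simp add: W_def)
  qed
  define A' where "A' = R * B * transpose_mat R"
  have A': "A' \<in> carrier_mat n n" using Rc B by (simp add: A'_def)
  have A'sym: "transpose_mat A' = A'" unfolding A'_def by (rule symmetric_mat_conj[OF B Bsym Rc])
  have As: "A' $$ (i, j) = A' $$ (j, i)" if "i < n" "j < n" for i j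
    using arg_cong[OF A'sym, of "\<lambda>M. M $$ (i, j)"] that A' by simp
  have "A' * (R * W) = R * (B * (transpose_mat R * (R * W)))"
    using Rc B W unfolding A'_def
    by (simp add: assoc_mult_mat[of _ n n _ n _ n] assoc_mult_mat[of _ n n _ n _ 1])
  also have "\<dots> = \<mu> \<cdot>\<^sub>m (R * W)"
    unfolding RtRW BW using Rc W by (simp add: mult_smult_distrib[of _ n n _ 1])
  finally have AW: "A' * (R * W) = \<mu> \<cdot>\<^sub>m (R * W)" .
  have colk: "A' $$ (i, k) = 0" if "i < n" "i \<noteq> k" for i
  proof -
    have "(A' * (R * W)) $$ (i, 0) = (\<Sum>l<n. A' $$ (i, l) * (R * W) $$ (l, 0))"
      by (rule mat_mult_index_sum[OF A']) (use Rc W that in auto)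
    also have "\<dots> = (\<Sum>l\<in>{k}. A' $$ (i, l) * (R * W) $$ (l, 0))"
      using k RW0 by (intro sum.mono_neutral_right) auto
    finally have "A' $$ (i, k) * (R * W) $$ (k, 0) = \<mu> * (R * W) $$ (i, 0)"
      unfolding AW using that Rc W by simp
    then show ?thesis using RW0[OF that] g by simp
  qed
  \<comment> \<open>The finished rows survive because \<open>R\<close> acts as the identity on the
    first \<open>k\<close> coordinates.\<close>
  have rowlow: "A' $$ (a, j) = 0" if a: "a < k" and j: "j < n" "j \<noteq> a" for a j
  proof -
    have an: "a < n" using a k by simp
    have BR: "B * transpose_mat R \<in> carrier_mat n n" using B Rc by simp
    have "A' = R * (B * transpose_mat R)" using Rc B by (simp add: A'_def assoc_mult_mat[of _ n n _ n _ n])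
    then have "A' $$ (a, j) = (B * transpose_mat R) $$ (a, j)"
      using rotations_fix_upper[OF R BR a an j(1)] by simp
    also have "\<dots> = (\<Sum>l<n. B $$ (a, l) * transpose_mat R $$ (l, j))"
      by (rule mat_mult_index_sum[OF B]) (use Rc an j in auto)
    also have "\<dots> = (\<Sum>l\<in>{a}. B $$ (a, l) * transpose_mat R $$ (l, j))"
      using an a diag by (intro sum.mono_neutral_right) (auto simp: B_def)
    also have "\<dots> = B $$ (a, a) * (R * 1\<^sub>m n) $$ (j, a)" using Rc an j by simp
    also have "(R * 1\<^sub>m n) $$ (j, a) = 0"
    proof (cases "j < k")
      case True
      then show ?thesis using rotations_fix_upper[OF R, of "1\<^sub>m n" n j a] an j by simp
    next
      case False
      then show ?thesis using rotations_zero_lower[OF R, of "1\<^sub>m n" n a j] an j a by simp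
    qed
    finally show ?thesis by simp
  qed
  have "(R * Q) * A * transpose_mat (R * Q) = A'"
    using Rc Qc A unfolding A'_def B_def
    by (simp add: transpose_mult[of _ n n _ n] assoc_mult_mat[of _ n n _ n _ n])
  moreover have "A' $$ (i, j) = 0" if "i < n" "j < n" "i \<noteq> j" "i < Suc k \<or> j < Suc k" for i j
    using that colk[of i] colk[of j] rowlow[of i j] rowlow[of j i] As[of i j] by (auto simp: less_Suc_eq)
  ultimately show ?case
    using orth_mat_mult[OF Ro Q] by auto
qed

text \<open>The link to \<open>singular_values\<close>: the characteristic polynomial is invariant
  under similarity, and its roots with multiplicity are the entries of the diagonal form.\<close>

lemma symmetric_mat_diagonalize:
  fixes A :: "real mat"
  assumes A: "A \<in> carrier_mat n n" and sym: "transpose_mat A = A"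
  obtains Q where "orth_mat n Q" "diagonal_mat (Q * A * transpose_mat Q)"
    "proots (char_poly A) = mset (diag_mat (Q * A * transpose_mat Q))"
proof -
  obtain Q where Q: "orth_mat n Q"
    and d: "\<And>i j. i < n \<Longrightarrow> j < n \<Longrightarrow> i \<noteq> j \<Longrightarrow> (Q * A * transpose_mat Q) $$ (i, j) = 0"
    using symmetric_mat_diagonalize_upto[OF A sym order_refl] by auto
  note Qc = orth_matD(1)[OF Q]
  define D where "D = Q * A * transpose_mat Q"
  have D: "D \<in> carrier_mat n n" using A Qc by (simp add: D_def)
  have "similar_mat_wit D A Q (transpose_mat Q)"
    using A Qc orth_matD[OF Q] D by (intro similar_mat_witI[of _ _ n]) (auto simp: D_def)
  then have "char_poly A = char_poly D"
    using char_poly_similar[of D A] unfolding similar_mat_def by metis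
  also have "\<dots> = (\<Prod>a\<leftarrow>diag_mat D. [:- a, 1:])"
    by (rule char_poly_upper_triangular[OF D], rule upper_triangularI) (use d D in \<open>auto simp: D_def\<close>)
  finally have cp: "char_poly A = (\<Prod>a\<leftarrow>diag_mat D. [:- a, 1:])" .
  have "proots (\<Prod>a\<leftarrow>xs. [:- a, 1:]) = mset xs" for xs :: "real list"
  proof (induction xs)
    case (Cons x xs)
    have "(\<Prod>a\<leftarrow>xs. [:- a, 1:]) \<noteq> 0" by (auto simp: prod_list_zero_iff)
    then show ?case using Cons by (simp add: proots_mult del: mult_pCons_left)
  qed simp
  then have "proots (char_poly A) = mset (diag_mat D)" by (simp add: cp)
  moreover have "diagonal_mat D" using d D unfolding diagonal_mat_def D_def by auto
  ultimately show ?thesis using that[OF Q] unfolding D_def by blast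
qed

lemma gram_index:
  fixes M N :: "real mat"
  assumes "M \<in> carrier_mat q n" "N \<in> carrier_mat q k" "i < n" "j < k"
  shows "(transpose_mat M * N) $$ (i, j) = (\<Sum>a<q. M $$ (a, i) * N $$ (a, j))"
  using mat_mult_index_sum[of "transpose_mat M" n q N k i j] assms by simp

lemma orth_matI:
  assumes V: "V \<in> carrier_mat n n"
    and c: "\<And>i j. i < n \<Longrightarrow> j < n \<Longrightarrow> (\<Sum>a<n. V $$ (a, i) * V $$ (a, j)) = (if i = j then 1 else 0)"
  shows "orth_mat n V"
proof -
  have "transpose_mat V * V = 1\<^sub>m n"
    by (rule eq_matI) (use V c in \<open>auto simp: gram_index[OF V V] simp del: index_mult_mat(1)\<close>)
  then show ?thesis
    using V mat_mult_left_right_inverse[of "transpose_mat V" n V] by (simp add: orth_mat_def)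
qed

text \<open>The columns of \<open>V\<close> are right singular vectors, that is, eigenvectors of the
  Gram matrix permuted such that the eigenvalues decrease.\<close>

lemma singular_basis:
  assumes G: "G \<in> carrier_mat q n"
  obtains V where "orth_mat n V"
    "\<forall>i<n. \<forall>j<n. (\<Sum>a<q. (G * V) $$ (a, i) * (G * V) $$ (a, j)) =
        (if i = j then (singular_value (Suc i) G)\<^sup>2 else 0)"
    "\<forall>j<n. \<forall>i\<le>j. (singular_value (Suc j) G)\<^sup>2 \<le> (singular_value (Suc i) G)\<^sup>2"
proof -
  define A where "A = transpose_mat G * G"
  have A: "A \<in> carrier_mat n n" using G by (simp add: A_def)
  have "transpose_mat A = transpose_mat G * transpose_mat (transpose_mat G)"
    unfolding A_def by (rule transpose_mult) (use G in auto)
  then have sym: "transpose_mat A = A" by (simp add: A_def)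
  obtain Q where Q: "orth_mat n Q" and dg: "diagonal_mat (Q * A * transpose_mat Q)"
    and pr: "proots (char_poly A) = mset (diag_mat (Q * A * transpose_mat Q))"
    by (rule symmetric_mat_diagonalize[OF A sym])
  note Qc = orth_matD(1)[OF Q]
  define D where "D = Q * A * transpose_mat Q"
  have D: "D \<in> carrier_mat n n" using A Qc by (simp add: D_def)
  define ds where "ds = rev (sort (diag_mat D))"
  have sv: "singular_values G = map sqrt ds"
    unfolding singular_values_def A_def[symmetric] pr ds_def D_def by simp
  have lds: "length ds = n" using D by (simp add: ds_def diag_mat_def)
  have "mset ds = mset (diag_mat D)" by (simp add: ds_def)
  then obtain p where p: "p permutes {..<length (diag_mat D)}" "permute_list p (diag_mat D) = ds"
    by (rule mset_eq_permutation)
  have ld: "length (diag_mat D) = n" using D by (simp add: diag_mat_def)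
  have pn: "p i < n" if "i < n" for i
    using permutes_in_image[OF p(1)] that ld by auto
  have pinj: "p i = p j \<longleftrightarrow> i = j" for i j using permutes_inj[OF p(1)] by (auto dest: injD)
  have dsi: "ds ! i = D $$ (p i, p i)" if "i < n" for i
    using permute_list_nth[OF p(1), of i] p(2) that ld pn[OF that] D by (simp add: diag_mat_def)
  define V where "V = mat n n (\<lambda>(a, i). Q $$ (p i, a))"
  have V: "V \<in> carrier_mat n n" by (simp add: V_def)
  have Vo: "orth_mat n V"
  proof (rule orth_matI[OF V])
    fix i j assume "i < n" "j < n"
    then show "(\<Sum>a<n. V $$ (a, i) * V $$ (a, j)) = (if i = j then 1 else 0)"
      using orth_mat_rows[OF Q pn pn, of i j] by (simp add: V_def pinj)
  qed
  have GV: "G * V \<in> carrier_mat q n" using G V by simp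
  have key: "(\<Sum>a<q. (G * V) $$ (a, i) * (G * V) $$ (a, j)) = D $$ (p i, p j)" if ij: "i < n" "j < n" for i j
  proof -
    have "(\<Sum>a<q. (G * V) $$ (a, i) * (G * V) $$ (a, j)) = (transpose_mat (G * V) * (G * V)) $$ (i, j)"
      by (rule gram_index[symmetric, OF GV GV ij])
    also have "transpose_mat (G * V) * (G * V) = transpose_mat V * (A * V)"
      using G V unfolding A_def
      by (simp add: transpose_mult[OF G V] assoc_mult_mat[of _ n q _ n _ n] assoc_mult_mat[of _ n n _ q _ n])
    also have "\<dots> $$ (i, j) = (\<Sum>a<n. V $$ (a, i) * (A * V) $$ (a, j))"
      using A V by (intro gram_index[OF V _ ij]) auto
    also have "\<dots> = (\<Sum>a<n. V $$ (a, i) * (\<Sum>b<n. A $$ (a, b) * V $$ (b, j)))"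
      by (intro sum.cong refl arg_cong2[where f="(*)"] mat_mult_index_sum[OF A V _ ij(2)]) simp
    also have "\<dots> = (\<Sum>a<n. Q $$ (p i, a) * (\<Sum>b<n. A $$ (a, b) * Q $$ (p j, b)))"
      using ij by (intro sum.cong refl) (simp add: V_def)
    also have "\<dots> = (Q * (A * transpose_mat Q)) $$ (p i, p j)"
    proof -
      have "(A * transpose_mat Q) $$ (a, p j) = (\<Sum>b<n. A $$ (a, b) * Q $$ (p j, b))" if "a < n" for a
        using mat_mult_index_sum[OF A, of "transpose_mat Q" n a "p j"] Qc that pn[OF ij(2)] by simp
      then show ?thesis
        using mat_mult_index_sum[OF Qc, of "A * transpose_mat Q" n "p i" "p j"] A Qc pn[OF ij(1)] pn[OF ij(2)]
        by (simp del: index_mult_mat(1))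
    qed
    finally show ?thesis using A Qc by (simp add: D_def assoc_mult_mat[of _ n n _ n _ n])
  qed
  \<comment> \<open>Each eigenvalue is a squared column length, so that squaring undoes the square
    root in \<open>singular_values\<close>.\<close>
  have dpos: "0 \<le> ds ! i" if "i < n" for i
    unfolding dsi[OF that] key[OF that that, symmetric] by (intro sum_nonneg) simp
  have svi: "(singular_value (Suc i) G)\<^sup>2 = ds ! i" if "i < n" for i
    using that lds dpos[OF that] by (simp add: singular_value_def sv)
  have "sorted_wrt (\<ge>) ds"
    unfolding ds_def sorted_wrt_rev by simp
  then have mono: "ds ! j \<le> ds ! i" if "i \<le> j" "j < n" for i j
    using that lds by (cases "i = j") (auto simp: sorted_wrt_iff_nth_less)
  show ?thesis
  proof (rule that[OF Vo]; intro allI impI)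
    fix i j assume ij: "i < n" "j < n"
    show "(\<Sum>a<q. (G * V) $$ (a, i) * (G * V) $$ (a, j)) = (if i = j then (singular_value (Suc i) G)\<^sup>2 else 0)"
      using dg D pn ij pinj[of i j] unfolding key[OF ij] svi[OF ij(1)] dsi[OF ij(1)] diagonal_mat_def D_def[symmetric] by auto
  next
    fix j i assume "j < n" "i \<le> j"
    then show "(singular_value (Suc j) G)\<^sup>2 \<le> (singular_value (Suc i) G)\<^sup>2"
      using mono svi by auto
  qed
qed

section \<open>Variational properties of the Ky Fan norms\<close>

definition col_sq :: "real mat \<Rightarrow> nat \<Rightarrow> real" where
  "col_sq M j = (\<Sum>a<dim_row M. (M $$ (a, j))\<^sup>2)"

lemma col_sq_nonneg: "0 \<le> col_sq M j"
  by (simp add: col_sq_def sum_nonneg)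

lemma hs_norm_nonneg: "0 \<le> hs_norm M"
  by (simp add: hs_norm_def sum_nonneg)

lemma hs_norm_sq_cols: "(hs_norm M)\<^sup>2 = (\<Sum>j<dim_col M. col_sq M j)"
proof -
  have "(hs_norm M)\<^sup>2 = (\<Sum>i<dim_row M. \<Sum>j<dim_col M. (M $$ (i, j))\<^sup>2)"
    by (simp add: hs_norm_def sum_nonneg)
  also have "\<dots> = (\<Sum>j<dim_col M. col_sq M j)"
    unfolding col_sq_def by (rule sum.swap)
  finally show ?thesis .
qed

lemma hs_norm_transpose: "hs_norm (transpose_mat M) = hs_norm M"
  unfolding hs_norm_def by (subst sum.swap) simp

lemma col_sq_orthogonal_mult:
  assumes R: "orth_mat n R" and M: "M \<in> carrier_mat n m" and j: "j < m"
  shows "col_sq (R * M) j = col_sq M j"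
proof -
  note Rc = orth_matD(1)[OF R]
  have RM: "R * M \<in> carrier_mat n m" using Rc M by simp
  have "transpose_mat (R * M) * (R * M) = transpose_mat M * (transpose_mat R * R * M)"
    using Rc M by (simp add: transpose_mult[OF Rc M] assoc_mult_mat[of _ m n _ n _ m] assoc_mult_mat[of _ n n _ n _ m])
  then have "transpose_mat (R * M) * (R * M) = transpose_mat M * M"
    using M orth_matD(3)[OF R] by simp
  then have "(transpose_mat (R * M) * (R * M)) $$ (j, j) = (transpose_mat M * M) $$ (j, j)" by simp
  then show ?thesis
    unfolding gram_index[OF RM RM j j] gram_index[OF M M j j]
    using M Rc by (simp add: col_sq_def power2_eq_square)
qed

lemma hs_norm_orthogonal_mult:
  assumes R: "orth_mat n R" and M: "M \<in> carrier_mat n m"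
  shows "hs_norm (R * M) = hs_norm M"
proof -
  have "(hs_norm (R * M))\<^sup>2 = (hs_norm M)\<^sup>2"
    unfolding hs_norm_sq_cols using M by (simp add: col_sq_orthogonal_mult[OF R M])
  then show ?thesis by (simp add: hs_norm_nonneg)
qed

lemma hs_norm_mult_orthogonal:
  assumes R: "orth_mat n R" and M: "M \<in> carrier_mat m n"
  shows "hs_norm (M * R) = hs_norm M"
proof -
  have "hs_norm (M * R) = hs_norm (transpose_mat R * transpose_mat M)"
    by (subst hs_norm_transpose[symmetric]) (simp add: transpose_mult[OF M orth_matD(1)[OF R]])
  also have "\<dots> = hs_norm M"
    using hs_norm_orthogonal_mult[OF orth_mat_transpose[OF R], of "transpose_mat M" m] M
    by (simp add: hs_norm_transpose)
  finally show ?thesis .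
qed

lemma ky_fan2_nonneg: "0 \<le> ky_fan2 r G"
  by (simp add: ky_fan2_def sum_nonneg)

lemma ky_fan2_sq: "(ky_fan2 r G)\<^sup>2 = (\<Sum>j<r. (singular_value (Suc j) G)\<^sup>2)"
proof -
  have "(ky_fan2 r G)\<^sup>2 = (\<Sum>k=1..r. (singular_value k G)\<^sup>2)"
    by (simp add: ky_fan2_def sum_nonneg)
  also have "\<dots> = (\<Sum>j<r. (singular_value (Suc j) G)\<^sup>2)"
    by (rule sum.reindex_bij_witness[of _ Suc "\<lambda>k. k - 1"]) auto
  finally show ?thesis .
qed

lemma ky_fan2_attained:
  assumes G: "G \<in> carrier_mat q n"
  obtains V where "orth_mat n V" "\<forall>r\<le>n. (\<Sum>j<r. col_sq (G * V) j) = (ky_fan2 r G)\<^sup>2"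
proof -
  obtain V where V: "orth_mat n V"
    "\<forall>i<n. \<forall>j<n. (\<Sum>a<q. (G * V) $$ (a, i) * (G * V) $$ (a, j)) =
        (if i = j then (singular_value (Suc i) G)\<^sup>2 else 0)"
    "\<forall>j<n. \<forall>i\<le>j. (singular_value (Suc j) G)\<^sup>2 \<le> (singular_value (Suc i) G)\<^sup>2"
    by (rule singular_basis[OF G])
  show ?thesis
  proof (rule that[OF V(1)]; intro allI impI)
    fix r assume r: "r \<le> n"
    show "(\<Sum>j<r. col_sq (G * V) j) = (ky_fan2 r G)\<^sup>2"
      unfolding ky_fan2_sq
    proof (rule sum.cong[OF refl])
      fix j assume "j \<in> {..<r}"
      then show "col_sq (G * V) j = (singular_value (Suc j) G)\<^sup>2"
        using V(2) r G by (simp add: col_sq_def power2_eq_square del: index_mult_mat(1))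
    qed
  qed
qed

text \<open>The value \<open>t = l (r - 1)\<close> separates the first \<open>r\<close> entries from
  the others, so that moving weight from the tail to the unfilled part of the first \<open>r\<close>
  positions cannot decrease the sum.\<close>

lemma weighted_sum_le_partial_sum:
  fixes l c :: "nat \<Rightarrow> real"
  assumes "r \<le> n"
    and dec: "\<And>i j. i \<le> j \<Longrightarrow> j < n \<Longrightarrow> l j \<le> l i"
    and c: "\<And>i. i < n \<Longrightarrow> 0 \<le> c i" "\<And>i. i < n \<Longrightarrow> c i \<le> 1" and s: "(\<Sum>i<n. c i) = real r"
  shows "(\<Sum>i<n. l i * c i) \<le> (\<Sum>i<r. l i)"
proof (cases "r = 0")
  case True
  then have "\<forall>i<n. c i = 0" using s c(1) sum_nonneg_eq_0_iff[of "{..<n}" c] by auto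
  then show ?thesis using True by simp
next
  case False
  define t where "t = l (r - 1)"
  have split: "{..<n} = {..<r} \<union> {r..<n}" using \<open>r \<le> n\<close> by auto
  have S: "(\<Sum>i<n. f i) = (\<Sum>i<r. f i) + (\<Sum>i=r..<n. f i)" for f :: "nat \<Rightarrow> real"
    unfolding split by (rule sum.union_disjoint) auto
  have "(\<Sum>i=r..<n. l i * c i) \<le> (\<Sum>i=r..<n. t * c i)"
    unfolding t_def using c dec by (intro sum_mono mult_right_mono) auto
  moreover have "(\<Sum>i<r. t * (1 - c i)) \<le> (\<Sum>i<r. l i * (1 - c i))"
    unfolding t_def using c dec False \<open>r \<le> n\<close> by (intro sum_mono mult_right_mono) auto
  moreover have "(\<Sum>i<r. t * (1 - c i)) = t * (real r - (\<Sum>i<r. c i))"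
    by (simp add: sum_distrib_left[symmetric] sum_subtractf)
  moreover have "(\<Sum>i=r..<n. t * c i) = t * (\<Sum>i=r..<n. c i)" by (simp add: sum_distrib_left)
  moreover have "(\<Sum>i<r. l i * (1 - c i)) = (\<Sum>i<r. l i) - (\<Sum>i<r. l i * c i)"
    by (simp add: right_diff_distrib sum_subtractf)
  moreover have "real r - (\<Sum>i<r. c i) = (\<Sum>i=r..<n. c i)" using s S[of c] by simp
  ultimately show ?thesis using S[of "\<lambda>i. l i * c i"] by simp
qed

text \<open>Ky Fan's maximum principle. In a singular basis the squared length of column
  \<open>j\<close> is the mean of the squared singular values with weights
  \<open>(P $$ (i, j))^2\<close>. Over \<open>r\<close> columns of the orthogonal matrix
  \<open>P\<close> these weights add up to at most 1 for each \<open>i\<close>, and to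
  \<open>r\<close> in total.\<close>

lemma sum_col_sq_le_ky_fan2:
  assumes G: "G \<in> carrier_mat q n" and U: "orth_mat n U" and r: "r \<le> n"
  shows "(\<Sum>j<r. col_sq (G * U) j) \<le> (ky_fan2 r G)\<^sup>2"
proof -
  obtain V where V: "orth_mat n V"
    and VG: "\<forall>i<n. \<forall>j<n. (\<Sum>a<q. (G * V) $$ (a, i) * (G * V) $$ (a, j)) =
        (if i = j then (singular_value (Suc i) G)\<^sup>2 else 0)"
    and dec: "\<forall>j<n. \<forall>i\<le>j. (singular_value (Suc j) G)\<^sup>2 \<le> (singular_value (Suc i) G)\<^sup>2"
    by (rule singular_basis[OF G])
  note Vc = orth_matD(1)[OF V] and Uc = orth_matD(1)[OF U]
  define P where "P = transpose_mat V * U"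
  have P: "orth_mat n P"
    unfolding P_def by (intro orth_mat_mult orth_mat_transpose V U)
  note Pc = orth_matD(1)[OF P]
  have GV: "G * V \<in> carrier_mat q n" using G Vc by simp
  have "V * P = V * transpose_mat V * U"
    unfolding P_def using Vc Uc by (simp add: assoc_mult_mat[of _ n n _ n _ n])
  then have "V * P = U" using Uc orth_matD(2)[OF V] by simp
  then have GU: "G * U = (G * V) * P"
    using G Vc Pc by (simp add: assoc_mult_mat[of _ q n _ n _ n])
  define l where "l i = (singular_value (Suc i) G)\<^sup>2" for i
  have col: "col_sq (G * U) j = (\<Sum>i<n. l i * (P $$ (i, j))\<^sup>2)" if j: "j < n" for j
  proof -
    have "col_sq (G * U) j = (\<Sum>a<q. (\<Sum>i<n. (G * V) $$ (a, i) * P $$ (i, j))\<^sup>2)"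
      unfolding GU col_sq_def using G j by (intro sum.cong) (auto simp: mat_mult_index_sum[OF GV Pc] simp del: index_mult_mat(1))
    also have "\<dots> = (\<Sum>a<q. \<Sum>i<n. \<Sum>k<n. ((G * V) $$ (a, i) * (G * V) $$ (a, k)) * (P $$ (i, j) * P $$ (k, j)))"
      unfolding power2_eq_square sum_product by (intro sum.cong refl) (simp add: mult_ac)
    also have "\<dots> = (\<Sum>i<n. \<Sum>k<n. (\<Sum>a<q. (G * V) $$ (a, i) * (G * V) $$ (a, k)) * (P $$ (i, j) * P $$ (k, j)))"
    proof -
      define F where "F a i k = ((G * V) $$ (a, i) * (G * V) $$ (a, k)) * (P $$ (i, j) * P $$ (k, j))" for a i k
      have "(\<Sum>a<q. \<Sum>i<n. \<Sum>k<n. F a i k) = (\<Sum>i<n. \<Sum>a<q. \<Sum>k<n. F a i k)" by (rule sum.swap)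
      also have "\<dots> = (\<Sum>i<n. \<Sum>k<n. \<Sum>a<q. F a i k)" by (rule sum.cong[OF refl], rule sum.swap)
      finally show ?thesis unfolding F_def sum_distrib_right .
    qed
    also have "\<dots> = (\<Sum>i<n. \<Sum>k<n. if k = i then l i * (P $$ (i, j))\<^sup>2 else 0)"
      using VG by (intro sum.cong refl) (auto simp: l_def power2_eq_square)
    also have "\<dots> = (\<Sum>i<n. l i * (P $$ (i, j))\<^sup>2)" by simp
    finally show ?thesis .
  qed
  have "(\<Sum>j<r. col_sq (G * U) j) = (\<Sum>j<r. \<Sum>i<n. l i * (P $$ (i, j))\<^sup>2)"
    using r by (intro sum.cong) (auto simp: col)
  also have "\<dots> = (\<Sum>i<n. l i * (\<Sum>j<r. (P $$ (i, j))\<^sup>2))"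
    unfolding sum_distrib_left by (rule sum.swap)
  also have "\<dots> \<le> (\<Sum>i<r. l i)"
  proof (rule weighted_sum_le_partial_sum[OF r])
    fix i assume i: "i < n"
    show "0 \<le> (\<Sum>j<r. (P $$ (i, j))\<^sup>2)" by (simp add: sum_nonneg)
    have "(\<Sum>j<r. (P $$ (i, j))\<^sup>2) \<le> (\<Sum>j<n. (P $$ (i, j))\<^sup>2)"
      using r by (intro sum_mono2) auto
    also have "\<dots> = 1" using orth_mat_rows[OF P i i] by (simp add: power2_eq_square)
    finally show "(\<Sum>j<r. (P $$ (i, j))\<^sup>2) \<le> 1" .
  next
    show "l j \<le> l i" if "i \<le> j" "j < n" for i j using dec that by (simp add: l_def)
    have "(\<Sum>i<n. \<Sum>j<r. (P $$ (i, j))\<^sup>2) = (\<Sum>j<r. \<Sum>i<n. (P $$ (i, j))\<^sup>2)" by (rule sum.swap)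
    also have "\<dots> = (\<Sum>j<r. 1)"
      using r orth_mat_cols[OF P] by (intro sum.cong refl) (simp add: power2_eq_square)
    finally show "(\<Sum>i<n. \<Sum>j<r. (P $$ (i, j))\<^sup>2) = real r" by simp
  qed
  finally show ?thesis by (simp add: ky_fan2_sq l_def)
qed

lemma ky_fan2_mono: "r \<le> s \<Longrightarrow> ky_fan2 r G \<le> ky_fan2 s G"
  unfolding ky_fan2_def by (intro real_sqrt_le_mono sum_mono2) auto

lemma ky_fan2_sq_le_hs_norm:
  assumes G: "G \<in> carrier_mat q n" and r: "r \<le> n"
  shows "(ky_fan2 r G)\<^sup>2 \<le> (hs_norm G)\<^sup>2"
proof -
  obtain V where V: "orth_mat n V" "\<forall>r\<le>n. (\<Sum>j<r. col_sq (G * V) j) = (ky_fan2 r G)\<^sup>2"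
    by (rule ky_fan2_attained[OF G])
  have "(\<Sum>j<r. col_sq (G * V) j) \<le> (\<Sum>j<n. col_sq (G * V) j)"
    using r by (intro sum_mono2) (auto simp: col_sq_nonneg)
  also have "\<dots> = (hs_norm (G * V))\<^sup>2"
    using orth_matD(5)[OF V(1)] by (simp add: hs_norm_sq_cols)
  finally show ?thesis using V(2) r hs_norm_mult_orthogonal[OF V(1) G] by simp
qed

lemma ky_fan2_sq_le_mult:
  assumes G: "G \<in> carrier_mat q n" and r: "r \<le> n"
  shows "(ky_fan2 r G)\<^sup>2 \<le> real r * (ky_fan2 1 G)\<^sup>2"
proof -
  have dec: "(singular_value (Suc j) G)\<^sup>2 \<le> (singular_value (Suc i) G)\<^sup>2" if "i \<le> j" "j < n" for i j
  proof -
    obtain V where "orth_mat n V" "\<forall>i<n. \<forall>j<n. (\<Sum>a<q. (G * V) $$ (a, i) * (G * V) $$ (a, j)) =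
        (if i = j then (singular_value (Suc i) G)\<^sup>2 else 0)"
      "\<forall>j<n. \<forall>i\<le>j. (singular_value (Suc j) G)\<^sup>2 \<le> (singular_value (Suc i) G)\<^sup>2"
      by (rule singular_basis[OF G])
    then show ?thesis using that by simp
  qed
  have "(ky_fan2 r G)\<^sup>2 \<le> (\<Sum>j<r. (ky_fan2 1 G)\<^sup>2)"
    unfolding ky_fan2_sq using dec[of 0] r by (intro sum_mono) auto
  then show ?thesis by simp
qed

text \<open>Supplies the vector that \<open>integral_operator_norm_le_dims\<close> asks for.\<close>

lemma ky_fan2_1_attained:
  assumes G: "G \<in> carrier_mat q n" and n: "0 < n"
  obtains v where "(\<Sum>j<n. (v j)\<^sup>2) = 1" "(ky_fan2 1 G)\<^sup>2 = (\<Sum>i<q. (\<Sum>j<n. G $$ (i, j) * v j)\<^sup>2)"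
proof -
  obtain V where V: "orth_mat n V" "\<forall>r\<le>n. (\<Sum>j<r. col_sq (G * V) j) = (ky_fan2 r G)\<^sup>2"
    by (rule ky_fan2_attained[OF G])
  show ?thesis
  proof (rule that[of "\<lambda>j. V $$ (j, 0)"])
    show "(\<Sum>j<n. (V $$ (j, 0))\<^sup>2) = 1"
      using orth_mat_cols[OF V(1) n n] by (simp add: power2_eq_square)
    have "(G * V) $$ (i, 0) = (\<Sum>j<n. G $$ (i, j) * V $$ (j, 0))" if "i < q" for i
      by (rule mat_mult_index_sum[OF G orth_matD(1)[OF V(1)] that n])
    then show "(ky_fan2 1 G)\<^sup>2 = (\<Sum>i<q. (\<Sum>j<n. G $$ (i, j) * V $$ (j, 0))\<^sup>2)"
      using V(2)[rule_format, of 1] n G by (simp add: col_sq_def del: index_mult_mat(1))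
  qed
qed

lemma sum_cols_le_ky_fan2:
  assumes G: "G \<in> carrier_mat q n" and r: "r \<le> n"
  shows "(\<Sum>j<r. \<Sum>i<q. (G $$ (i, j))\<^sup>2) \<le> (ky_fan2 r G)\<^sup>2"
  using sum_col_sq_le_ky_fan2[OF G orth_mat_one r] G by (simp add: col_sq_def)

text \<open>The rows of \<open>Z\<close> are rotated into the first \<open>r\<close> coordinates, so that \<open>W * Z\<close> does not affect the
  remaining columns.\<close>

lemma eckart_young_le:
  assumes G: "G \<in> carrier_mat q n" and W: "W \<in> carrier_mat q r" and Z: "Z \<in> carrier_mat r n" and r: "r \<le> n"
  shows "(hs_norm G)\<^sup>2 - (ky_fan2 r G)\<^sup>2 \<le> (hs_norm (G - W * Z))\<^sup>2"
proof -
  have Zt: "transpose_mat Z \<in> carrier_mat n r" using Z by simp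
  obtain R where R: "R \<in> rotations n 0"
    and Rz: "\<And>i j. j < r \<Longrightarrow> i < n \<Longrightarrow> j < i \<Longrightarrow> (R * transpose_mat Z) $$ (i, j) = 0"
    using rotations_upper_triangular[OF Zt] by blast
  have Ro: "orth_mat n R" by (rule rotations_orthogonal[OF R])
  define U where "U = transpose_mat R"
  have U: "orth_mat n U" unfolding U_def by (rule orth_mat_transpose[OF Ro])
  note Uc = orth_matD(1)[OF U]
  have ZU: "(Z * U) $$ (i, j) = 0" if "i < r" "r \<le> j" "j < n" for i j
  proof -
    have "Z * U = transpose_mat (R * transpose_mat Z)"
      using transpose_mult[OF orth_matD(1)[OF Ro] Zt] by (simp add: U_def)
    then have "(Z * U) $$ (i, j) = (R * transpose_mat Z) $$ (j, i)"
      using that Zt orth_matD(1)[OF Ro] by simp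
    then show ?thesis using Rz[of i j] that by simp
  qed
  have GU: "G * U \<in> carrier_mat q n" and WZ: "W * Z \<in> carrier_mat q n" and ZUc: "Z * U \<in> carrier_mat r n"
    using G W Z Uc by auto
  have "(G - W * Z) * U = G * U - W * (Z * U)"
    using G W Z Uc WZ by (simp add: minus_mult_distrib_mat[of _ q n _ _ n] assoc_mult_mat[of _ q r _ n _ n])
  moreover have "(W * (Z * U)) $$ (a, j) = 0" if "a < q" "r \<le> j" "j < n" for a j
    using mat_mult_index_sum[OF W ZUc that(1,3)] ZU that by simp
  ultimately have ent: "((G - W * Z) * U) $$ (a, j) = (G * U) $$ (a, j)" if "a < q" "r \<le> j" "j < n" for a j
    using that G Uc W Z by (simp del: index_mult_mat(1))
  have "(hs_norm G)\<^sup>2 = (hs_norm (G * U))\<^sup>2" using hs_norm_mult_orthogonal[OF U G] by simp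
  also have "\<dots> = (\<Sum>j<n. col_sq (G * U) j)" using Uc by (simp add: hs_norm_sq_cols)
  also have "\<dots> = (\<Sum>j<r. col_sq (G * U) j) + (\<Sum>j=r..<n. col_sq (G * U) j)"
  proof -
    have "{..<n} = {..<r} \<union> {r..<n}" using r by auto
    then show ?thesis by (simp add: sum.union_disjoint ivl_disj_int)
  qed
  also have "\<dots> \<le> (ky_fan2 r G)\<^sup>2 + (\<Sum>j=r..<n. col_sq ((G - W * Z) * U) j)"
  proof (rule add_mono[OF sum_col_sq_le_ky_fan2[OF G U r]])
    show "(\<Sum>j=r..<n. col_sq (G * U) j) \<le> (\<Sum>j=r..<n. col_sq ((G - W * Z) * U) j)"
      using G W by (intro sum_mono) (auto simp: col_sq_def ent simp del: index_mult_mat(1))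
  qed
  also have "(\<Sum>j=r..<n. col_sq ((G - W * Z) * U) j) \<le> (\<Sum>j<n. col_sq ((G - W * Z) * U) j)"
    by (intro sum_mono2) (auto simp: col_sq_nonneg)
  also have "(\<Sum>j<n. col_sq ((G - W * Z) * U) j) = (hs_norm ((G - W * Z) * U))\<^sup>2"
    using Uc by (simp add: hs_norm_sq_cols)
  also have "\<dots> = (hs_norm (G - W * Z))\<^sup>2"
    using hs_norm_mult_orthogonal[OF U minus_carrier_mat[OF WZ]] by simp
  finally show ?thesis by simp
qed

text \<open>The projection to the first \<open>r\<close> right singular vectors is optimal. The
  factored form is kept because both the rank bound and a preimage under the design matrix are read
  off from it.\<close>

lemma eckart_young_attained:
  assumes G: "G \<in> carrier_mat q n" and r: "r \<le> n"
  obtains V where "V \<in> carrier_mat n r"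
    "(hs_norm (G - G * V * transpose_mat V))\<^sup>2 = (hs_norm G)\<^sup>2 - (ky_fan2 r G)\<^sup>2"
proof -
  obtain U where U: "orth_mat n U" "\<forall>r\<le>n. (\<Sum>j<r. col_sq (G * U) j) = (ky_fan2 r G)\<^sup>2"
    by (rule ky_fan2_attained[OF G])
  note Uc = orth_matD(1)[OF U(1)]
  define V where "V = mat n r (\<lambda>(i, j). U $$ (i, j))"
  have V: "V \<in> carrier_mat n r" by (simp add: V_def)
  define C where "C = G * V * transpose_mat V"
  have C: "C \<in> carrier_mat q n" using G V by (simp add: C_def)
  have GU: "G * U \<in> carrier_mat q n" and GV: "G * V \<in> carrier_mat q r" using G Uc V by auto
  have CU: "(C * U) $$ (a, j) = (if j < r then (G * U) $$ (a, j) else 0)" if a: "a < q" and j: "j < n" for a j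
  proof -
    have "C * U = (G * V) * (transpose_mat V * U)"
      unfolding C_def by (rule assoc_mult_mat[of _ q r _ n _ n]) (use GV V Uc in auto)
    then have "(C * U) $$ (a, j) = (\<Sum>k<r. (G * V) $$ (a, k) * (transpose_mat V * U) $$ (k, j))"
      using mat_mult_index_sum[OF GV _ a j, of "transpose_mat V * U"] V Uc by (simp del: index_mult_mat(1))
    also have "\<dots> = (\<Sum>k<r. if k = j then (G * U) $$ (a, k) else 0)"
    proof (rule sum.cong[OF refl])
      fix k assume "k \<in> {..<r}"
      then have k: "k < r" "k < n" using r by auto
      have "(transpose_mat V * U) $$ (k, j) = (\<Sum>i<n. U $$ (i, k) * U $$ (i, j))"
        using gram_index[OF V Uc k(1) j] k by (simp add: V_def del: index_mult_mat(1))
      moreover have "(G * V) $$ (a, k) = (G * U) $$ (a, k)"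
        unfolding mat_mult_index_sum[OF G V a k(1)] mat_mult_index_sum[OF G Uc a k(2)]
        using k by (simp add: V_def)
      ultimately show "(G * V) $$ (a, k) * (transpose_mat V * U) $$ (k, j) = (if k = j then (G * U) $$ (a, k) else 0)"
        using orth_mat_cols[OF U(1) k(2) j] by (simp del: index_mult_mat(1))
    qed
    finally show ?thesis by (simp del: index_mult_mat(1))
  qed
  have "(hs_norm (G - C))\<^sup>2 = (hs_norm ((G - C) * U))\<^sup>2"
    using hs_norm_mult_orthogonal[OF U(1) minus_carrier_mat[OF C]] by simp
  also have "\<dots> = (\<Sum>j<n. col_sq ((G - C) * U) j)"
    using Uc by (simp add: hs_norm_sq_cols)
  also have "(G - C) * U = G * U - C * U"
    using G C Uc by (simp add: minus_mult_distrib_mat[of _ q n _ _ n])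
  also have "(\<Sum>j<n. col_sq (G * U - C * U) j) = (\<Sum>j<n. if j < r then 0 else col_sq (G * U) j)"
  proof (rule sum.cong[OF refl])
    fix j assume "j \<in> {..<n}"
    then have j: "j < n" by simp
    have ent: "(G * U - C * U) $$ (a, j) = (if j < r then 0 else (G * U) $$ (a, j))" if a: "a < q" for a
    proof -
      have "(G * U - C * U) $$ (a, j) = (G * U) $$ (a, j) - (C * U) $$ (a, j)"
        by (rule index_minus_mat(1)) (use C Uc a j in auto)
      then show ?thesis unfolding CU[OF a j] by (cases "j < r") (simp_all del: index_mult_mat(1) index_minus_mat(1))
    qed
    have dims: "dim_row (G * U - C * U) = q" "dim_row (G * U) = q"
      using G C by auto
    show "col_sq (G * U - C * U) j = (if j < r then 0 else col_sq (G * U) j)"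
      unfolding col_sq_def dims using ent by (cases "j < r") (simp_all del: index_mult_mat(1) index_minus_mat(1))
  qed
  also have "\<dots> = (\<Sum>j<n. col_sq (G * U) j) - (\<Sum>j<r. col_sq (G * U) j)"
  proof -
    have s: "{..<n} = {..<r} \<union> {r..<n}" using r by auto
    show ?thesis unfolding s by (simp add: sum.union_disjoint ivl_disj_int)
  qed
  also have "(\<Sum>j<n. col_sq (G * U) j) = (hs_norm G)\<^sup>2"
    using hs_norm_mult_orthogonal[OF U(1) G] hs_norm_sq_cols[of "G * U"] Uc by simp
  finally show ?thesis using that[OF V] U(2) r by (simp add: C_def)
qed

text \<open>The truncation of \<open>G\<close> to its first \<open>r\<close> rows is a competitor in
  \<open>eckart_young_le\<close>. Singular values are defined by the Gram matrix of the columns, and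
  this argument avoids a comparison with those of the transpose.\<close>

lemma sum_rows_le_ky_fan2:
  assumes G: "G \<in> carrier_mat q n" and r: "r \<le> n" "r \<le> q"
  shows "(\<Sum>i<r. \<Sum>j<n. (G $$ (i, j))\<^sup>2) \<le> (ky_fan2 r G)\<^sup>2"
proof -
  define W where "W = mat q r (\<lambda>(i, j). if i = j then 1 else 0 :: real)"
  define Z where "Z = mat r n (\<lambda>(i, j). G $$ (i, j))"
  have W: "W \<in> carrier_mat q r" and Z: "Z \<in> carrier_mat r n" by (auto simp: W_def Z_def)
  have WZ: "(W * Z) $$ (i, j) = (if i < r then G $$ (i, j) else 0)" if "i < q" "j < n" for i j
  proof -
    have "(W * Z) $$ (i, j) = (\<Sum>k<r. if k = i then G $$ (i, j) else 0)"
      unfolding mat_mult_index_sum[OF W Z that] using that by (intro sum.cong) (auto simp: W_def Z_def)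
    then show ?thesis using that r by (simp del: index_mult_mat(1))
  qed
  define f where "f i = (\<Sum>j<n. (G $$ (i, j))\<^sup>2)" for i
  have h: "(hs_norm G)\<^sup>2 = (\<Sum>i<q. f i)"
    using G by (simp add: hs_norm_def sum_nonneg f_def)
  have "(hs_norm (G - W * Z))\<^sup>2 = (\<Sum>i<q. \<Sum>j<n. ((G - W * Z) $$ (i, j))\<^sup>2)"
    using W Z by (simp add: hs_norm_def sum_nonneg del: index_minus_mat(1))
  also have "\<dots> = (\<Sum>i<q. if i < r then 0 else f i)"
    using W Z by (intro sum.cong refl) (auto simp: WZ f_def simp del: index_mult_mat(1))
  also have "\<dots> = (\<Sum>i<q. f i) - (\<Sum>i<r. f i)"
  proof -
    have s: "{..<q} = {..<r} \<union> {r..<q}" using r by auto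
    show ?thesis unfolding s by (simp add: sum.union_disjoint ivl_disj_int)
  qed
  finally show ?thesis
    using eckart_young_le[OF G W Z r(1)] h by (simp add: f_def)
qed

text \<open>With \<open>V\<close> optimal for \<open>G\<close>, the norm of \<open>G\<close> is that
  of the first \<open>r\<close> columns of \<open>G * V\<close>. The triangle inequality and the
  maximum principle for \<open>H\<close> in the same basis do the rest.\<close>

lemma ky_fan2_lipschitz_le:
  assumes G: "G \<in> carrier_mat q n" and H: "H \<in> carrier_mat q n" and r: "r \<le> n"
  shows "ky_fan2 r G \<le> ky_fan2 r H + hs_norm (G - H)"
proof -
  obtain V where V: "orth_mat n V" "\<forall>r\<le>n. (\<Sum>j<r. col_sq (G * V) j) = (ky_fan2 r G)\<^sup>2"
    by (rule ky_fan2_attained[OF G])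
  note Vc = orth_matD(1)[OF V(1)]
  define N where "N M = L2_set (\<lambda>(j, a). M $$ (a, j)) ({..<r} \<times> {..<q})" for M :: "real mat"
  have N: "(N M)\<^sup>2 = (\<Sum>j<r. col_sq M j)" if "M \<in> carrier_mat q n" for M
    using that by (simp add: N_def L2_set_def sum_nonneg sum.cartesian_product' col_sq_def)
  have N0: "0 \<le> N M" for M by (simp add: N_def)
  have GV: "G * V \<in> carrier_mat q n" and HV: "H * V \<in> carrier_mat q n" and GHV: "(G - H) * V \<in> carrier_mat q n"
    using G H Vc by auto
  have "ky_fan2 r G = N (G * V)"
    by (rule power2_eq_imp_eq) (use V(2) r N[OF GV] N0 in \<open>auto simp: ky_fan2_nonneg\<close>)
  also have "\<dots> = L2_set (\<lambda>p. (case p of (j, a) \<Rightarrow> (H * V) $$ (a, j)) + (case p of (j, a) \<Rightarrow> ((G - H) * V) $$ (a, j))) ({..<r} \<times> {..<q})"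
    unfolding N_def
  proof (intro L2_set_cong refl)
    fix p assume "p \<in> {..<r} \<times> {..<q}"
    then obtain j a where p: "p = (j, a)" "j < n" "a < q" using r by auto
    have "(G - H) * V = G * V - H * V"
      using G H Vc by (simp add: minus_mult_distrib_mat[of _ q n _ _ n])
    then show "(case p of (j, a) \<Rightarrow> (G * V) $$ (a, j)) = (case p of (j, a) \<Rightarrow> (H * V) $$ (a, j)) + (case p of (j, a) \<Rightarrow> ((G - H) * V) $$ (a, j))"
      using p G H Vc by (simp del: index_mult_mat(1))
  qed
  also have "\<dots> \<le> N (H * V) + N ((G - H) * V)"
    unfolding N_def by (rule L2_set_triangle_ineq)
  also have "N (H * V) \<le> ky_fan2 r H"
    by (rule power2_le_imp_le[OF _ ky_fan2_nonneg]) (simp add: N[OF HV] sum_col_sq_le_ky_fan2[OF H V(1) r])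
  also have "N ((G - H) * V) \<le> hs_norm (G - H)"
  proof (rule power2_le_imp_le[OF _ hs_norm_nonneg])
    have "(N ((G - H) * V))\<^sup>2 \<le> (\<Sum>j<n. col_sq ((G - H) * V) j)"
      unfolding N[OF GHV] using r by (intro sum_mono2) (auto simp: col_sq_nonneg)
    also have "\<dots> = (hs_norm ((G - H) * V))\<^sup>2" using Vc by (simp add: hs_norm_sq_cols)
    also have "\<dots> = (hs_norm (G - H))\<^sup>2"
      using hs_norm_mult_orthogonal[OF V(1) minus_carrier_mat[OF H]] by simp
    finally show "(N ((G - H) * V))\<^sup>2 \<le> (hs_norm (G - H))\<^sup>2" .
  qed
  finally show ?thesis by simp
qed

subsection \<open>Rank-restricted least squares\<close>

text \<open>The columns of \<open>W\<close> are a maximal independent set of columns of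
  \<open>X\<close>. The equations \<open>X = W * Z\<close> and \<open>W = X * B\<close> give both
  matrices the same range, and the injectivity of \<open>W\<close> is the form in which the rank is
  used later.\<close>

lemma (in vec_space) rank_factorization:
  assumes X: "X \<in> carrier_mat n p"
  obtains W B Z where "W \<in> carrier_mat n (rank X)" "B \<in> carrier_mat p (rank X)" "Z \<in> carrier_mat (rank X) p"
    "X = W * Z" "W = X * B" "\<forall>v\<in>carrier_vec (rank X). W *\<^sub>v v = 0\<^sub>v n \<longrightarrow> v = 0\<^sub>v (rank X)"
proof -
  define r where "r = rank X"
  have Xc: "set (cols X) \<subseteq> carrier_vec n" using X cols_dim by blast
  have "\<exists>S. finite S \<and> maximal S (\<lambda>T. T \<subseteq> set (cols X) \<and> lin_indpt T) \<and> {} \<subseteq> S"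
    by (rule maximal_exists_superset[of "set (cols X)"]) (auto simp: lin_dep_def)
  then obtain S where S: "finite S" "maximal S (\<lambda>T. T \<subseteq> set (cols X) \<and> lin_indpt T)" by blast
  then have SX: "S \<subseteq> set (cols X)" and Si: "lin_indpt S" by (auto simp: maximal_def)
  have Sc: "S \<subseteq> carrier_vec n" using SX Xc by blast
  have cS: "card S = r" using rank_card_indpt[OF X S(2)] by (simp add: r_def)
  obtain w where w: "set w = S" "distinct w" using finite_distinct_list[OF S(1)] by blast
  have lw: "length w = r" using w cS distinct_card by fastforce
  define W where "W = mat_of_cols n w"
  have W: "W \<in> carrier_mat n r" unfolding W_def lw[symmetric] by (rule mat_of_cols_carrier)
  have cW: "cols W = w" unfolding W_def using Sc w(1) by (intro cols_mat_of_cols) simp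
  have inj: "v = 0\<^sub>v r" if "v \<in> carrier_vec r" "W *\<^sub>v v = 0\<^sub>v n" for v
    using lin_depI[OF W that(1) _ that(2)] Si w by (auto simp: cW)
  have "\<exists>z\<in>carrier_vec r. W *\<^sub>v z = x" if x: "x \<in> set (cols X)" for x
  proof -
    have "x \<in> span S"
    proof (cases "x \<in> S")
      case True
      then show ?thesis using span_mem Sc by auto
    next
      case False
      have "\<not> (S \<union> {x} \<subseteq> set (cols X) \<and> lin_indpt (S \<union> {x}))"
      proof
        assume *: "S \<union> {x} \<subseteq> set (cols X) \<and> lin_indpt (S \<union> {x})"
        then have "S \<union> {x} = S" using S(2) unfolding maximal_def by (metis Un_upper1)
        then show False using False by blast
      qed
      then have "lin_dep (S \<union> {x})" using SX x by blast
      then show ?thesis using lin_dep_iff_in_span[OF _ Si _ False] Sc Xc x by auto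
    qed
    then obtain a where "x = lincomb a S"
      using finite_span[OF S(1)] Sc by auto
    then have "W *\<^sub>v vec r (\<lambda>i. a (col W i)) = x"
      using mat_mult_eq_lincomb[OF W, of a] w by (simp add: cW)
    then show ?thesis by (intro bexI[of _ "vec r (\<lambda>i. a (col W i))"]) auto
  qed
  then have "\<exists>z\<in>carrier_vec r. W *\<^sub>v z = col X j" if "j < p" for j
    using that X by (metis carrier_matD(2) cols_length cols_nth nth_mem)
  then obtain z where z: "\<And>j. j < p \<Longrightarrow> z j \<in> carrier_vec r \<and> W *\<^sub>v z j = col X j"
    by metis
  define Z where "Z = mat r p (\<lambda>(i, j). z j $ i)"
  have Z: "Z \<in> carrier_mat r p" by (simp add: Z_def)
  have colZ: "col Z j = z j" if "j < p" for j using z[OF that] that by (auto simp: Z_def)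
  have XWZ: "X = W * Z"
  proof (rule eq_matI)
    fix i j assume "i < dim_row (W * Z)" "j < dim_col (W * Z)"
    then have ij: "i < n" "j < p" using W Z by auto
    have "(W * Z) $$ (i, j) = (W *\<^sub>v z j) $ i" using ij W Z colZ by simp
    then show "X $$ (i, j) = (W * Z) $$ (i, j)" using z[OF ij(2)] ij X by simp
  qed (use X W Z in auto)
  have "\<exists>l<p. w ! k = col X l" if "k < r" for k
  proof -
    have "w ! k \<in> set (cols X)" using that lw w SX nth_mem by blast
    then show ?thesis using X by (auto simp: in_set_conv_nth)
  qed
  \<comment> \<open>Every column of \<open>W\<close> is a column of \<open>X\<close>, so
    \<open>B\<close> only selects columns.\<close>
  then obtain f where f: "\<And>k. k < r \<Longrightarrow> f k < p \<and> w ! k = col X (f k)" by metis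
  define B where "B = mat p r (\<lambda>(a, k). if a = f k then 1 else 0 :: 'a)"
  have B: "B \<in> carrier_mat p r" by (simp add: B_def)
  have WXB: "W = X * B"
  proof (rule eq_matI)
    fix i k assume "i < dim_row (X * B)" "k < dim_col (X * B)"
    then have ik: "i < n" "k < r" using X B by auto
    have "(X * B) $$ (i, k) = (\<Sum>a<p. X $$ (i, a) * B $$ (a, k))"
      using ik X B by (auto simp: scalar_prod_def lessThan_atLeast0 intro!: sum.cong)
    also have "\<dots> = (\<Sum>a<p. if a = f k then X $$ (i, f k) else 0)"
      using ik by (intro sum.cong) (auto simp: B_def)
    also have "\<dots> = col X (f k) $ i" using f[OF ik(2)] ik X by simp
    also have "\<dots> = W $$ (i, k)"
      using f[OF ik(2)] ik lw by (simp add: W_def mat_of_cols_index)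
    finally show "W $$ (i, k) = (X * B) $$ (i, k)" by simp
  qed (use X W B in auto)
  show ?thesis
    using that[of W B Z, folded r_def] W B Z XWZ WXB inj by blast
qed

lemma mult_mat_vec_index_sum:
  assumes "A \<in> carrier_mat m q" "v \<in> carrier_vec q" "i < m"
  shows "(A *\<^sub>v v) $ i = (\<Sum>j<q. A $$ (i, j) * v $ j)"
  using assms by (auto simp: scalar_prod_def lessThan_atLeast0 intro!: sum.cong)

text \<open>Once the transpose of \<open>N\<close> is triangular, its last row lies below the
  diagonal in all \<open>r\<close> columns and vanishes. This says that the last row of the
  rotation, a unit vector, is in the kernel of \<open>N\<close>.\<close>

lemma wide_matrix_kernel:
  fixes N :: "real mat"
  assumes N: "N \<in> carrier_mat r s" and rs: "r < s"
  shows "\<exists>v\<in>carrier_vec s. v \<noteq> 0\<^sub>v s \<and> N *\<^sub>v v = 0\<^sub>v r"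
proof -
  have Nt: "transpose_mat N \<in> carrier_mat s r" using N by simp
  obtain R where R: "R \<in> rotations s 0"
    and z: "\<forall>j<r. \<forall>i<s. j < i \<longrightarrow> (R * transpose_mat N) $$ (i, j) = 0"
    using rotations_upper_triangular[OF Nt] by blast
  note Rc = rotations_carrier[OF R]
  define l where "l = s - 1"
  have l: "l < s" using rs by (simp add: l_def)
  have "N *\<^sub>v row R l = 0\<^sub>v r"
  proof (rule eq_vecI)
    fix k assume "k < dim_vec (0\<^sub>v r)"
    then have k: "k < r" by simp
    have "(N *\<^sub>v row R l) $ k = (R * transpose_mat N) $$ (l, k)"
      using k l N Rc by (simp add: scalar_prod_def mult.commute)
    then show "(N *\<^sub>v row R l) $ k = 0\<^sub>v r $ k" using z k l rs by (simp add: l_def)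
  qed (use N in auto)
  moreover have "row R l \<noteq> 0\<^sub>v s"
  proof
    assume 0: "row R l = 0\<^sub>v s"
    have "R $$ (l, a) = 0" if "a < s" for a
      using arg_cong[OF 0, of "\<lambda>v. v $ a"] that l Rc by simp
    then show False using orth_mat_rows[OF rotations_orthogonal[OF R] l l] by simp
  qed
  moreover have "row R l \<in> carrier_vec s" using Rc l by auto
  ultimately show ?thesis by blast
qed

text \<open>If the rank \<open>s\<close> exceeded \<open>r\<close>, then
  \<open>W = L * (M * B)\<close> would annihilate a kernel vector of the wide matrix
  \<open>M * B\<close>, against the injectivity of \<open>W\<close>.\<close>

lemma rank_mult_le:
  fixes L M :: "real mat"
  assumes L: "L \<in> carrier_mat p r" and M: "M \<in> carrier_mat r n"
  shows "vec_space.rank p (L * M) \<le> r"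
proof (rule ccontr)
  interpret vec_space "TYPE(real)" p .
  assume "\<not> ?thesis"
  then have rs: "r < rank (L * M)" by simp
  have LM: "L * M \<in> carrier_mat p n" using L M by simp
  define s where "s = rank (L * M)"
  obtain W B Z where W: "W \<in> carrier_mat p s" and B: "B \<in> carrier_mat n s" and "Z \<in> carrier_mat s n"
    "L * M = W * Z" "W = (L * M) * B" and inj: "\<forall>v\<in>carrier_vec s. W *\<^sub>v v = 0\<^sub>v p \<longrightarrow> v = 0\<^sub>v s"
    unfolding s_def by (rule rank_factorization[OF LM])
  have MB: "M * B \<in> carrier_mat r s" using M B by simp
  have "W = L * (M * B)" using \<open>W = (L * M) * B\<close> L M B by (simp add: assoc_mult_mat[of _ p r _ n _ s])
  moreover obtain v where v: "v \<in> carrier_vec s" "v \<noteq> 0\<^sub>v s" "(M * B) *\<^sub>v v = 0\<^sub>v r"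
    using wide_matrix_kernel[OF MB] rs s_def by auto
  ultimately have "W *\<^sub>v v = L *\<^sub>v 0\<^sub>v r"
    using assoc_mult_mat_vec[OF L MB v(1)] by simp
  also have "\<dots> = 0\<^sub>v p" using L by auto
  finally show False using inj v by blast
qed

section \<open>Reduction of the design matrix to its range\<close>

definition top_rows :: "nat \<Rightarrow> real mat \<Rightarrow> real mat" where
  "top_rows q A = mat q (dim_col A) (\<lambda>(i, j). A $$ (i, j))"

lemma top_rows_carrier [simp]: "A \<in> carrier_mat m n \<Longrightarrow> top_rows q A \<in> carrier_mat q n"
  by (simp add: top_rows_def)

lemma top_rows_index: "i < q \<Longrightarrow> j < dim_col A \<Longrightarrow> top_rows q A $$ (i, j) = A $$ (i, j)"
  by (simp add: top_rows_def)

lemma top_rows_mult: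
  assumes A: "A \<in> carrier_mat m k" and B: "B \<in> carrier_mat k n" and q: "q \<le> m"
  shows "top_rows q (A * B) = top_rows q A * B"
proof (rule eq_matI)
  fix i j assume "i < dim_row (top_rows q A * B)" "j < dim_col (top_rows q A * B)"
  then have ij: "i < q" "j < n" "i < m" using q B by (auto simp: top_rows_def)
  show "top_rows q (A * B) $$ (i, j) = (top_rows q A * B) $$ (i, j)"
    using ij A B mat_mult_index_sum[OF A B ij(3,2)] mat_mult_index_sum[OF top_rows_carrier[OF A] B ij(1,2)]
    by (simp add: top_rows_index del: index_mult_mat(1))
qed (use A B in \<open>auto simp: top_rows_def\<close>)

lemma hs_norm_sq_rows: "(hs_norm M)\<^sup>2 = (\<Sum>i<dim_row M. \<Sum>j<dim_col M. (M $$ (i, j))\<^sup>2)"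
  by (simp add: hs_norm_def sum_nonneg)

lemma hs_norm_top_rows:
  assumes A: "A \<in> carrier_mat m n" and q: "q \<le> m"
  shows "(hs_norm A)\<^sup>2 = (hs_norm (top_rows q A))\<^sup>2 + (\<Sum>i=q..<m. \<Sum>j<n. (A $$ (i, j))\<^sup>2)"
proof -
  have s: "{..<m} = {..<q} \<union> {q..<m}" using q by auto
  have "(hs_norm A)\<^sup>2 = (\<Sum>i<q. \<Sum>j<n. (A $$ (i, j))\<^sup>2) + (\<Sum>i=q..<m. \<Sum>j<n. (A $$ (i, j))\<^sup>2)"
    using A by (simp add: hs_norm_sq_rows s sum.union_disjoint ivl_disj_int)
  moreover have "(hs_norm (top_rows q A))\<^sup>2 = (\<Sum>i<q. \<Sum>j<n. (A $$ (i, j))\<^sup>2)"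
    using A by (simp add: hs_norm_sq_rows top_rows_def)
  ultimately show ?thesis by simp
qed

text \<open>After an orthogonal change of the rows, the range of \<open>X\<close> is spanned by the first \<open>rank X\<close>
  coordinates, so the design matrix may be replaced by a matrix with a right inverse.\<close>

lemma design_reduction:
  fixes X :: "real mat"
  assumes X: "X \<in> carrier_mat m p" and rk: "vec_space.rank m X = q"
  obtains R T T' where "R \<in> rotations m 0" "q \<le> m" "T \<in> carrier_mat q p" "T' \<in> carrier_mat p q" "T * T' = 1\<^sub>m q"
    "\<forall>n. \<forall>E\<in>carrier_mat m n. \<forall>B\<in>carrier_mat p n. (hs_norm (E - X * B))\<^sup>2 =
        (hs_norm E)\<^sup>2 - (hs_norm (top_rows q (R * E)))\<^sup>2 + (hs_norm (top_rows q (R * E) - T * B))\<^sup>2"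
proof -
  interpret vec_space "TYPE(real)" m .
  obtain W B Z where W: "W \<in> carrier_mat m q" and B: "B \<in> carrier_mat p q" and Z: "Z \<in> carrier_mat q p"
    and XWZ: "X = W * Z" and WXB: "W = X * B" and inj: "\<forall>v\<in>carrier_vec q. W *\<^sub>v v = 0\<^sub>v m \<longrightarrow> v = 0\<^sub>v q"
    by (rule rank_factorization[OF X, unfolded rk])
  have qm: "q \<le> m"
  proof (rule ccontr)
    assume "\<not> q \<le> m"
    then show False using wide_matrix_kernel[OF W] inj by auto
  qed
  obtain R where R: "R \<in> rotations m 0" and Rz: "\<forall>j<q. \<forall>i<m. j < i \<longrightarrow> (R * W) $$ (i, j) = 0"
    using rotations_upper_triangular[OF W] by blast
  note Ro = rotations_orthogonal[OF R] and Rc = rotations_carrier[OF R]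
  have RW: "R * W \<in> carrier_mat m q" and RX: "R * X \<in> carrier_mat m p" using Rc W X by auto
  have RWz: "(R * W) $$ (i, j) = 0" if "q \<le> i" "i < m" "j < q" for i j
    using Rz that by auto
  have RXe: "R * X = (R * W) * Z" using XWZ Rc W Z by (simp add: assoc_mult_mat[of _ m m _ q _ p])
  have RXz: "(R * X) $$ (i, j) = 0" if "q \<le> i" "i < m" "j < p" for i j
    unfolding RXe mat_mult_index_sum[OF RW Z that(2,3)] using RWz that by (simp del: index_mult_mat(1))
  define T where "T = top_rows q (R * X)"
  have T: "T \<in> carrier_mat q p" using RX by (simp add: T_def)
  define D where "D = top_rows q (R * W)"
  have D: "D \<in> carrier_mat q q" using RW by (simp add: D_def)
  \<comment> \<open>The rows of \<open>R * W\<close> from \<open>q\<close> on vanish, so a kernel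
    vector of \<open>D\<close> would be one of \<open>R * W\<close> and thus of the injective
    \<open>W\<close>.\<close>
  have "det D \<noteq> 0"
  proof
    assume "det D = 0"
    then obtain v where v: "v \<in> carrier_vec q" "v \<noteq> 0\<^sub>v q" "D *\<^sub>v v = 0\<^sub>v q"
      using det_0_iff_vec_prod_zero_field[OF D] by auto
    have "(R * W) *\<^sub>v v = 0\<^sub>v m"
    proof (rule eq_vecI)
      fix i assume "i < dim_vec (0\<^sub>v m)"
      then have i: "i < m" by simp
      have s: "((R * W) *\<^sub>v v) $ i = (\<Sum>j<q. (R * W) $$ (i, j) * v $ j)"
        by (rule mult_mat_vec_index_sum[OF RW v(1) i])
      show "((R * W) *\<^sub>v v) $ i = 0\<^sub>v m $ i"
      proof (cases "i < q")
        case True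
        have "(D *\<^sub>v v) $ i = (\<Sum>j<q. D $$ (i, j) * v $ j)"
          by (rule mult_mat_vec_index_sum[OF D v(1) True])
        also have "\<dots> = (\<Sum>j<q. (R * W) $$ (i, j) * v $ j)"
          unfolding D_def using True W by (intro sum.cong refl) (simp add: top_rows_index del: index_mult_mat(1))
        finally show ?thesis using s v(3) True i by (simp del: index_mult_mat(1))
      next
        case False
        then show ?thesis using s RWz i by (simp del: index_mult_mat(1))
      qed
    qed (use RW in auto)
    then have "transpose_mat R *\<^sub>v ((R * W) *\<^sub>v v) = 0\<^sub>v m" using Rc by auto
    also have "transpose_mat R *\<^sub>v ((R * W) *\<^sub>v v) = (transpose_mat R * (R * W)) *\<^sub>v v"
      by (rule assoc_mult_mat_vec[symmetric]) (use Rc RW v in auto)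
    also have "transpose_mat R * (R * W) = W"
      using Rc W orth_matD(3)[OF Ro] by (simp add: assoc_mult_mat[of _ m m _ m _ q, symmetric])
    finally show False using inj v by blast
  qed
  then have "D \<in> Units (ring_mat TYPE(real) q ())" by (rule det_non_zero_imp_unit[OF D])
  then obtain J where J: "J \<in> carrier_mat q q" "D * J = 1\<^sub>m q"
    unfolding Units_def ring_mat_def by auto
  \<comment> \<open>The invertible \<open>D\<close> factors through \<open>T\<close>, which yields
    the right inverse \<open>B * J\<close>.\<close>
  have "T * B = D"
    unfolding T_def D_def top_rows_mult[OF RX B qm, symmetric]
    using WXB Rc X B by (simp add: assoc_mult_mat[of _ m m _ p _ q])
  then have TT: "T * (B * J) = 1\<^sub>m q"
    using T B J by (simp add: assoc_mult_mat[of _ q p _ q _ q, symmetric])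
  have key: "(hs_norm (E - X * C))\<^sup>2 =
        (hs_norm E)\<^sup>2 - (hs_norm (top_rows q (R * E)))\<^sup>2 + (hs_norm (top_rows q (R * E) - T * C))\<^sup>2"
    if E: "E \<in> carrier_mat m n" and C: "C \<in> carrier_mat p n" for n E C
  proof -
    have XC: "X * C \<in> carrier_mat m n" and RE: "R * E \<in> carrier_mat m n" and RXC: "(R * X) * C \<in> carrier_mat m n"
      using X C Rc E RX by auto
    define F where "F = R * (E - X * C)"
    have F: "F \<in> carrier_mat m n" using Rc XC by (simp add: F_def minus_carrier_mat)
    have Fe: "F = R * E - (R * X) * C"
      unfolding F_def using Rc E XC X C
      by (simp add: mult_minus_distrib_mat[of _ m m _ n] assoc_mult_mat[of _ m m _ p _ n])
    have Fi: "F $$ (i, j) = (R * E) $$ (i, j) - ((R * X) * C) $$ (i, j)" if "i < m" "j < n" for i j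
      unfolding Fe by (rule index_minus_mat(1)) (use RXC that in auto)
    \<comment> \<open>The fit does not reach the rows from \<open>q\<close> on; their contribution
      is independent of \<open>C\<close>.\<close>
    have low: "F $$ (i, j) = (R * E) $$ (i, j)" if "q \<le> i" "i < m" "j < n" for i j
      unfolding Fi[OF that(2,3)] mat_mult_index_sum[OF RX C that(2,3)]
      using RXz that by (simp del: index_mult_mat(1))
    have top: "top_rows q F = top_rows q (R * E) - T * C"
    proof (rule eq_matI)
      fix i j assume "i < dim_row (top_rows q (R * E) - T * C)" "j < dim_col (top_rows q (R * E) - T * C)"
      then have ij: "i < q" "j < n" "i < m" using T C qm by auto
      have "(T * C) $$ (i, j) = ((R * X) * C) $$ (i, j)"
        unfolding T_def top_rows_mult[OF RX C qm, symmetric]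
        by (rule top_rows_index) (use ij RXC in auto)
      moreover have "(top_rows q (R * E) - T * C) $$ (i, j) = top_rows q (R * E) $$ (i, j) - (T * C) $$ (i, j)"
        by (rule index_minus_mat(1)) (use T C ij in auto)
      moreover have "top_rows q (R * E) $$ (i, j) = (R * E) $$ (i, j)"
        by (rule top_rows_index) (use ij RE in auto)
      moreover have "top_rows q F $$ (i, j) = F $$ (i, j)"
        by (rule top_rows_index) (use ij F in auto)
      ultimately show "top_rows q F $$ (i, j) = (top_rows q (R * E) - T * C) $$ (i, j)"
        using Fi[OF ij(3,2)] by (simp only:)
    qed (use F T C in \<open>auto simp: top_rows_def\<close>)
    have "(hs_norm (E - X * C))\<^sup>2 = (hs_norm F)\<^sup>2"
      unfolding F_def using hs_norm_orthogonal_mult[OF Ro minus_carrier_mat[OF XC]] by simp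
    also have "\<dots> = (hs_norm (top_rows q (R * E) - T * C))\<^sup>2 + (\<Sum>i=q..<m. \<Sum>j<n. (F $$ (i, j))\<^sup>2)"
      unfolding top[symmetric] by (rule hs_norm_top_rows[OF F qm])
    also have "(\<Sum>i=q..<m. \<Sum>j<n. (F $$ (i, j))\<^sup>2) = (\<Sum>i=q..<m. \<Sum>j<n. ((R * E) $$ (i, j))\<^sup>2)"
      by (intro sum.cong refl) (simp add: low del: index_mult_mat(1))
    also have "\<dots> = (hs_norm (R * E))\<^sup>2 - (hs_norm (top_rows q (R * E)))\<^sup>2"
      using hs_norm_top_rows[OF RE qm] by simp
    also have "hs_norm (R * E) = hs_norm E" by (rule hs_norm_orthogonal_mult[OF Ro E])
    finally show ?thesis by simp
  qed
  show ?thesis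
    by (rule that[OF R qm T _ TT]) (use B J key in auto)
qed

subsection \<open>Gaussian matrices\<close>

text \<open>Restriction to the index rectangle puts the result into the space of
  \<open>gauss_mat\<close>, where the map is inverse to \<open>mat q n\<close>.\<close>

definition mat_entries :: "nat \<Rightarrow> nat \<Rightarrow> real mat \<Rightarrow> nat \<times> nat \<Rightarrow> real" where
  "mat_entries q n A = restrict (\<lambda>ij. A $$ ij) ({..<q} \<times> {..<n})"

abbreviation gauss_mat :: "nat \<Rightarrow> nat \<Rightarrow> (nat \<times> nat \<Rightarrow> real) measure" where
  "gauss_mat q n \<equiv> gauss_PiM ({..<q} \<times> {..<n})"

lemma gaussian_entries_eq: "gaussian_entries q n = gauss_mat q n"
  by (simp add: gaussian_entries_def)

lemma mat_entries_mat: "g \<in> space (gauss_mat q n) \<Longrightarrow> mat_entries q n (mat q n g) = g"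
  by (auto simp: mat_entries_def space_PiM PiE_iff extensional_def fun_eq_iff)

lemma mat_mat_entries: "A \<in> carrier_mat q n \<Longrightarrow> mat q n (mat_entries q n A) = A"
  by (rule eq_matI) (auto simp: mat_entries_def)

lemma measurable_gauss_PiM_I:
  assumes "\<And>x. x \<in> space M \<Longrightarrow> f x \<in> extensional I" "\<And>i. i \<in> I \<Longrightarrow> (\<lambda>x. f x i) \<in> borel_measurable M"
  shows "f \<in> M \<rightarrow>\<^sub>M gauss_PiM I"
proof (rule measurable_PiM_single')
  show "f \<in> space M \<rightarrow> (\<Pi>\<^sub>E i\<in>I. space std_normal)"
    using assms(1) by (auto simp: PiE_iff)
  show "(\<lambda>x. f x i) \<in> M \<rightarrow>\<^sub>M std_normal" if "i \<in> I" for i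
    using assms(2)[OF that] by (simp cong: measurable_cong_sets)
qed

lemma mat_entries_mult_measurable:
  assumes R: "R \<in> carrier_mat m m" and q: "q \<le> m"
  shows "(\<lambda>g. mat_entries q n (R * mat m n g)) \<in> gauss_mat m n \<rightarrow>\<^sub>M gauss_mat q n"
proof (rule measurable_gauss_PiM_I)
  fix ij assume "ij \<in> {..<q} \<times> {..<n}"
  then obtain i j where ij: "ij = (i, j)" "i < q" "j < n" "i < m" using q by auto
  have "mat_entries q n (R * mat m n g) ij = (\<Sum>l<m. R $$ (i, l) * g (l, j))" for g
    using mat_mult_index_sum[OF R, of "mat m n g" n i j] ij by (simp add: mat_entries_def del: index_mult_mat(1))
  moreover have "(\<lambda>g. \<Sum>l<m. R $$ (i, l) * g (l, j)) \<in> borel_measurable (gauss_mat m n)"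
    by measurable (use ij in auto)
  ultimately show "(\<lambda>g. mat_entries q n (R * mat m n g) ij) \<in> borel_measurable (gauss_mat m n)" by simp
qed (simp add: mat_entries_def)

text \<open>A Givens matrix rotates every column in the same plane. The auxiliary map
  \<open>\<phi> l\<close> does this for the first \<open>l\<close> columns, and each further column
  is a plane rotation of two entries of the array.\<close>

lemma distr_gauss_mat_givens:
  assumes ik: "i < m" "k < m" "i \<noteq> k" and cs: "c\<^sup>2 + s\<^sup>2 = 1" and c: "0 \<le> c"
  shows "distr (gauss_mat m n) (gauss_mat m n) (\<lambda>g. mat_entries m n (givens m i k c s * mat m n g)) = gauss_mat m n"
proof -
  let ?M = "gauss_mat m n"
  define \<phi> where "\<phi> l g = (\<lambda>(a, b). if b < l then (if a = i then c * g (i, b) - s * g (k, b)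
      else if a = k then s * g (i, b) + c * g (k, b) else g (a, b)) else g (a, b))"
    for l :: nat and g :: "nat \<times> nat \<Rightarrow> real"
  have "\<phi> l \<in> ?M \<rightarrow>\<^sub>M ?M \<and> distr ?M ?M (\<phi> l) = ?M" if "l \<le> n" for l
    using that
  proof (induction l)
    case 0
    have "\<phi> 0 = (\<lambda>g. g)" by (auto simp: \<phi>_def fun_eq_iff)
    then show ?case by (simp add: distr_id)
  next
    case (Suc l)
    then have IH: "\<phi> l \<in> ?M \<rightarrow>\<^sub>M ?M" "distr ?M ?M (\<phi> l) = ?M" by auto
    have in': "(i, l) \<in> {..<m} \<times> {..<n}" "(k, l) \<in> {..<m} \<times> {..<n}" using ik Suc.prems by auto
    have eq: "\<phi> (Suc l) = plane_rotation (i, l) (k, l) c s \<circ> \<phi> l"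
      using ik(3) by (auto simp: \<phi>_def fun_eq_iff plane_rotation_def less_Suc_eq)
    note pm = plane_rotation_measurable[OF in', of c s]
    have "distr ?M ?M (\<phi> (Suc l)) = distr (distr ?M ?M (\<phi> l)) ?M (plane_rotation (i, l) (k, l) c s)"
      unfolding eq by (rule distr_distr[symmetric, OF pm IH(1)])
    also have "\<dots> = ?M"
      unfolding IH(2) by (rule distr_gauss_PiM_plane_rotation) (use in' ik cs c in auto)
    finally have "distr ?M ?M (\<phi> (Suc l)) = ?M" .
    then show ?case unfolding eq using measurable_comp[OF IH(1) pm] by blast
  qed
  then have \<phi>: "distr ?M ?M (\<phi> n) = ?M" by simp
  have "mat_entries m n (givens m i k c s * mat m n g) = \<phi> n g" if g: "g \<in> space ?M" for g
  proof
    fix ab :: "nat \<times> nat"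
    obtain a b where ab: "ab = (a, b)" by force
    show "mat_entries m n (givens m i k c s * mat m n g) ab = \<phi> n g ab"
    proof (cases "a < m \<and> b < n")
      case True
      then show ?thesis
        using givens_mult_index[of "mat m n g" m n i k a b c s] ik
        by (simp add: mat_entries_def \<phi>_def ab del: index_mult_mat(1))
    next
      case False
      have "\<phi> n g (a, b) = g (a, b)" using False ik by (auto simp: \<phi>_def)
      moreover have "g (a, b) = undefined"
        using g False by (auto simp: space_PiM PiE_iff extensional_def)
      ultimately show ?thesis using False by (auto simp: mat_entries_def ab)
    qed
  qed
  then have "distr ?M ?M (\<lambda>g. mat_entries m n (givens m i k c s * mat m n g)) = distr ?M ?M (\<phi> n)"
    by (intro distr_cong) auto
  then show ?thesis by (simp add: \<phi>)
qed

lemma distr_gauss_mat_rotation: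
  assumes "R \<in> rotations m 0"
  shows "distr (gauss_mat m n) (gauss_mat m n) (\<lambda>g. mat_entries m n (R * mat m n g)) = gauss_mat m n"
  using assms
proof (induction rule: rotations.induct)
  case one
  have "distr (gauss_mat m n) (gauss_mat m n) (\<lambda>g. mat_entries m n (1\<^sub>m m * mat m n g))
      = distr (gauss_mat m n) (gauss_mat m n) (\<lambda>g. g)"
    by (intro distr_cong) (auto simp: mat_entries_mat)
  then show ?case by (simp add: distr_id)
next
  case (step R i j c s)
  let ?M = "gauss_mat m n"
  note Rc = rotations_carrier[OF step.hyps(1)]
  have comp: "(\<lambda>g. mat_entries m n (givens m i j c s * R * mat m n g)) =
      (\<lambda>g. mat_entries m n (givens m i j c s * mat m n g)) \<circ> (\<lambda>g. mat_entries m n (R * mat m n g))"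
  proof
    fix g
    have "givens m i j c s * R * mat m n g = givens m i j c s * (R * mat m n g)"
      using Rc by (simp add: assoc_mult_mat[of _ m m _ m _ n])
    moreover have "mat m n (mat_entries m n (R * mat m n g)) = R * mat m n g"
      by (rule mat_mat_entries) (use Rc in auto)
    ultimately show "mat_entries m n (givens m i j c s * R * mat m n g) =
      ((\<lambda>g. mat_entries m n (givens m i j c s * mat m n g)) \<circ> (\<lambda>g. mat_entries m n (R * mat m n g))) g"
      by simp
  qed
  have "distr ?M ?M (\<lambda>g. mat_entries m n (givens m i j c s * R * mat m n g)) =
      distr (distr ?M ?M (\<lambda>g. mat_entries m n (R * mat m n g))) ?M (\<lambda>g. mat_entries m n (givens m i j c s * mat m n g))"
    unfolding comp by (intro distr_distr[symmetric] mat_entries_mult_measurable) (use Rc in auto)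
  also have "\<dots> = ?M"
    unfolding step.IH by (rule distr_gauss_mat_givens) (use step.hyps in auto)
  finally show ?case .
qed

lemma mat_entries_top_rows:
  assumes "A \<in> carrier_mat m n" "q \<le> m"
  shows "mat_entries q n (top_rows q A) = restrict (mat_entries m n A) ({..<q} \<times> {..<n})"
  using assms by (auto simp: mat_entries_def top_rows_def fun_eq_iff)

text \<open>Independence amounts to the joint law being a product; the equivalence is applied to a
  nonempty index set, which is where the positive dimensions enter.\<close>

lemma std_gaussian_matrix_distr:
  assumes M: "prob_space M" and mn: "0 < m" "0 < n" and E: "std_gaussian_matrix M m n E"
  shows "(\<lambda>\<omega>. mat_entries m n (E \<omega>)) \<in> M \<rightarrow>\<^sub>M gauss_mat m n"
    and "distr M (gauss_mat m n) (\<lambda>\<omega>. mat_entries m n (E \<omega>)) = gauss_mat m n"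
proof -
  interpret prob_space M by fact
  let ?I = "{..<m} \<times> {..<n}"
  have ind: "indep_vars (\<lambda>_. borel) (\<lambda>ij \<omega>. E \<omega> $$ ij) ?I"
    and dis: "\<And>ij. ij \<in> ?I \<Longrightarrow> distributed M lborel (\<lambda>\<omega>. E \<omega> $$ ij) std_normal_density"
    using E by (auto simp: std_gaussian_matrix_def)
  have rv: "random_variable borel (\<lambda>\<omega>. E \<omega> $$ ij)" if "ij \<in> ?I" for ij
    using distributed_measurable[OF dis[OF that]] by (simp cong: measurable_cong_sets)
  have ne: "?I \<noteq> {}" using mn by auto
  have d: "distr M borel (\<lambda>\<omega>. E \<omega> $$ ij) = std_normal" if "ij \<in> ?I" for ij
  proof -
    have "distr M borel (\<lambda>\<omega>. E \<omega> $$ ij) = distr M lborel (\<lambda>\<omega>. E \<omega> $$ ij)"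
      by (intro distr_cong) auto
    then show ?thesis using distributed_distr_eq_density[OF dis[OF that]] by simp
  qed
  show "(\<lambda>\<omega>. mat_entries m n (E \<omega>)) \<in> M \<rightarrow>\<^sub>M gauss_mat m n"
    by (rule measurable_gauss_PiM_I) (use rv in \<open>auto simp: mat_entries_def\<close>)
  have "distr M (PiM ?I (\<lambda>_. borel)) (\<lambda>\<omega>. \<lambda>ij\<in>?I. E \<omega> $$ ij) = PiM ?I (\<lambda>ij. distr M borel (\<lambda>\<omega>. E \<omega> $$ ij))"
    using indep_vars_iff_distr_eq_PiM'[OF ne, where M' = "\<lambda>_. borel" and X = "\<lambda>ij \<omega>. E \<omega> $$ ij"] rv ind by blast
  also have "\<dots> = gauss_mat m n" by (intro PiM_cong refl d)
  also have "distr M (PiM ?I (\<lambda>_. borel)) (\<lambda>\<omega>. \<lambda>ij\<in>?I. E \<omega> $$ ij) = distr M (gauss_mat m n) (\<lambda>\<omega>. mat_entries m n (E \<omega>))"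
    by (intro distr_cong refl) (auto simp: mat_entries_def intro!: sets_PiM_cong)
  finally show "distr M (gauss_mat m n) (\<lambda>\<omega>. mat_entries m n (E \<omega>)) = gauss_mat m n" .
qed

lemma distr_top_rows_rotation:
  assumes M: "prob_space M" and mn: "0 < m" "0 < n" and E: "std_gaussian_matrix M m n E"
    and R: "R \<in> rotations m 0" and q: "q \<le> m"
  shows "(\<lambda>\<omega>. mat_entries q n (top_rows q (R * E \<omega>))) \<in> M \<rightarrow>\<^sub>M gauss_mat q n"
    and "distr M (gauss_mat q n) (\<lambda>\<omega>. mat_entries q n (top_rows q (R * E \<omega>))) = gauss_mat q n"
proof -
  let ?f = "\<lambda>\<omega>. mat_entries m n (E \<omega>)" and ?g = "\<lambda>g. mat_entries m n (R * mat m n g)"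
    and ?h = "\<lambda>g. restrict g ({..<q} \<times> {..<n})"
  interpret product_prob_space "\<lambda>_::nat \<times> nat. std_normal" by (rule product_prob_space_std_normal)
  note Rc = rotations_carrier[OF R]
  have Ec: "E \<omega> \<in> carrier_mat m n" if "\<omega> \<in> space M" for \<omega>
    using E that by (auto simp: std_gaussian_matrix_def)
  have eq: "mat_entries q n (top_rows q (R * E \<omega>)) = ?h (?g (?f \<omega>))" if "\<omega> \<in> space M" for \<omega>
    using mat_entries_top_rows[of "R * E \<omega>" m n q] Ec[OF that] Rc q by (simp add: mat_mat_entries)
  have sub: "{..<q} \<times> {..<n} \<subseteq> {..<m} \<times> {..<n}" using q by auto
  note mf = std_gaussian_matrix_distr[OF M mn E]
  have mg: "?g \<in> gauss_mat m n \<rightarrow>\<^sub>M gauss_mat m n" by (rule mat_entries_mult_measurable[OF Rc order_refl])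
  have mh: "?h \<in> gauss_mat m n \<rightarrow>\<^sub>M gauss_mat q n" by (rule measurable_restrict_subset[OF sub])
  have mgf: "(\<lambda>\<omega>. ?g (?f \<omega>)) \<in> M \<rightarrow>\<^sub>M gauss_mat m n" by (rule measurable_compose[OF mf(1) mg])
  have "(\<lambda>\<omega>. ?h (?g (?f \<omega>))) \<in> M \<rightarrow>\<^sub>M gauss_mat q n" by (rule measurable_compose[OF mgf mh])
  then show "(\<lambda>\<omega>. mat_entries q n (top_rows q (R * E \<omega>))) \<in> M \<rightarrow>\<^sub>M gauss_mat q n"
    by (subst measurable_cong[OF eq])
  have "distr M (gauss_mat q n) (\<lambda>\<omega>. mat_entries q n (top_rows q (R * E \<omega>)))
      = distr M (gauss_mat q n) (?h \<circ> (\<lambda>\<omega>. ?g (?f \<omega>)))"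
    by (intro distr_cong refl) (simp add: eq)
  also have "\<dots> = distr (distr M (gauss_mat m n) (?g \<circ> ?f)) (gauss_mat q n) ?h"
    using distr_distr[OF mh mgf] by (simp add: comp_def)
  also have "distr M (gauss_mat m n) (?g \<circ> ?f) = distr (distr M (gauss_mat m n) ?f) (gauss_mat m n) ?g"
    by (rule distr_distr[symmetric, OF mg mf(1)])
  also have "\<dots> = gauss_mat m n"
    unfolding mf(2) by (rule distr_gauss_mat_rotation[OF R])
  also have "distr (gauss_mat m n) (gauss_mat q n) ?h = gauss_mat q n"
    by (rule distr_restrict[OF sub, symmetric]) simp
  finally show "distr M (gauss_mat q n) (\<lambda>\<omega>. mat_entries q n (top_rows q (R * E \<omega>))) = gauss_mat q n" .
qed

section \<open>Means of Hilbert-Schmidt and Ky Fan norms\<close>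

lemma hs_norm_mat: "hs_norm (mat q n g) = L2_set g ({..<q} \<times> {..<n})"
  by (simp add: hs_norm_def L2_set_def sum.cartesian_product')

lemma lipschitz_L2_hs_norm: "lipschitz_L2 ({..<q} \<times> {..<n}) 1 (\<lambda>g. hs_norm (mat q n g))"
proof -
  have *: "L2_set x I \<le> L2_set y I + L2_set (\<lambda>i. x i - y i) I" for x y :: "nat \<times> nat \<Rightarrow> real" and I
    using L2_set_triangle_ineq[of y "\<lambda>i. x i - y i" I] by simp
  have sym: "L2_set (\<lambda>i. y i - x i) I = L2_set (\<lambda>i. x i - y i) I" for x y :: "nat \<times> nat \<Rightarrow> real" and I
    by (simp add: L2_set_def power2_commute)
  have "\<bar>L2_set x I - L2_set y I\<bar> \<le> L2_set (\<lambda>i. x i - y i) I" for x y :: "nat \<times> nat \<Rightarrow> real" and I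
    using *[of x I y] *[of y I x] sym[of y x I] by linarith
  then show ?thesis by (simp add: lipschitz_L2_def hs_norm_mat)
qed

lemma lipschitz_L2_ky_fan2:
  assumes r: "r \<le> n"
  shows "lipschitz_L2 ({..<q} \<times> {..<n}) 1 (\<lambda>g. ky_fan2 r (mat q n g))"
proof -
  have d: "hs_norm (mat q n x - mat q n y) = L2_set (\<lambda>i. x i - y i) ({..<q} \<times> {..<n})" for x y :: "nat \<times> nat \<Rightarrow> real"
  proof -
    have "mat q n x - mat q n y = mat q n (\<lambda>i. x i - y i)" by (rule eq_matI) auto
    then show ?thesis by (simp add: hs_norm_mat)
  qed
  have sym: "L2_set (\<lambda>i. y i - x i) I = L2_set (\<lambda>i. x i - y i) I" for x y :: "nat \<times> nat \<Rightarrow> real" and I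
    by (simp add: L2_set_def power2_commute)
  have "\<bar>ky_fan2 r (mat q n x) - ky_fan2 r (mat q n y)\<bar> \<le> L2_set (\<lambda>i. x i - y i) ({..<q} \<times> {..<n})" for x y
    using ky_fan2_lipschitz_le[of "mat q n x" q n "mat q n y" r] ky_fan2_lipschitz_le[of "mat q n y" q n "mat q n x" r]
      r d[of x y] d[of y x] sym[of y x] by auto
  then show ?thesis by (simp add: lipschitz_L2_def)
qed

lemma gauss_component_second_moment:
  assumes "i \<in> I"
  shows "integrable (gauss_PiM I) (\<lambda>g. (g i)\<^sup>2)" "(LINT g|gauss_PiM I. (g i)\<^sup>2) = 1"
proof -
  interpret product_prob_space "\<lambda>_::'a. std_normal" by (rule product_prob_space_std_normal)
  have d: "distr (gauss_PiM I) std_normal (\<lambda>g. g i) = std_normal" by (rule PiM_component[OF assms])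
  have m: "(\<lambda>g. g i) \<in> gauss_PiM I \<rightarrow>\<^sub>M std_normal" using assms by measurable
  have i1: "integrable std_normal (\<lambda>x. x\<^sup>2)"
    using integrable_std_normal_moment[of 2] by (subst integrable_density) auto
  have "(LINT x|std_normal. x\<^sup>2) = 1"
    using integral_std_normal_moment_even[of 1] by (subst integral_density) (auto simp: numeral_2_eq_2)
  then show "(LINT g|gauss_PiM I. (g i)\<^sup>2) = 1"
    using integral_distr[OF m, of "\<lambda>x. x\<^sup>2"] by (simp add: d)
  show "integrable (gauss_PiM I) (\<lambda>g. (g i)\<^sup>2)"
    using integrable_distr[OF m, of "\<lambda>x. x\<^sup>2"] i1 by (simp add: d)
qed

lemma gauss_sum_squares:
  assumes "J \<subseteq> I" "finite J"
  shows "integrable (gauss_PiM I) (\<lambda>g. \<Sum>i\<in>J. (g i)\<^sup>2)" "(LINT g|gauss_PiM I. (\<Sum>i\<in>J. (g i)\<^sup>2)) = card J"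
  using gauss_component_second_moment[of _ I] assms by (auto simp: subset_iff)

lemma square_expectation_le:
  assumes I: "finite I" and F: "lipschitz_L2 I L F"
  shows "(LINT x|gauss_PiM I. F x)\<^sup>2 \<le> (LINT x|gauss_PiM I. (F x)\<^sup>2)"
proof -
  interpret prob_space "gauss_PiM I" by (rule prob_space_gauss_PiM)
  note i = integrable_lipschitz[OF I F]
  have "0 \<le> variance F" by simp
  then show ?thesis using i by (simp add: variance_eq)
qed

lemma gauss_ky_fan_eq: "gauss_ky_fan q n r = (LINT g|gauss_mat q n. ky_fan2 r (mat q n g))"
  by (simp add: gauss_ky_fan_def gaussian_entries_eq)

lemma gauss_ky_fan_nonneg: "0 \<le> gauss_ky_fan q n r"
  unfolding gauss_ky_fan_eq by (simp add: ky_fan2_nonneg)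

lemma expectation_hs_norm_le: "(LINT g|gauss_mat q n. hs_norm (mat q n g)) \<le> sqrt (real q * real n)"
proof (rule real_le_rsqrt)
  have "(LINT g|gauss_mat q n. hs_norm (mat q n g))\<^sup>2 \<le> (LINT g|gauss_mat q n. (hs_norm (mat q n g))\<^sup>2)"
    by (rule square_expectation_le[OF _ lipschitz_L2_hs_norm]) simp
  also have "\<dots> = real q * real n"
    using gauss_sum_squares(2)[of "{..<q} \<times> {..<n}" "{..<q} \<times> {..<n}"]
    by (simp add: hs_norm_mat L2_set_def sum_nonneg)
  finally show "(LINT g|gauss_mat q n. hs_norm (mat q n g))\<^sup>2 \<le> real q * real n" .
qed

lemma gauss_ky_fan_sq_le:
  assumes r: "r \<le> n"
  shows "(gauss_ky_fan q n r)\<^sup>2 \<le> real q * real n"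
proof -
  note L = lipschitz_L2_ky_fan2[OF r, of q]
  have "(gauss_ky_fan q n r)\<^sup>2 \<le> (LINT g|gauss_mat q n. (ky_fan2 r (mat q n g))\<^sup>2)"
    unfolding gauss_ky_fan_eq by (rule square_expectation_le[OF _ L]) simp
  also have "\<dots> \<le> (LINT g|gauss_mat q n. (hs_norm (mat q n g))\<^sup>2)"
    using integrable_lipschitz(2)[OF _ L] integrable_lipschitz(2)[OF _ lipschitz_L2_hs_norm[of q n]] r
    by (intro integral_mono ky_fan2_sq_le_hs_norm) auto
  also have "\<dots> = real q * real n"
    using gauss_sum_squares(2)[of "{..<q} \<times> {..<n}" "{..<q} \<times> {..<n}"]
    by (simp add: hs_norm_mat L2_set_def sum_nonneg)
  finally show ?thesis .
qed

text \<open>The first \<open>r\<close> rows and the first \<open>r\<close> columns bound the squared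
  Ky Fan norm from below, with \<open>r * n\<close> and \<open>q * r\<close> entries of unit
  variance. The 7 is the price for passing from the second moment to the squared mean.\<close>

lemma gauss_ky_fan_sq_ge:
  assumes r: "r \<le> n" "r \<le> q"
  shows "real r * real (max n q) \<le> (gauss_ky_fan q n r)\<^sup>2 + 7"
proof -
  note L = lipschitz_L2_ky_fan2[OF r(1), of q]
  let ?I = "{..<q} \<times> {..<n}"
  have iK: "integrable (gauss_mat q n) (\<lambda>g. (ky_fan2 r (mat q n g))\<^sup>2)"
    by (rule integrable_lipschitz(2)[OF _ L]) simp
  have *: "real (card J) \<le> (LINT g|gauss_mat q n. (ky_fan2 r (mat q n g))\<^sup>2)"
    if J: "J \<subseteq> ?I" and le: "\<And>g. (\<Sum>ij\<in>J. (g ij)\<^sup>2) \<le> (ky_fan2 r (mat q n g))\<^sup>2" for J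
  proof -
    have fJ: "finite J" using J by (rule finite_subset) simp
    show ?thesis
      unfolding gauss_sum_squares(2)[OF J fJ, symmetric]
      by (rule integral_mono[OF gauss_sum_squares(1)[OF J fJ] iK le])
  qed
  have "(\<Sum>ij\<in>{..<r} \<times> {..<n}. (g ij)\<^sup>2) \<le> (ky_fan2 r (mat q n g))\<^sup>2" for g
    using sum_rows_le_ky_fan2[of "mat q n g" q n r] r by (simp add: sum.cartesian_product')
  moreover have "{..<r} \<times> {..<n} \<subseteq> ?I" using r by auto
  ultimately have "real r * real n \<le> (LINT g|gauss_mat q n. (ky_fan2 r (mat q n g))\<^sup>2)"
    using *[of "{..<r} \<times> {..<n}"] by simp
  moreover have "real q * real r \<le> (LINT g|gauss_mat q n. (ky_fan2 r (mat q n g))\<^sup>2)"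
  proof -
    have "(\<Sum>ij\<in>{..<q} \<times> {..<r}. (g ij)\<^sup>2) \<le> (ky_fan2 r (mat q n g))\<^sup>2" for g
    proof -
      have "(\<Sum>ij\<in>{..<q} \<times> {..<r}. (g ij)\<^sup>2) = (\<Sum>j<r. \<Sum>i<q. (g (i, j))\<^sup>2)"
        unfolding sum.cartesian_product' by (rule sum.swap)
      then show ?thesis using sum_cols_le_ky_fan2[of "mat q n g" q n r] r by simp
    qed
    moreover have "{..<q} \<times> {..<r} \<subseteq> ?I" using r by auto
    ultimately show ?thesis using *[of "{..<q} \<times> {..<r}"] by simp
  qed
  ultimately have "real r * real (max n q) \<le> (LINT g|gauss_mat q n. (ky_fan2 r (mat q n g))\<^sup>2)"
    by (simp add: max_def mult.commute)
  also have "\<dots> \<le> (gauss_ky_fan q n r)\<^sup>2 + 7"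
    unfolding gauss_ky_fan_eq by (rule gauss_lipschitz_second_moment[OF _ L]) simp
  finally show ?thesis .
qed

lemma gauss_ky_fan_sq_le_dims:
  assumes r: "r \<le> n" and qn: "0 < q" "0 < n"
  shows "(gauss_ky_fan q n r)\<^sup>2 \<le> real r * (2 * (sqrt (real q) + sqrt (real n))\<^sup>2)"
proof -
  note L = lipschitz_L2_ky_fan2[OF r, of q]
  have L1: "lipschitz_L2 ({..<q} \<times> {..<n}) 1 (\<lambda>g. ky_fan2 1 (mat q n g))"
    by (rule lipschitz_L2_ky_fan2) (use qn in simp)
  have i1: "integrable (gauss_mat q n) (\<lambda>g. (ky_fan2 1 (mat q n g))\<^sup>2)"
    by (rule integrable_lipschitz(2)[OF _ L1]) simp
  have "(gauss_ky_fan q n r)\<^sup>2 \<le> (LINT g|gauss_mat q n. (ky_fan2 r (mat q n g))\<^sup>2)"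
    unfolding gauss_ky_fan_eq by (rule square_expectation_le[OF _ L]) simp
  also have "\<dots> \<le> (LINT g|gauss_mat q n. real r * (ky_fan2 1 (mat q n g))\<^sup>2)"
  proof (rule integral_mono)
    show "integrable (gauss_mat q n) (\<lambda>g. (ky_fan2 r (mat q n g))\<^sup>2)"
      by (rule integrable_lipschitz(2)[OF _ L]) simp
    show "integrable (gauss_mat q n) (\<lambda>g. real r * (ky_fan2 1 (mat q n g))\<^sup>2)"
      using i1 by (rule integrable_mult_right)
    show "(ky_fan2 r (mat q n g))\<^sup>2 \<le> real r * (ky_fan2 1 (mat q n g))\<^sup>2" for g
      by (rule ky_fan2_sq_le_mult[of _ q n, OF _ r]) simp
  qed
  also have "\<dots> = real r * (LINT g|gauss_mat q n. (ky_fan2 1 (mat q n g))\<^sup>2)" by simp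
  also have "\<dots> \<le> real r * (2 * (sqrt (real (card {..<q})) + sqrt (real (card {..<n})))\<^sup>2)"
  proof (rule mult_left_mono[OF integral_operator_norm_le_dims])
    fix g :: "nat \<times> nat \<Rightarrow> real"
    obtain v where v: "(\<Sum>j<n. (v j)\<^sup>2) = 1" "(ky_fan2 1 (mat q n g))\<^sup>2 = (\<Sum>i<q. (\<Sum>j<n. mat q n g $$ (i, j) * v j)\<^sup>2)"
      by (rule ky_fan2_1_attained[of "mat q n g" q n]) (use qn in auto)
    then show "\<exists>v. (\<Sum>j<n. (v j)\<^sup>2) \<le> 1 \<and> (ky_fan2 1 (mat q n g))\<^sup>2 \<le> (\<Sum>i<q. (\<Sum>j<n. g (i, j) * v j)\<^sup>2)"
      by (intro exI[of _ v]) simp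
  qed (use qn i1 in auto)
  finally show ?thesis by simp
qed

subsection \<open>The selected rank\<close>

lemma hs_norm_smult:
  assumes "0 \<le> c"
  shows "hs_norm (c \<cdot>\<^sub>m A) = c * hs_norm A"
proof -
  have "(hs_norm (c \<cdot>\<^sub>m A))\<^sup>2 = (c * hs_norm A)\<^sup>2"
    by (simp add: hs_norm_sq_rows power_mult_distrib sum_distrib_left)
  then show ?thesis using assms by (simp add: hs_norm_nonneg power2_eq_iff_nonneg)
qed

text \<open>Upper bound: because of \<open>T * T' = 1\<close>, the best approximation of
  \<open>G\<close> has a preimage \<open>C\<close> under \<open>T\<close>, and its factored form
  bounds the rank. Lower bound: a matrix of rank \<open>s <= r\<close> factors through dimension
  \<open>s\<close>, hence so does its image under \<open>T\<close>, and
  \<open>eckart_young_le\<close> applies.\<close>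

lemma rank_restricted_lse_rss:
  assumes X: "X \<in> carrier_mat m p" and T: "T \<in> carrier_mat q p" and T': "T' \<in> carrier_mat p q" "T * T' = 1\<^sub>m q"
    and key: "\<forall>B\<in>carrier_mat p n. (hs_norm (E - X * B))\<^sup>2 = (hs_norm E)\<^sup>2 - (hs_norm G)\<^sup>2 + (hs_norm (G - T * B))\<^sup>2"
    and E: "E \<in> carrier_mat m n" and G: "G \<in> carrier_mat q n" and \<sigma>: "0 < \<sigma>" and r: "r \<le> n"
    and lse: "rank_restricted_lse p n r X (\<sigma> \<cdot>\<^sub>m E) B"
  shows "(hs_norm (\<sigma> \<cdot>\<^sub>m E - X * B))\<^sup>2 = \<sigma>\<^sup>2 * ((hs_norm E)\<^sup>2 - (ky_fan2 r G)\<^sup>2)"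
proof -
  interpret vec_space "TYPE(real)" p .
  have Bc: "B \<in> carrier_mat p n" and Br: "vec_space.rank p B \<le> r"
    and opt: "\<And>C. C \<in> carrier_mat p n \<Longrightarrow> vec_space.rank p C \<le> r \<Longrightarrow>
        hs_norm (\<sigma> \<cdot>\<^sub>m E - X * B) \<le> hs_norm (\<sigma> \<cdot>\<^sub>m E - X * C)"
    using lse unfolding rank_restricted_lse_def is_arg_min_def by (auto simp: not_less)
  \<comment> \<open>Competitors are scaled along with the data, which reduces the problem to unit
    noise level.\<close>
  have scale: "hs_norm (\<sigma> \<cdot>\<^sub>m E - X * (\<sigma> \<cdot>\<^sub>m C)) = \<sigma> * hs_norm (E - X * C)" if C: "C \<in> carrier_mat p n" for C
  proof -
    have "\<sigma> \<cdot>\<^sub>m E - X * (\<sigma> \<cdot>\<^sub>m C) = \<sigma> \<cdot>\<^sub>m (E - X * C)"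
    proof (rule eq_matI)
      fix i j assume "i < dim_row (\<sigma> \<cdot>\<^sub>m (E - X * C))" "j < dim_col (\<sigma> \<cdot>\<^sub>m (E - X * C))"
      then show "(\<sigma> \<cdot>\<^sub>m E - X * (\<sigma> \<cdot>\<^sub>m C)) $$ (i, j) = (\<sigma> \<cdot>\<^sub>m (E - X * C)) $$ (i, j)"
        using X C E unfolding mult_smult_distrib[OF X C] by (simp add: right_diff_distrib del: index_mult_mat(1))
    qed (use X C E in auto)
    then show ?thesis using \<sigma> by (simp add: hs_norm_smult)
  qed
  show ?thesis
  proof (rule antisym)
    obtain V where V: "V \<in> carrier_mat n r" "(hs_norm (G - G * V * transpose_mat V))\<^sup>2 = (hs_norm G)\<^sup>2 - (ky_fan2 r G)\<^sup>2"
      by (rule eckart_young_attained[OF G r])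
    define L where "L = T' * (G * V)"
    define C where "C = L * transpose_mat V"
    have L: "L \<in> carrier_mat p r" and Vt: "transpose_mat V \<in> carrier_mat r n" and GV: "G * V \<in> carrier_mat q r"
      using T' G V by (auto simp: L_def)
    have C: "C \<in> carrier_mat p n" using L Vt by (simp add: C_def)
    have "\<sigma> \<cdot>\<^sub>m C = (\<sigma> \<cdot>\<^sub>m L) * transpose_mat V"
      unfolding C_def by (rule mult_smult_assoc_mat[symmetric, OF L Vt])
    then have "vec_space.rank p (\<sigma> \<cdot>\<^sub>m C) \<le> r"
      using rank_mult_le[of "\<sigma> \<cdot>\<^sub>m L" p r "transpose_mat V" n] L Vt by simp
    then have "hs_norm (\<sigma> \<cdot>\<^sub>m E - X * B) \<le> \<sigma> * hs_norm (E - X * C)"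
      using opt[of "\<sigma> \<cdot>\<^sub>m C"] C scale[OF C] by simp
    then have "(hs_norm (\<sigma> \<cdot>\<^sub>m E - X * B))\<^sup>2 \<le> (\<sigma> * hs_norm (E - X * C))\<^sup>2"
      by (intro power_mono hs_norm_nonneg)
    also have "\<dots> = \<sigma>\<^sup>2 * ((hs_norm E)\<^sup>2 - (hs_norm G)\<^sup>2 + (hs_norm (G - T * C))\<^sup>2)"
      using bspec[OF key C] by (simp add: power_mult_distrib)
    also have "T * C = G * V * transpose_mat V"
    proof -
      have "T * L = (T * T') * (G * V)"
        unfolding L_def by (rule assoc_mult_mat[symmetric, OF T T'(1) GV])
      then have "T * L = G * V" using T'(2) left_mult_one_mat[OF GV] by simp
      then show ?thesis unfolding C_def using assoc_mult_mat[OF T L Vt] by simp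
    qed
    finally show "(hs_norm (\<sigma> \<cdot>\<^sub>m E - X * B))\<^sup>2 \<le> \<sigma>\<^sup>2 * ((hs_norm E)\<^sup>2 - (ky_fan2 r G)\<^sup>2)"
      unfolding V(2) by simp
  next
    define s where "s = rank B"
    have s: "s \<le> r" using Br by (simp add: s_def)
    obtain W B' Z where W: "W \<in> carrier_mat p s" and "B' \<in> carrier_mat n s" and Z: "Z \<in> carrier_mat s n"
      and BWZ: "B = W * Z" and "W = B * B'" and "\<forall>v\<in>carrier_vec s. W *\<^sub>v v = 0\<^sub>v p \<longrightarrow> v = 0\<^sub>v s"
      unfolding s_def by (rule rank_factorization[OF Bc])
    define C where "C = (1 / \<sigma>) \<cdot>\<^sub>m B"
    have C: "C \<in> carrier_mat p n" using Bc by (simp add: C_def)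
    have "B = \<sigma> \<cdot>\<^sub>m C" using \<sigma> by (auto simp: C_def)
    then have h: "hs_norm (\<sigma> \<cdot>\<^sub>m E - X * B) = \<sigma> * hs_norm (E - X * C)" using scale[OF C] by simp
    define W' where "W' = T * ((1 / \<sigma>) \<cdot>\<^sub>m W)"
    have W': "W' \<in> carrier_mat q s" using T W by (simp add: W'_def)
    have "C = ((1 / \<sigma>) \<cdot>\<^sub>m W) * Z"
      unfolding C_def BWZ by (rule mult_smult_assoc_mat[symmetric, OF W Z])
    then have "T * C = W' * Z"
      unfolding W'_def using assoc_mult_mat[of T q p "(1 / \<sigma>) \<cdot>\<^sub>m W" s Z n] T W Z by simp
    then have "(hs_norm G)\<^sup>2 - (ky_fan2 s G)\<^sup>2 \<le> (hs_norm (G - T * C))\<^sup>2"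
      using eckart_young_le[OF G W' Z] s r by simp
    moreover have "(ky_fan2 s G)\<^sup>2 \<le> (ky_fan2 r G)\<^sup>2"
      by (intro power_mono ky_fan2_mono s ky_fan2_nonneg)
    ultimately have "(hs_norm E)\<^sup>2 - (ky_fan2 r G)\<^sup>2 \<le> (hs_norm (E - X * C))\<^sup>2"
      using bspec[OF key C] by simp
    then show "\<sigma>\<^sup>2 * ((hs_norm E)\<^sup>2 - (ky_fan2 r G)\<^sup>2) \<le> (hs_norm (\<sigma> \<cdot>\<^sub>m E - X * B))\<^sup>2"
      unfolding h power_mult_distrib by (rule mult_left_mono) simp
  qed
qed

section \<open>Comparison of two ranks under the criterion\<close>

lemma one_plus_penalty:
  fixes a K S :: real
  assumes a: "0 < a" and u: "K * S\<^sup>2 / a < 1"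
  shows "1 + (K * S\<^sup>2 / (1 - K / a * S\<^sup>2)) / a = 1 / (1 - K * S\<^sup>2 / a)"
proof -
  define u where "u = K * S\<^sup>2 / a"
  have "K * S\<^sup>2 = u * a" "K / a * S\<^sup>2 = u" using a by (simp_all add: u_def)
  moreover have "1 + (u * a / (1 - u)) / a = 1 / (1 - u)" using a u by (simp add: u_def[symmetric] field_simps)
  ultimately show ?thesis unfolding u_def[symmetric] by simp
qed

text \<open>Here \<open>D\<^sup>2 = min n q\<close>, and \<open>s\<close>, \<open>s0\<close>, \<open>A\<close> stand for the expected Ky Fan norms at the ranks \<open>D\<^sup>2 - 1\<close> and
  \<open>r0\<close> (the largest one below the threshold) and for \<open>sqrt (n * m)\<close>, all divided by \<open>sqrt (max n q)\<close>.\<close>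

lemma selection_inequality:
  fixes D s s0 \<alpha> A :: real
  assumes D: "3 \<le> D" and \<alpha>: "0 < \<alpha>" "\<alpha> \<le> 1 / 4" "2 < \<alpha> * D\<^sup>2"
    and s: "0 \<le> s" "s \<le> D" "D\<^sup>2 - 16 / 9 \<le> s\<^sup>2" and s0: "0 \<le> s0" "s0\<^sup>2 \<le> \<alpha> * D\<^sup>2" and A: "D \<le> A"
  shows "(s0 + sqrt 2 * \<alpha>)\<^sup>2 + (1 - 4 * \<alpha>) * s\<^sup>2 * (1 + 2 * \<alpha> / A)\<^sup>2 < (s - sqrt 2 * \<alpha>)\<^sup>2"
proof -
  define w where "w = sqrt (2 :: real)"
  have w2: "w\<^sup>2 = 2" and w0: "0 < w" by (auto simp: w_def)
  have w: "w \<le> 14143 / 10000" unfolding w_def by (rule real_le_lsqrt) (auto simp: power2_eq_square)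
  have sD: "s\<^sup>2 \<le> D\<^sup>2" using s by (intro power_mono) auto
  have "s\<^sup>2 * (1 + 2 * \<alpha> / A)\<^sup>2 \<le> s\<^sup>2 * (1 + 2 * \<alpha> / D)\<^sup>2"
    using D A \<alpha> by (intro mult_left_mono power_mono add_left_mono divide_left_mono) auto
  also have "\<dots> = s\<^sup>2 + (4 * \<alpha> / D + 4 * \<alpha>\<^sup>2 / D\<^sup>2) * s\<^sup>2"
    using D by (simp add: power2_eq_square field_simps)
  also have "\<dots> \<le> s\<^sup>2 + (4 * \<alpha> / D + 4 * \<alpha>\<^sup>2 / D\<^sup>2) * D\<^sup>2"
    using D \<alpha> by (intro add_left_mono mult_left_mono sD) auto
  also have "\<dots> = s\<^sup>2 + 4 * \<alpha> * D + 4 * \<alpha>\<^sup>2"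
    using D by (simp add: power2_eq_square field_simps)
  finally have "(1 - 4 * \<alpha>) * (s\<^sup>2 * (1 + 2 * \<alpha> / A)\<^sup>2) \<le> (1 - 4 * \<alpha>) * (s\<^sup>2 + 4 * \<alpha> * D + 4 * \<alpha>\<^sup>2)"
    using \<alpha> by (intro mult_left_mono) auto
  then have 1: "(1 - 4 * \<alpha>) * s\<^sup>2 * (1 + 2 * \<alpha> / A)\<^sup>2 \<le> (1 - 4 * \<alpha>) * (s\<^sup>2 + 4 * \<alpha> * D + 4 * \<alpha>\<^sup>2)"
    by (simp only: mult.assoc)
  \<comment> \<open>\<open>\<alpha> * B\<close> is what remains of the difference of both sides,
    with the last summand replaced by its bound, after \<open>\<alpha> * D^2 - s0^2\<close> is split
    off.\<close>
  define B where "B = 4 * s\<^sup>2 - 2 * w * s - D\<^sup>2 - 2 * w * s0 - (1 - 4 * \<alpha>) * (4 * D + 4 * \<alpha>)"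
  \<comment> \<open>The square root of \<open>\<alpha>\<close> is bounded by its tangent at
    \<open>1 / 4\<close>, which makes the bound for \<open>s0\<close> linear in
    \<open>\<alpha>\<close>.\<close>
  have "\<alpha> \<le> ((1 + 4 * \<alpha>) / 4)\<^sup>2" using zero_le_power2[of "1 - 4 * \<alpha>"] by (simp add: power2_eq_square algebra_simps)
  then have "\<alpha> * D\<^sup>2 \<le> ((1 + 4 * \<alpha>) / 4)\<^sup>2 * D\<^sup>2" by (rule mult_right_mono) simp
  then have "s0\<^sup>2 \<le> ((1 + 4 * \<alpha>) / 4 * D)\<^sup>2" using s0 by (simp only: power_mult_distrib)
  then have s0': "s0 \<le> (1 + 4 * \<alpha>) / 4 * D"
    by (rule power2_le_imp_le) (use \<alpha> D in auto)
  have "w * s \<le> 14143 / 10000 * D" using w w0 s D by (intro mult_mono) auto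
  moreover have "w * s0 \<le> 14143 / 10000 * ((1 + 4 * \<alpha>) / 4 * D)" using w w0 s0 s0' by (intro mult_mono) auto
  moreover have "(1 - 4 * \<alpha>) * (4 * \<alpha>) \<le> 1 / 4"
    using zero_le_power2[of "4 * \<alpha> - 1 / 2"] by (simp add: power2_eq_square algebra_simps)
  moreover have "14143 / 10000 * ((1 + 4 * \<alpha>) / 4 * D) = 14143 / 40000 * D + 14143 / 10000 * (\<alpha> * D)"
    by (simp add: field_simps)
  moreover have "B = 4 * s\<^sup>2 - 2 * (w * s) - D\<^sup>2 - 2 * (w * s0) - 4 * D + 16 * (\<alpha> * D) - (1 - 4 * \<alpha>) * (4 * \<alpha>)"
    by (simp add: B_def algebra_simps)
  \<comment> \<open>Rounded constants: \<open>4 * 16 / 9 + 1 / 4 < 37 / 5\<close> is the constant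
    term, \<open>4 + 2 * w + w / 2 < 38 / 5\<close> collects the terms in \<open>D\<close>, and
    \<open>16 - 2 * w > 13\<close> those in \<open>\<alpha> * D\<close>.\<close>
  ultimately have B1: "3 * D\<^sup>2 - 37 / 5 - 38 / 5 * D + 13 * (\<alpha> * D) \<le> B"
    using s(3) D \<alpha> mult_pos_pos[of \<alpha> D] by linarith
  \<comment> \<open>The cubic is the lower bound for \<open>B * D\<close> under
    \<open>\<alpha> * D^2 > 2\<close>, whence \<open>26 = 13 * 2\<close>. Expanded in
    \<open>u = D - 3\<close> it has only positive coefficients.\<close>
  have "0 < 3 * D ^ 3 - 37 / 5 * D - 38 / 5 * D\<^sup>2 + 26"
  proof -
    define u where "u = D - 3"
    have u: "0 \<le> u" "D = 3 + u" using D by (auto simp: u_def)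
    have "3 * D ^ 3 - 37 / 5 * D - 38 / 5 * D\<^sup>2 + 26 = 3 * u ^ 3 + 97 / 5 * u\<^sup>2 + 28 * u + 82 / 5"
      unfolding u(2) by (simp add: power2_eq_square power3_eq_cube field_simps)
    also have "\<dots> > 0" using u(1) by (intro add_nonneg_pos add_nonneg_nonneg) auto
    finally show ?thesis .
  qed
  also have "\<dots> \<le> (3 * D\<^sup>2 - 37 / 5 - 38 / 5 * D + 13 * (\<alpha> * D)) * D"
    using \<alpha>(3) by (simp add: power2_eq_square power3_eq_cube algebra_simps)
  also have "\<dots> \<le> B * D" using B1 D by (intro mult_right_mono) auto
  finally have "0 < B" using D by (simp add: zero_less_mult_iff)
  then have "0 < \<alpha> * B" using \<alpha> by simp
  moreover have "(s - w * \<alpha>)\<^sup>2 - (s0 + w * \<alpha>)\<^sup>2 - (1 - 4 * \<alpha>) * (s\<^sup>2 + 4 * \<alpha> * D + 4 * \<alpha>\<^sup>2) = \<alpha> * B + (\<alpha> * D\<^sup>2 - s0\<^sup>2)"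
  proof -
    have "(s - w * \<alpha>)\<^sup>2 = s\<^sup>2 - 2 * w * \<alpha> * s + w\<^sup>2 * \<alpha>\<^sup>2" "(s0 + w * \<alpha>)\<^sup>2 = s0\<^sup>2 + 2 * w * \<alpha> * s0 + w\<^sup>2 * \<alpha>\<^sup>2"
      by (simp_all add: power2_eq_square algebra_simps)
    then show ?thesis unfolding B_def by (simp add: power2_eq_square algebra_simps)
  qed
  ultimately show ?thesis using 1 s0(2) unfolding w_def[symmetric] by linarith
qed

lemma measure_preimage_le:
  assumes f: "f \<in> M \<rightarrow>\<^sub>M N" and d: "distr M N f = N" and A: "A \<in> sets N" and m: "measure N A \<le> c"
  shows "{\<omega> \<in> space M. f \<omega> \<in> A} \<in> sets M" "measure M {\<omega> \<in> space M. f \<omega> \<in> A} \<le> c"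
proof -
  have e: "{\<omega> \<in> space M. f \<omega> \<in> A} = f -` A \<inter> space M" by auto
  show "{\<omega> \<in> space M. f \<omega> \<in> A} \<in> sets M" unfolding e by (rule measurable_sets[OF f A])
  show "measure M {\<omega> \<in> space M. f \<omega> \<in> A} \<le> c"
    unfolding e measure_distr[OF f A, symmetric] d by (rule m)
qed

theorem proposition2:
  fixes M :: "'w measure"
    and m n p q :: nat
    and X A :: "real mat"
    and E Y :: "'w \<Rightarrow> real mat"
    and Ahat :: "nat \<Rightarrow> 'w \<Rightarrow> real mat"
    and rhat :: "'w \<Rightarrow> nat"
    and \<sigma> K \<alpha> :: real
  assumes "prob_space M"
    and "0 < m" and "0 < n" and "0 < p"
    and "X \<in> carrier_mat m p" and "vec_space.rank m X = q"
    and "0 < \<sigma>"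
    and "A \<in> carrier_mat p n"
    and "std_gaussian_matrix M m n E"
    and "\<And>\<omega>. \<omega> \<in> space M \<Longrightarrow> Y \<omega> = X * A + \<sigma> \<cdot>\<^sub>m E \<omega>"
    and "\<And>r \<omega>. r \<in> {1..min n q - 1} \<Longrightarrow> \<omega> \<in> space M \<Longrightarrow>
           rank_restricted_lse p n r X (Y \<omega>) (Ahat r \<omega>)"
    and "A = 0\<^sub>m p n"
    and "0 \<le> K" and "K < 1"
    and "{1..min n q - 1} \<noteq> {}"
    and "rhat \<in> measurable M (count_space UNIV)"
    and "\<And>\<omega>. \<omega> \<in> space M \<Longrightarrow>
           is_arg_min (crit' K m n q X (Y \<omega>) (\<lambda>r. Ahat r \<omega>))
             (\<lambda>r. r \<in> {1..min n q - 1}) (rhat \<omega>)"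
    and "\<alpha> = (1 - K) / 4"
  shows "\<P>(\<omega> in M. real (rhat \<omega>) \<ge>
             (1 - K) / 8 * ((real n * real q - 1) / (sqrt (real n) + sqrt (real q))\<^sup>2))
         \<ge> 1 - 2 * exp (\<alpha>\<^sup>2 / 2) *
               (exp (- (\<alpha>\<^sup>2 * real (max n q) / 2)) /
                (1 - exp (- (\<alpha>\<^sup>2 * real (max n q) / 2))))"
proof -
  interpret prob_space M by fact
  note X = assms(5) and \<sigma> = assms(7) and E = assms(9) and lse = assms(11) and K = assms(13,14)
    and rhat = assms(17) and \<alpha>_def = assms(18)
  define d N where "d = min n q" and "N = max n q"
  define x where "x = exp (- (\<alpha>\<^sup>2 * real N / 2))"
  define b where "b = (1 - K) / 8 * ((real n * real q - 1) / (sqrt (real n) + sqrt (real q))\<^sup>2)"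
  define event where "event = {\<omega> \<in> space M. b \<le> real (rhat \<omega>)}"
  have d2: "2 \<le> d" using assms(15) by (auto simp: d_def)
  then have qn: "0 < q" "0 < n" "d \<le> n" "d \<le> q" "d \<le> N" "real d * real N = real n * real q"
    by (auto simp: d_def N_def min_def max_def split: if_splits)
  \<comment> \<open>The sign condition on \<open>K\<close> enters as
    \<open>\<alpha> <= 1 / 4\<close>.\<close>
  have "0 < \<alpha> \<and> \<alpha> \<le> 1 / 4 \<and> K = 1 - 4 * \<alpha>" using K \<alpha>_def by argo
  then have \<alpha>: "0 < \<alpha>" "\<alpha> \<le> 1 / 4" "K = 1 - 4 * \<alpha>" by auto
  have x: "0 < x" "x < 1" using \<alpha> qn by (auto simp: x_def N_def)
  have evM: "event \<in> sets M" unfolding event_def using assms(16) by measurable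
  have rhat_in: "rhat \<omega> \<in> {1..d - 1}" if "\<omega> \<in> space M" for \<omega>
    using rhat[OF that] by (simp add: is_arg_min_def d_def)
  \<comment> \<open>Two terms of the geometric series, \<open>x / (1 - x) >= x + x^2\<close>: the
    claim leaves room for two events of probability \<open>x\<close> and a third one of probability
    \<open>x^2\<close>.\<close>
  have target: "1 - 2 * exp (\<alpha>\<^sup>2 / 2) * (x / (1 - x)) \<le> 1 - (2 * x + x\<^sup>2)"
  proof -
    have "2 * x + x\<^sup>2 \<le> 2 * (x * (1 + x))" by (simp add: power2_eq_square algebra_simps)
    also have "\<dots> \<le> 2 * (x / (1 - x))"
    proof -
      have "x * (1 + x) * (1 - x) \<le> x * 1"
        unfolding mult.assoc using x by (intro mult_left_mono) (auto simp: algebra_simps)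
      then show ?thesis using x by (simp add: pos_le_divide_eq)
    qed
    also have "\<dots> = 1 * (2 * (x / (1 - x)))" by simp
    also have "\<dots> \<le> exp (\<alpha>\<^sup>2 / 2) * (2 * (x / (1 - x)))"
      using x by (intro mult_right_mono) auto
    finally show ?thesis by simp
  qed
  have "1 - (2 * x + x\<^sup>2) \<le> prob event"
  proof (cases "b \<le> 1")
    case True
    \<comment> \<open>A threshold of at most 1 is met by every admissible rank.\<close>
    have "event = space M" unfolding event_def using True rhat_in by fastforce
    moreover have "0 \<le> 2 * x + x\<^sup>2" using x by simp
    ultimately show ?thesis by (simp add: prob_space)
  next
    case False
    then have b1: "1 < b" by simp
    define Q where "Q = (sqrt (real n) + sqrt (real q))\<^sup>2"
    have NQ: "real N \<le> Q"
    proof -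
      have "sqrt (real N) \<le> sqrt (real n) + sqrt (real q)" by (auto simp: N_def max_def)
      then have "(sqrt (real N))\<^sup>2 \<le> Q" unfolding Q_def by (intro power_mono) auto
      then show ?thesis by simp
    qed
    have N0: "0 < real N" and Q0: "0 < Q" using qn NQ by (auto simp: N_def)
    \<comment> \<open>Here \<open>(1 - K) / 8\<close> is \<open>\<alpha> / 2\<close>, and the factor
      2 on the left is that of the bound on the mean squared operator norm.\<close>
    have bQ: "b * (2 * Q) = \<alpha> * (real d * real N - 1)"
      unfolding b_def Q_def[symmetric] qn(6) using Q0 by (simp add: \<alpha>_def field_simps)
    \<comment> \<open>A nontrivial threshold forces \<open>\<alpha> * d > 2\<close> and thus a large
      \<open>d\<close>, as \<open>selection_inequality\<close> demands.\<close>
    have "1 * (2 * real N) < b * (2 * Q)"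
      using b1 NQ N0 by (intro mult_less_le_imp_less) auto
    also have "\<dots> \<le> \<alpha> * real d * real N" unfolding bQ using \<alpha> by (simp add: algebra_simps)
    finally have \<alpha>d: "2 < \<alpha> * real d" using N0 by simp
    have "\<alpha> * real d \<le> 1 / 4 * real d" using \<alpha> by (intro mult_right_mono) auto
    then have d9: "9 \<le> d" using \<alpha>d by linarith
    have bd: "b < real d"
    proof -
      have "b * (2 * real N) \<le> b * (2 * Q)" using NQ b1 by (intro mult_left_mono) auto
      also have "\<dots> \<le> \<alpha> * (real d * real N)" unfolding bQ using \<alpha> by (intro mult_left_mono) auto
      also have "\<dots> < 2 * (real d * real N)" using \<alpha> d2 N0 by (intro mult_strict_right_mono) auto
      finally have "b * (2 * real N) < real d * (2 * real N)" by (simp add: mult_ac)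
      then show ?thesis using N0 by simp
    qed
    \<comment> \<open>The largest integer strictly below \<open>b\<close>: the event fails exactly
      when the selected rank is less than \<open>b\<close>.\<close>
    define r0 where "r0 = nat \<lceil>b\<rceil> - 1"
    define rs where "rs = d - 1"
    have r0: "real r0 < b" "r0 \<le> n" and below: "k \<le> r0" if "real k < b" for k
      using b1 bd qn that unfolding r0_def by linarith+
    have rs: "rs \<in> {1..min n q - 1}" "rs \<le> n" "rs \<le> q" using d2 qn by (auto simp: rs_def d_def)
    obtain R T T' where R: "R \<in> rotations m 0" and qm: "q \<le> m" and T: "T \<in> carrier_mat q p" "T' \<in> carrier_mat p q" "T * T' = 1\<^sub>m q"
      and key: "\<forall>n. \<forall>E\<in>carrier_mat m n. \<forall>B\<in>carrier_mat p n. (hs_norm (E - X * B))\<^sup>2 =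
        (hs_norm E)\<^sup>2 - (hs_norm (top_rows q (R * E)))\<^sup>2 + (hs_norm (top_rows q (R * E) - T * B))\<^sup>2"
      by (rule design_reduction[OF X assms(6)])
    define G where "G \<omega> = top_rows q (R * E \<omega>)" for \<omega>
    have Ec: "E \<omega> \<in> carrier_mat m n" and Gc: "G \<omega> \<in> carrier_mat q n" if "\<omega> \<in> space M" for \<omega>
    proof -
      show "E \<omega> \<in> carrier_mat m n" using E that by (auto simp: std_gaussian_matrix_def)
      then show "G \<omega> \<in> carrier_mat q n"
        unfolding G_def using rotations_carrier[OF R] by (intro top_rows_carrier) auto
    qed
    define S where "S r = gauss_ky_fan q n r" for r
    \<comment> \<open>With tails \<open>exp (- t^2 / 4)\<close>, the deviation
      \<open>sqrt 2 * \<tau>\<close> has probability at most \<open>x\<close> and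
      \<open>2 * \<tau>\<close> at most \<open>x^2\<close>.\<close>
    define \<tau> where "\<tau> = \<alpha> * sqrt (real N)"
    have \<tau>: "0 \<le> \<tau>" "\<tau>\<^sup>2 = \<alpha>\<^sup>2 * real N" using \<alpha> by (auto simp: \<tau>_def power_mult_distrib)
    have x_eq: "exp (- (sqrt 2 * \<tau>)\<^sup>2 / 4) = x" "exp (- (2 * \<tau>)\<^sup>2 / 4) = x\<^sup>2"
      by (simp_all add: power_mult_distrib \<tau>(2) x_def exp_double[symmetric])
    define h0 where "h0 = (LINT g|gauss_mat m n. hs_norm (mat m n g))"
    have mg: "(\<lambda>\<omega>. mat_entries q n (G \<omega>)) \<in> M \<rightarrow>\<^sub>M gauss_mat q n"
      "distr M (gauss_mat q n) (\<lambda>\<omega>. mat_entries q n (G \<omega>)) = gauss_mat q n"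
      unfolding G_def by (rule distr_top_rows_rotation[OF assms(1-3) E R qm])+
    note me = std_gaussian_matrix_distr[OF assms(1-3) E]
    define A1 where "A1 = {g \<in> space (gauss_mat q n). ky_fan2 rs (mat q n g) \<le> S rs - sqrt 2 * \<tau>}"
    define A2 where "A2 = {g \<in> space (gauss_mat q n). S r0 + sqrt 2 * \<tau> \<le> ky_fan2 r0 (mat q n g)}"
    define A3 where "A3 = {g \<in> space (gauss_mat m n). h0 + 2 * \<tau> \<le> hs_norm (mat m n g)}"
    have r0n: "r0 \<le> n" using r0(2)[of 0] b1 by simp
    have fin: "finite ({..<q} \<times> {..<n})" "finite ({..<m} \<times> {..<n})" by auto
    note L1 = lipschitz_L2_ky_fan2[OF rs(2), of q] and L2 = lipschitz_L2_ky_fan2[OF r0n, of q]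
      and L3 = lipschitz_L2_hs_norm[of m n]
    note meas [measurable] = lipschitz_L2_measurable[OF fin(1) L1] lipschitz_L2_measurable[OF fin(1) L2]
      lipschitz_L2_measurable[OF fin(2) L3]
    have A: "A1 \<in> sets (gauss_mat q n)" "A2 \<in> sets (gauss_mat q n)" "A3 \<in> sets (gauss_mat m n)"
      unfolding A1_def A2_def A3_def by measurable
    have m1: "measure (gauss_mat q n) A1 \<le> x"
      unfolding A1_def S_def gauss_ky_fan_eq x_eq(1)[symmetric]
      by (rule gauss_lipschitz_lower_tail[OF fin(1) L1]) (use \<tau> in simp)
    have m2: "measure (gauss_mat q n) A2 \<le> x"
      unfolding A2_def S_def gauss_ky_fan_eq x_eq(1)[symmetric]
      by (rule gauss_lipschitz_upper_tail[OF fin(1) L2]) (use \<tau> in simp)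
    have m3: "measure (gauss_mat m n) A3 \<le> x\<^sup>2"
      unfolding A3_def h0_def x_eq(2)[symmetric]
      by (rule gauss_lipschitz_upper_tail[OF fin(2) L3]) (use \<tau> in simp)
    define B1 where "B1 = {\<omega> \<in> space M. mat_entries q n (G \<omega>) \<in> A1}"
    define B2 where "B2 = {\<omega> \<in> space M. mat_entries q n (G \<omega>) \<in> A2}"
    define B3 where "B3 = {\<omega> \<in> space M. mat_entries m n (E \<omega>) \<in> A3}"
    have B: "B1 \<in> sets M" "prob B1 \<le> x" "B2 \<in> sets M" "prob B2 \<le> x" "B3 \<in> sets M" "prob B3 \<le> x\<^sup>2"
      unfolding B1_def B2_def B3_def
      using measure_preimage_le[OF mg A(1) m1] measure_preimage_le[OF mg A(2) m2] measure_preimage_le[OF me A(3) m3]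
      by auto
    have good: "\<omega> \<in> event" if \<omega>: "\<omega> \<in> space M" "\<omega> \<notin> B1" "\<omega> \<notin> B2" "\<omega> \<notin> B3" for \<omega>
    proof (rule ccontr)
      assume "\<omega> \<notin> event"
      then have rb: "real (rhat \<omega>) < b" using \<omega>(1) by (simp add: event_def)
      then have rr0: "rhat \<omega> \<le> r0" by (rule below)
      define k where "k = rhat \<omega>"
      have k: "k \<in> {1..min n q - 1}" "k \<le> r0" "k \<le> n" using rhat_in[OF \<omega>(1)] rr0 r0n by (auto simp: k_def d_def)
      have Gg: "mat q n (mat_entries q n (G \<omega>)) = G \<omega>" "mat_entries q n (G \<omega>) \<in> space (gauss_mat q n)"
        using mat_mat_entries[OF Gc[OF \<omega>(1)]] measurable_space[OF mg(1) \<omega>(1)] by auto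
      have Ee: "mat m n (mat_entries m n (E \<omega>)) = E \<omega>" "mat_entries m n (E \<omega>) \<in> space (gauss_mat m n)"
        using mat_mat_entries[OF Ec[OF \<omega>(1)]] measurable_space[OF me(1) \<omega>(1)] by auto
      have F1: "S rs - sqrt 2 * \<tau> < ky_fan2 rs (G \<omega>)"
        using \<omega>(1,2) Gg unfolding B1_def A1_def by auto
      have F2: "ky_fan2 r0 (G \<omega>) < S r0 + sqrt 2 * \<tau>"
        using \<omega>(1,3) Gg unfolding B2_def A2_def by auto
      have F3: "hs_norm (E \<omega>) < h0 + 2 * \<tau>"
        using \<omega>(1,4) Ee unfolding B3_def A3_def by auto
      define a where "a = real n * real m"
      define e where "e = (hs_norm (E \<omega>))\<^sup>2"
      define f where "f r = (ky_fan2 r (G \<omega>))\<^sup>2" for r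
      have a0: "0 < a" and aN: "real d * real N \<le> a"
        using qm qn assms(2,3) unfolding qn(6) a_def by (auto intro: mult_left_mono)
      have Sq: "(S r)\<^sup>2 \<le> real d * real N" if "r \<le> n" for r
        using gauss_ky_fan_sq_le[OF that, of q] qn(6) by (simp add: S_def mult.commute)
      have uK: "0 \<le> K * (S r)\<^sup>2 / a" "K * (S r)\<^sup>2 / a < 1" if "r \<le> n" for r
      proof -
        show "0 \<le> K * (S r)\<^sup>2 / a" using K a0 by simp
        have "K * (S r)\<^sup>2 \<le> K * a" using Sq[OF that] aN K by (intro mult_left_mono) auto
        also have "\<dots> < 1 * a" using K a0 by (intro mult_strict_right_mono) auto
        finally show "K * (S r)\<^sup>2 / a < 1" using a0 by simp
      qed
      have Y: "Y \<omega> = \<sigma> \<cdot>\<^sub>m E \<omega>"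
        using assms(10)[OF \<omega>(1)] assms(12) X Ec[OF \<omega>(1)] by simp
      have rss: "(hs_norm (Y \<omega> - X * Ahat r \<omega>))\<^sup>2 = \<sigma>\<^sup>2 * (e - f r)" if "r \<in> {1..min n q - 1}" for r
        unfolding Y e_def f_def
      proof (rule rank_restricted_lse_rss[OF X T _ Ec[OF \<omega>(1)] Gc[OF \<omega>(1)] \<sigma>])
        show "\<forall>B\<in>carrier_mat p n. (hs_norm (E \<omega> - X * B))\<^sup>2 =
            (hs_norm (E \<omega>))\<^sup>2 - (hs_norm (G \<omega>))\<^sup>2 + (hs_norm (G \<omega> - T * B))\<^sup>2"
          unfolding G_def using key Ec[OF \<omega>(1)] by blast
        show "r \<le> n" using that by auto
        show "rank_restricted_lse p n r X (\<sigma> \<cdot>\<^sub>m E \<omega>) (Ahat r \<omega>)"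
          using lse[OF that \<omega>(1)] unfolding Y .
      qed
      have ef: "0 \<le> e - f r" if "r \<in> {1..min n q - 1}" for r
      proof -
        have "0 \<le> \<sigma>\<^sup>2 * (e - f r)" unfolding rss[OF that, symmetric] by simp
        then show ?thesis using \<sigma> by (simp add: zero_le_mult_iff)
      qed
      have crit: "crit' K m n q X (Y \<omega>) (\<lambda>r. Ahat r \<omega>) r = \<sigma>\<^sup>2 * (e - f r) * (1 / (1 - K * (S r)\<^sup>2 / a))"
        if "r \<in> {1..min n q - 1}" for r
        using one_plus_penalty[OF a0 uK(2), of r] that rss[OF that]
        unfolding crit'_def pen'_def S_def[symmetric] a_def[symmetric] by auto
      have "crit' K m n q X (Y \<omega>) (\<lambda>r. Ahat r \<omega>) k \<le> crit' K m n q X (Y \<omega>) (\<lambda>r. Ahat r \<omega>) rs"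
        using rhat[OF \<omega>(1)] rs(1) unfolding is_arg_min_def k_def by (auto simp: not_less)
      then have c: "(e - f k) * (1 / (1 - K * (S k)\<^sup>2 / a)) \<le> (e - f rs) * (1 / (1 - K * (S rs)\<^sup>2 / a))"
        unfolding crit[OF k(1)] crit[OF rs(1)] mult.assoc
        by (rule mult_left_le_imp_le) (use \<sigma> in simp)
      define u where "u = K * (S rs)\<^sup>2 / a"
      have u: "0 \<le> u" "u < 1" using uK[OF rs(2)] by (auto simp: u_def)
      \<comment> \<open>The penalty factor of the selected rank is at least 1 and may be
        dropped.\<close>
      have "(e - f k) * 1 \<le> (e - f k) * (1 / (1 - K * (S k)\<^sup>2 / a))"
        using ef[OF k(1)] uK[OF k(3)] by (intro mult_left_mono) auto
      also note c
      finally have "e - f k \<le> (e - f rs) / (1 - u)" by (simp add: u_def)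
      then have "(e - f k) * (1 - u) \<le> e - f rs" using u by (simp add: pos_le_divide_eq)
      moreover have "0 \<le> u * f k" using u by (simp add: f_def)
      ultimately have "f rs \<le> f k + u * e" by (simp add: algebra_simps)
      \<comment> \<open>Monotonicity in the rank lets the single event at \<open>r0\<close> account
        for all ranks below the threshold, without a union bound.\<close>
      also have "f k \<le> f r0" unfolding f_def by (intro power_mono ky_fan2_mono k ky_fan2_nonneg)
      finally have main: "f rs \<le> f r0 + u * e" by simp
      define D where "D = sqrt (real d)"
      define s where "s = S rs / sqrt (real N)"
      define s0 where "s0 = S r0 / sqrt (real N)"
      define A where "A = sqrt (a / real N)"
      have D2: "D\<^sup>2 = real d" "3 \<le> D" "0 \<le> D"
        using d9 by (auto simp: D_def intro!: real_le_rsqrt)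
      have S0: "0 \<le> S r" for r by (simp add: S_def gauss_ky_fan_nonneg)
      have s2: "s\<^sup>2 = (S rs)\<^sup>2 / real N" "s0\<^sup>2 = (S r0)\<^sup>2 / real N" "0 \<le> s" "0 \<le> s0"
        by (auto simp: s_def s0_def power_divide S0)
      have A2: "A\<^sup>2 = a / real N" "0 < A" using a0 N0 by (auto simp: A_def)
      have sD: "s \<le> D"
        by (rule power2_le_imp_le[OF _ D2(3)]) (use Sq[OF rs(2)] N0 in \<open>simp add: s2 D2 pos_divide_le_eq\<close>)
      \<comment> \<open>The rank \<open>d - 1\<close> in place of \<open>d\<close> loses 1, and the
        correction of the second moment loses \<open>7 / N <= 7 / 9\<close>.\<close>
      have sl: "D\<^sup>2 - 16 / 9 \<le> s\<^sup>2"
      proof -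
        have "real rs * real N \<le> (S rs)\<^sup>2 + 7" using gauss_ky_fan_sq_ge[OF rs(2,3)] by (simp add: S_def N_def)
        moreover have "real rs = real d - 1" using d2 by (simp add: rs_def of_nat_diff)
        moreover have "9 \<le> real N" using d9 qn(5) by linarith
        ultimately have "(D\<^sup>2 - 16 / 9) * real N \<le> (S rs)\<^sup>2" by (simp add: D2 algebra_simps)
        then show ?thesis using N0 by (simp add: s2 pos_le_divide_eq)
      qed
      have s0D: "s0\<^sup>2 \<le> \<alpha> * D\<^sup>2"
      proof -
        have "(S r0)\<^sup>2 \<le> real r0 * (2 * Q)"
          using gauss_ky_fan_sq_le_dims[OF r0n qn(1,2)] by (simp add: S_def Q_def add.commute)
        also have "\<dots> \<le> b * (2 * Q)" using r0(1)[OF rb] Q0 by (intro mult_right_mono) auto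
        also have "\<dots> \<le> \<alpha> * real d * real N" unfolding bQ using \<alpha> by (simp add: algebra_simps)
        finally show ?thesis using N0 by (simp add: s2 D2 pos_divide_le_eq)
      qed
      have DA: "D \<le> A"
        by (rule power2_le_imp_le) (use aN N0 A2 in \<open>simp_all add: D2 pos_le_divide_eq\<close>)
      have ineq: "(s0 + sqrt 2 * \<alpha>)\<^sup>2 + (1 - 4 * \<alpha>) * s\<^sup>2 * (1 + 2 * \<alpha> / A)\<^sup>2 < (s - sqrt 2 * \<alpha>)\<^sup>2"
        by (rule selection_inequality[OF D2(2) \<alpha>(1,2) _ s2(3) sD sl s2(4) s0D DA]) (use \<alpha>d in \<open>simp add: D2\<close>)
      have sN: "S rs = sqrt (real N) * s" "S r0 = sqrt (real N) * s0" using N0 by (auto simp: s_def s0_def)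
      \<comment> \<open>Squaring the lower bound requires it to be nonnegative:
        \<open>s^2 >= 9 - 16 / 9\<close> gives \<open>s >= 2\<close>, while
        \<open>sqrt 2 * \<alpha> <= 1 / 2\<close>.\<close>
      have f1: "real N * (s - sqrt 2 * \<alpha>)\<^sup>2 \<le> f rs"
      proof -
        have "sqrt 2 * \<alpha> \<le> 2 * (1 / 4)" using \<alpha> by (intro mult_mono real_le_lsqrt) auto
        moreover have "2 \<le> s"
          by (rule power2_le_imp_le) (use sl D2 d9 s2 in auto)
        ultimately have "0 \<le> s - sqrt 2 * \<alpha>" by simp
        then have "0 \<le> sqrt (real N) * (s - sqrt 2 * \<alpha>)" by simp
        moreover have "sqrt (real N) * (s - sqrt 2 * \<alpha>) \<le> ky_fan2 rs (G \<omega>)"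
          using F1 by (simp add: sN \<tau>_def algebra_simps)
        ultimately have "(sqrt (real N) * (s - sqrt 2 * \<alpha>))\<^sup>2 \<le> f rs" unfolding f_def by (intro power_mono)
        then show ?thesis by (simp add: power_mult_distrib)
      qed
      have f2: "f r0 \<le> real N * (s0 + sqrt 2 * \<alpha>)\<^sup>2"
      proof -
        have "ky_fan2 r0 (G \<omega>) \<le> sqrt (real N) * (s0 + sqrt 2 * \<alpha>)"
          using F2 by (simp add: sN \<tau>_def algebra_simps)
        then have "f r0 \<le> (sqrt (real N) * (s0 + sqrt 2 * \<alpha>))\<^sup>2"
          unfolding f_def by (intro power_mono ky_fan2_nonneg)
        then show ?thesis by (simp add: power_mult_distrib)
      qed
      have f3: "u * e \<le> real N * ((1 - 4 * \<alpha>) * s\<^sup>2 * (1 + 2 * \<alpha> / A)\<^sup>2)"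
      proof -
        have sa: "sqrt a = sqrt (real N) * A" using N0 by (simp add: A_def real_sqrt_divide)
        have "h0 \<le> sqrt a" unfolding h0_def a_def using expectation_hs_norm_le[of m n] by (simp add: mult.commute)
        then have "hs_norm (E \<omega>) \<le> sqrt (real N) * (A + 2 * \<alpha>)"
          using F3 by (simp add: sa \<tau>_def algebra_simps)
        then have "e \<le> (sqrt (real N) * (A + 2 * \<alpha>))\<^sup>2"
          unfolding e_def by (intro power_mono hs_norm_nonneg)
        then have "u * e \<le> u * (real N * (A + 2 * \<alpha>)\<^sup>2)"
          using u by (intro mult_left_mono) (simp_all add: power_mult_distrib)
        also have "\<dots> = real N * ((1 - 4 * \<alpha>) * s\<^sup>2 * ((A + 2 * \<alpha>)\<^sup>2 / A\<^sup>2))"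
        proof -
          have "u = (1 - 4 * \<alpha>) * s\<^sup>2 / A\<^sup>2"
            using N0 a0 by (simp add: u_def \<alpha>(3) s2 A2)
          then show ?thesis by simp
        qed
        also have "(A + 2 * \<alpha>)\<^sup>2 / A\<^sup>2 = (1 + 2 * \<alpha> / A)\<^sup>2"
          using A2(2) by (simp add: power_divide[symmetric] add_divide_distrib)
        finally show ?thesis .
      qed
      have "real N * (s - sqrt 2 * \<alpha>)\<^sup>2 \<le> real N * ((s0 + sqrt 2 * \<alpha>)\<^sup>2 + (1 - 4 * \<alpha>) * s\<^sup>2 * (1 + 2 * \<alpha> / A)\<^sup>2)"
        using main f1 f2 f3 unfolding distrib_left by linarith
      then show False using ineq N0 by simp
    qed
    have "prob (space M - event) \<le> prob (B1 \<union> B2 \<union> B3)"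
      by (rule finite_measure_mono) (use good B in auto)
    also have "\<dots> \<le> prob B1 + prob B2 + prob B3"
      using measure_Un_le[of "B1 \<union> B2" M B3] measure_Un_le[of B1 M B2] B by auto
    also have "\<dots> \<le> 2 * x + x\<^sup>2" using B by simp
    finally show ?thesis using prob_compl[OF evM] by simp
  qed
  then show ?thesis
    using target unfolding event_def b_def x_def N_def by simp
qed

end
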